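(* Let $\mathcal E\subset M^{(2)}$ be a Goursat-type third-order Monge–Ampère equation and let $f\in C^\infty(M^{(1)})$. Then the following statements are equivalent: (a) $f$ is an intermediate integral of $\mathcal E$; (b) there exists a 3-dimensional distribution $\mathcal D\subset\mathcal C^1$ such that $f$ is a first integral of $\mathcal D$ and $\mathcal E_{\mathcal D}=\mathcal E$.
   Context: Setting. Everything is smooth. $(M,\mathcal C)$ is a 5-dimensional contact manifold, locally $\mathcal C=\ker\theta$ with $\theta\wedge d\theta\wedge d\theta\neq0$. $\pi:M^{(1)}\to M$ is the bundle of Lagrangian (maximally $d\theta$-isotropic) 2-planes of the spaces $\mathcal C_m$; a point $m^1\in M^{(1)}$ viewed as a plane is denoted $L_{m^1}\subset\mathcal C_{\pi(m^1)}$. $M^{(1)}$ (dimension 8) carries the rank-5 distribution $\mathcal C^1_{m^1}=\{\nu\in T_{m^1}M^{(1)} : \pi_*\nu\in L_{m^1}\}$. $\pi_{2,1}:M^{(2)}\to M^{(1)}$ is the bundle of Lagrangian planes of $M^{(1)}$: the 2-dimensional $\pi$-horizontal subspaces $L_{m^2}\subset T_{m^1}M^{(1)}$ on which all forms in the differential ideal generated by the 1-forms vanishing on $\mathcal C^1$ vanish. In contact coordinates $(x^i,u,p_i)$ on $M$ ($\theta=du-p_idx^i$, $i=1,2$), $M^{(1)}$ has coordinates $(x^i,u,p_i,p_{11},p_{12},p_{22})$, $\mathcal C^1=\langle D_1,D_2,\partial_{p_{11}},\partial_{p_{12}},\partial_{p_{22}}\rangle$ with $D_i=\partial_{x^i}+p_i\partial_u+p_{ij}\partial_{p_j}$,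 and $M^{(2)}$ has further coordinates $p_{111},p_{112},p_{122},p_{222}$ with $L_{m^2}=\langle D_1+p_{111}\partial_{p_{11}}+p_{112}\partial_{p_{12}}+p_{122}\partial_{p_{22}},\ D_2+p_{112}\partial_{p_{11}}+p_{122}\partial_{p_{12}}+p_{222}\partial_{p_{22}}\rangle$. When $m^1,m^2$ appear together, $m^1=\pi_{2,1}(m^2)$. Third-order PDE: a codimension-one sub-bundle $\mathcal E\subset M^{(2)}\to M^{(1)}$ (surjecting onto $M^{(1)}$, with connected fibres), locally $\{F=0\}$, possibly with singular points in the fibres. For a 3-dimensional sub-distribution $\mathcal D\subset\mathcal C^1$ put $\mathcal E_{\mathcal D}=\{m^2\in M^{(2)} : L_{m^2}\cap\mathcal D_{m^1}\neq0\}$; a Goursat-type third-order Monge–Ampère equation is a third-order PDE of the form $\mathcal E_{\mathcal D}$. A function $f\in C^\infty(M^{(1)})$ is considered in a neighbourhood of a non-singular point of it. For $c\in\mathbb R$ put $(M^{(1)})_{f-c}=\{m^1 : f(m^1)=c\}$, with prolongation $(M^{(1)})_{f-c}^{(1)}=\{m^2\in M^{(2)} : f(\pi_{2,1}(m^2))=c,\ df|_{L_{m^2}}=0\}$. $f$ is an intermediate integral of $\mathcal E$ if $(M^{(1)})_{f-c}^{(1)}\subseteq\mathcal E$ for all $c\in\mathbb R$. $f$ is a first integral of $\mathcal D$ if $\mathcal D\subseteq\ker df$.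
   Formalization: "Non-singular point" of f is taken to mean that df is nonzero on vectors tangent to the fibres of M^(1) over M; with only df nonzero the equivalence fails, e.g. f = x^1 and E: p111 p122 = p112^2, where all prolonged level sets are empty so (a) is vacuous but (b) fails. *)

theory Defs
  imports "HOL-Analysis.Analysis"
begin

section \<open>Smooth maps, submanifolds and 1-forms\<close>

text \<open>On an open set, a map is \<open>C\<^sup>k\<close> iff it has iterated directional derivatives up to order \<open>k\<close> of this
  kind; all spaces to which this is applied are finite-dimensional.\<close>

primrec Ck_on :: "nat \<Rightarrow> 'a::real_normed_vector set \<Rightarrow> ('a \<Rightarrow> 'b::real_normed_vector) \<Rightarrow> bool" where
  "Ck_on 0 S f \<longleftrightarrow> continuous_on S f"
| "Ck_on (Suc k) S f \<longleftrightarrow>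
     f differentiable_on S \<and> (\<forall>v. Ck_on k S (\<lambda>x. frechet_derivative f (at x) v))"

definition smooth_on :: "'a::real_normed_vector set \<Rightarrow> ('a \<Rightarrow> 'b::real_normed_vector) \<Rightarrow> bool" where
  "smooth_on S f \<longleftrightarrow> open S \<and> (\<forall>k. Ck_on k S f)"

text \<open>Smoothness on a subset that need not be open: local extendability to smooth maps of the
  ambient space.\<close>

definition smooth_fun :: "'a::real_normed_vector set \<Rightarrow> ('a \<Rightarrow> 'b::real_normed_vector) \<Rightarrow> bool" where
  "smooth_fun A f \<longleftrightarrow>
     (\<forall>x\<in>A. \<exists>U g. x \<in> U \<and> smooth_on U g \<and> (\<forall>y\<in>A \<inter> U. g y = f y))"

text \<open>Manifolds are embedded submanifolds of a Euclidean space (no loss of generality, by Whitney's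
  embedding theorem), described by slice charts. This makes tangent vectors elements of the ambient
  space.\<close>

definition submanifold :: "nat \<Rightarrow> 'a::euclidean_space set \<Rightarrow> bool" where
  "submanifold d M \<longleftrightarrow>
     (\<forall>x\<in>M. \<exists>U V \<Phi> \<Psi> S. x \<in> U \<and> smooth_on U \<Phi> \<and> smooth_on V \<Psi> \<and> \<Phi> ` U = V \<and> \<Psi> ` V = U \<and>
        (\<forall>y\<in>U. \<Psi> (\<Phi> y) = y) \<and> (\<forall>z\<in>V. \<Phi> (\<Psi> z) = (z::'a)) \<and>
        subspace S \<and> dim S = d \<and> \<Phi> ` (M \<inter> U) = V \<inter> S)"

definition curve_at :: "'a::real_normed_vector set \<Rightarrow> 'a \<Rightarrow> (real \<Rightarrow> 'a) \<Rightarrow> bool" where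
  "curve_at A x \<gamma> \<longleftrightarrow>
     \<gamma> 0 = x \<and> (\<exists>\<epsilon>>0. smooth_on {-\<epsilon><..<\<epsilon>} \<gamma> \<and> \<gamma> ` {-\<epsilon><..<\<epsilon>} \<subseteq> A)"

definition tangent_space :: "'a::real_normed_vector set \<Rightarrow> 'a \<Rightarrow> 'a set" where
  "tangent_space A x = {v. \<exists>\<gamma>. curve_at A x \<gamma> \<and> (\<gamma> has_vector_derivative v) (at 0)}"

text \<open>The value \<open>df\<^sub>x(v)\<close> for a function \<open>f\<close> of which only the restriction to \<open>A\<close> matters and
  \<open>v\<close> tangent to \<open>A\<close> at \<open>x\<close>.\<close>

definition differential :: "'a::real_normed_vector set \<Rightarrow> ('a \<Rightarrow> real) \<Rightarrow> 'a \<Rightarrow> 'a \<Rightarrow> real" where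
  "differential A f x v =
     (THE c. \<exists>\<gamma>. curve_at A x \<gamma> \<and> (\<gamma> has_vector_derivative v) (at 0) \<and>
                 ((\<lambda>t. f (\<gamma> t)) has_real_derivative c) (at 0))"

text \<open>The exterior derivative of the 1-form \<open>\<theta>\<close>, as an alternating bilinear form at \<open>x\<close>.\<close>

definition ext_deriv ::
    "('a::real_normed_vector \<Rightarrow> ('a \<Rightarrow>\<^sub>L real)) \<Rightarrow> 'a \<Rightarrow> 'a \<Rightarrow> 'a \<Rightarrow> real" where
  "ext_deriv \<theta> x v w =
     blinfun_apply (frechet_derivative \<theta> (at x) v) w - blinfun_apply (frechet_derivative \<theta> (at x) w) v"

text \<open>The value of \<open>\<alpha> \<and> \<omega> \<and> \<omega>\<close> on \<open>e 0, \<dots>, e 4\<close>, up to a positive normalisation constant.\<close>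

definition wedge_1_2_2 ::
    "('a \<Rightarrow> real) \<Rightarrow> ('a \<Rightarrow> 'a \<Rightarrow> real) \<Rightarrow> (nat \<Rightarrow> 'a) \<Rightarrow> real" where
  "wedge_1_2_2 \<alpha> \<omega> e =
     (\<Sum>\<sigma> | \<sigma> permutes {..<5}. real_of_int (sign \<sigma>) *
        \<alpha> (e (\<sigma> 0)) * \<omega> (e (\<sigma> 1)) (e (\<sigma> 2)) * \<omega> (e (\<sigma> 3)) (e (\<sigma> 4)))"

section \<open>Contact manifolds and their prolongations\<close>

definition local_contact_form ::
    "'a::euclidean_space set \<Rightarrow> ('a \<Rightarrow> 'a set) \<Rightarrow> 'a set \<Rightarrow> ('a \<Rightarrow> ('a \<Rightarrow>\<^sub>L real)) \<Rightarrow> bool" where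
  "local_contact_form M C U \<theta> \<longleftrightarrow> smooth_on U \<theta> \<and>
     (\<forall>x\<in>M \<inter> U. C x = {v \<in> tangent_space M x. blinfun_apply (\<theta> x) v = 0} \<and>
        (\<exists>e. (\<forall>i. e i \<in> tangent_space M x) \<and>
             wedge_1_2_2 (blinfun_apply (\<theta> x)) (ext_deriv \<theta> x) e \<noteq> 0))"

definition contact_manifold5 :: "'a::euclidean_space set \<Rightarrow> ('a \<Rightarrow> 'a set) \<Rightarrow> bool" where
  "contact_manifold5 M C \<longleftrightarrow>
     submanifold 5 M \<and> (\<forall>x\<in>M. \<exists>U \<theta>. x \<in> U \<and> local_contact_form M C U \<theta>)"

text \<open>The restriction of \<open>d\<theta>\<close> to \<open>C x\<close> depends on the local contact form \<open>\<theta>\<close> only up to a nonzero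
  factor. It is nondegenerate on the 4-dimensional space \<open>C x\<close>, so isotropic 2-planes are maximal
  isotropic.\<close>

definition lagrangian_plane ::
    "'a::euclidean_space set \<Rightarrow> ('a \<Rightarrow> 'a set) \<Rightarrow> 'a \<Rightarrow> 'a set \<Rightarrow> bool" where
  "lagrangian_plane M C x L \<longleftrightarrow> subspace L \<and> dim L = 2 \<and> L \<subseteq> C x \<and>
     (\<forall>U \<theta>. x \<in> U \<and> local_contact_form M C U \<theta> \<longrightarrow> (\<forall>v\<in>L. \<forall>w\<in>L. ext_deriv \<theta> x v w = 0))"

text \<open>A plane is encoded by the orthogonal projector onto it, which embeds the Grassmannian of a
  Euclidean space smoothly into the space of its endomorphisms. A point of \<open>M\<^sup>(\<^sup>1\<^sup>)\<close> is thus a pair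
  \<open>(x, P)\<close> with \<open>P\<close> a matrix; \<open>fst\<close> is both the bundle projection to \<open>M\<close> and, being linear, its
  differential.\<close>

type_synonym 'n space1 = "(real, 'n) vec \<times> ((real, 'n) vec, 'n) vec"

definition plane1 :: "('n::finite) space1 \<Rightarrow> (real^'n) set" where
  "plane1 m = range (\<lambda>v. snd m *v v)"

definition prolong1 ::
    "(real^'n) set \<Rightarrow> (real^'n \<Rightarrow> (real^'n) set) \<Rightarrow> ('n::finite) space1 set" where
  "prolong1 M C = {(x, P). x \<in> M \<and> transpose P = P \<and> P ** P = P \<and>
                           lagrangian_plane M C x (plane1 (x, P))}"

definition cartan1 ::
    "(real^'n) set \<Rightarrow> (real^'n \<Rightarrow> (real^'n) set) \<Rightarrow> 'n space1 \<Rightarrow> ('n::finite) space1 set" where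
  "cartan1 M C m = {\<nu> \<in> tangent_space (prolong1 M C) m. fst \<nu> \<in> plane1 m}"

definition annihilator_form ::
    "(real^'n) set \<Rightarrow> (real^'n \<Rightarrow> (real^'n) set) \<Rightarrow>
     'n space1 set \<Rightarrow> ('n space1 \<Rightarrow> (('n::finite) space1 \<Rightarrow>\<^sub>L real)) \<Rightarrow> bool" where
  "annihilator_form M C U \<eta> \<longleftrightarrow> smooth_on U \<eta> \<and>
     (\<forall>y\<in>prolong1 M C \<inter> U. \<forall>\<nu>\<in>cartan1 M C y. blinfun_apply (\<eta> y) \<nu> = 0)"

text \<open>All forms in the differential ideal generated by the annihilator forms vanish on \<open>R\<close> iff its
  algebraic generators, namely the annihilator forms \<open>\<eta>\<close> and their exterior derivatives, do.\<close>

definition lagrangian_plane2 ::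
    "(real^'n) set \<Rightarrow> (real^'n \<Rightarrow> (real^'n) set) \<Rightarrow> 'n space1 \<Rightarrow> ('n::finite) space1 set \<Rightarrow> bool" where
  "lagrangian_plane2 M C m R \<longleftrightarrow> subspace R \<and> dim R = 2 \<and>
     R \<subseteq> tangent_space (prolong1 M C) m \<and> R \<inter> {\<nu>. fst \<nu> = 0} = {0} \<and>
     (\<forall>U \<eta>. m \<in> U \<and> annihilator_form M C U \<eta> \<longrightarrow>
        (\<forall>v\<in>R. blinfun_apply (\<eta> m) v = 0) \<and> (\<forall>v\<in>R. \<forall>w\<in>R. ext_deriv \<eta> m v w = 0))"

text \<open>Again \<open>(m, Q)\<close> stands for the plane \<open>range Q\<close> at \<open>m\<close>, with \<open>Q\<close> an orthogonal projector.\<close>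

type_synonym 'n space2 = "'n space1 \<times> ('n space1 \<Rightarrow>\<^sub>L 'n space1)"

definition plane2 :: "('n::finite) space2 \<Rightarrow> 'n space1 set" where
  "plane2 z = range (blinfun_apply (snd z))"

definition prolong2 ::
    "(real^'n) set \<Rightarrow> (real^'n \<Rightarrow> (real^'n) set) \<Rightarrow> ('n::finite) space2 set" where
  "prolong2 M C = {(m, Q). m \<in> prolong1 M C \<and>
     (\<forall>v w. blinfun_apply Q v \<bullet> w = v \<bullet> blinfun_apply Q w) \<and> Q o\<^sub>L Q = Q \<and>
     lagrangian_plane2 M C m (plane2 (m, Q))}"

section \<open>Third-order equations of Goursat type\<close>

text \<open>Locally \<open>E = {F = 0}\<close>. Codimension one, with singular points allowed in the fibres, means:
  the points of the fibre of \<open>E\<close> over \<open>m\<close> at which the derivative of \<open>F\<close> along the fibre of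
  \<open>M\<^sup>(\<^sup>2\<^sup>)\<close> is nonzero are dense in it.\<close>

definition third_order_pde ::
    "(real^'n) set \<Rightarrow> (real^'n \<Rightarrow> (real^'n) set) \<Rightarrow> ('n::finite) space2 set \<Rightarrow> bool" where
  "third_order_pde M C E \<longleftrightarrow> E \<subseteq> prolong2 M C \<and>
     (\<forall>m\<in>prolong1 M C. (\<exists>Q. (m, Q) \<in> E) \<and> connected {Q. (m, Q) \<in> E}) \<and>
     (\<forall>z\<in>prolong2 M C. \<exists>U F. z \<in> U \<and> smooth_on U (F :: _ \<Rightarrow> real) \<and>
        E \<inter> U = {y \<in> prolong2 M C \<inter> U. F y = 0} \<and>
        (\<forall>m Q. (m, Q) \<in> E \<inter> U \<longrightarrow>
           Q \<in> closure {Q'. (m, Q') \<in> E \<inter> U \<and>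
             (\<exists>B\<in>tangent_space {Q''. (m, Q'') \<in> prolong2 M C} Q'.
                frechet_derivative F (at (m, Q')) (0, B) \<noteq> 0)}))"

text \<open>A smooth 3-dimensional sub-distribution of \<open>cartan1 M C\<close> over a subset \<open>N\<close> of \<open>M\<^sup>(\<^sup>1\<^sup>)\<close>.\<close>

definition subdistribution3 ::
    "(real^'n) set \<Rightarrow> (real^'n \<Rightarrow> (real^'n) set) \<Rightarrow>
     'n space1 set \<Rightarrow> ('n space1 \<Rightarrow> ('n::finite) space1 set) \<Rightarrow> bool" where
  "subdistribution3 M C N D \<longleftrightarrow>
     (\<forall>m\<in>N. dim (D m) = 3 \<and> D m \<subseteq> cartan1 M C m) \<and>
     (\<forall>m\<in>N. \<exists>U X Y Z. m \<in> U \<and> smooth_on U X \<and> smooth_on U Y \<and> smooth_on U Z \<and>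
        (\<forall>y\<in>N \<inter> U. D y = span {X y, Y y, Z y}))"

definition goursat_locus ::
    "(real^'n) set \<Rightarrow> (real^'n \<Rightarrow> (real^'n) set) \<Rightarrow>
     'n space1 set \<Rightarrow> ('n space1 \<Rightarrow> 'n space1 set) \<Rightarrow> ('n::finite) space2 set" where
  "goursat_locus M C N D =
     {z \<in> prolong2 M C. fst z \<in> N \<and> plane2 z \<inter> D (fst z) \<noteq> {0}}"

definition goursat_pde ::
    "(real^'n) set \<Rightarrow> (real^'n \<Rightarrow> (real^'n) set) \<Rightarrow> ('n::finite) space2 set \<Rightarrow> bool" where
  "goursat_pde M C E \<longleftrightarrow> third_order_pde M C E \<and>
     (\<exists>D. subdistribution3 M C (prolong1 M C) D \<and> E = goursat_locus M C (prolong1 M C) D)"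

section \<open>Functions on an open subset of the first prolongation\<close>

text \<open>Non-singularity is understood for \<open>{f = c}\<close> as a second-order equation: its fibre over \<open>M\<close>
  is non-singular at \<open>m\<close>, i.e. \<open>df\<close> does not vanish on the vertical vectors at \<open>m\<close>. The
  condition \<open>df \<noteq> 0\<close> alone would admit functions such as \<open>f = x\<^sup>1\<close>, for which all the prolongations
  of level sets are empty and hence contained in every equation.\<close>

definition nonsingular_at ::
    "(real^'n) set \<Rightarrow> (real^'n \<Rightarrow> (real^'n) set) \<Rightarrow>
     'n space1 set \<Rightarrow> (('n::finite) space1 \<Rightarrow> real) \<Rightarrow> 'n space1 \<Rightarrow> bool" where
  "nonsingular_at M C N f m \<longleftrightarrow>
     (\<exists>\<nu>\<in>tangent_space (prolong1 M C) m. fst \<nu> = 0 \<and> differential N f m \<nu> \<noteq> 0)"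

definition level_prolongation ::
    "(real^'n) set \<Rightarrow> (real^'n \<Rightarrow> (real^'n) set) \<Rightarrow>
     'n space1 set \<Rightarrow> (('n::finite) space1 \<Rightarrow> real) \<Rightarrow> real \<Rightarrow> 'n space2 set" where
  "level_prolongation M C N f c =
     {z \<in> prolong2 M C. fst z \<in> N \<and> f (fst z) = c \<and> (\<forall>\<nu>\<in>plane2 z. differential N f (fst z) \<nu> = 0)}"

definition intermediate_integral ::
    "(real^'n) set \<Rightarrow> (real^'n \<Rightarrow> (real^'n) set) \<Rightarrow>
     'n space1 set \<Rightarrow> (('n::finite) space1 \<Rightarrow> real) \<Rightarrow> 'n space2 set \<Rightarrow> bool" where
  "intermediate_integral M C N f E \<longleftrightarrow> (\<forall>c. level_prolongation M C N f c \<subseteq> E)"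

definition first_integral ::
    "'n space1 set \<Rightarrow> (('n::finite) space1 \<Rightarrow> real) \<Rightarrow> ('n space1 \<Rightarrow> 'n space1 set) \<Rightarrow> bool" where
  "first_integral N f D \<longleftrightarrow> (\<forall>m\<in>N. \<forall>\<nu>\<in>D m. differential N f m \<nu> = 0)"

end

theory Submission
  imports Defs
begin

text \<open>In the five-dimensional space \<open>cartan1 M C m\<close> the planes of \<open>prolong2\<close> are the horizontal planes on
  which the vector-valued curvature form \<open>\<Omega>\<close> vanishes, and the equation of a three-dimensional
  distribution \<open>D\<close> is \<open>\<Phi> = 0\<close>, where \<open>\<Phi>\<close> is a decomposable 2-form with radical \<open>D\<close>. If all such planes in the
  kernel of \<open>df\<close> satisfy the equation, comparing coefficients shows that \<open>\<Phi> = \<alpha> \<circ> \<Omega> + df \<and> \<zeta>\<close> for a linear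
  functional \<open>\<alpha>\<close> and a 1-form \<open>\<zeta>\<close>. Since \<open>\<Omega>\<close> vanishes on the planes in question, \<open>\<Phi>\<close> and \<open>df \<and> \<zeta>\<close> define the same
  equation, and the common kernel of \<open>df\<close> and \<open>\<zeta>\<close> is the required distribution. As \<open>\<alpha>\<close> and \<open>\<zeta>\<close> modulo \<open>df\<close> are uniquely
  determined by linear equations, it is smooth, although it need not coincide with \<open>D\<close> and the type of
  \<open>D\<close> may change from point to point. In the converse direction, a plane and a three-dimensional
  space in the four-dimensional kernel of \<open>df\<close> always meet. Tangent spaces are handled
  by smooth local retractions onto \<open>M\<close> and \<open>prolong1 M C\<close>.\<close>

section \<open>Smooth maps\<close>

text \<open>The distribution by which \<open>E\<close> is presented need not lie in the kernel of
  df: different distributions can define the same equation, so one adapted to \<open>f\<close> has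
  to be found. Two obstacles shape the search. Local solutions must agree on overlaps, because one
  distribution on all of \<open>N\<close> is claimed; hence \<open>conjugate_distribution\<close>
  quantifies over all admissible 2-forms and never selects one. And smoothness cannot be read off
  from that description, so near each point an explicit pair of 1-forms is built whose common kernel
  is the same space. Two pivots keep the formulas smooth: a vertical frame vector on which df is
  nonzero, obtained from nonsingularity after a suitable choice of basis of the plane, and a vector
  in the kernel of df on which \<zeta> is nonzero. The second exists because \<alpha> composed with
  the curvature is never a nonzero decomposable 2-form, so \<zeta> cannot vanish on the kernel of
  df. Both are picked at one point and persist nearby.\<close>

lemma Ck_on_cong:
  assumes "open S" "\<And>x. x \<in> S \<Longrightarrow> f x = g x" "Ck_on k S f"
  shows "Ck_on k S g"
  using assms(2,3)
proof (induction k arbitrary: f g)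
  case 0
  then show ?case by (metis Ck_on.simps(1) continuous_on_cong)
next
  case (Suc k)
  have d: "f differentiable_on S" and D: "\<And>v. Ck_on k S (\<lambda>x. frechet_derivative f (at x) v)"
    using Suc.prems by auto
  have hd: "(g has_derivative frechet_derivative f (at x)) (at x)" if "x \<in> S" for x
  proof (rule has_derivative_transform_within_open[OF _ assms(1) that])
    show "(f has_derivative frechet_derivative f (at x)) (at x)"
      using d that assms(1) by (simp add: differentiable_on_eq_differentiable_at frechet_derivative_works)
  qed (use Suc.prems in auto)
  have e: "frechet_derivative g (at x) = frechet_derivative f (at x)" if "x \<in> S" for x
    using frechet_derivative_at[OF hd[OF that]] by simp
  have "g differentiable_on S"
    using hd by (meson differentiable_at_withinI differentiable_def differentiable_on_def)
  moreover have "Ck_on k S (\<lambda>x. frechet_derivative g (at x) v)" for v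
    by (rule Suc.IH[OF _ D[of v]]) (simp add: e)
  ultimately show ?case by simp
qed

lemma Ck_on_Suc_imp: "Ck_on (Suc k) S f \<Longrightarrow> Ck_on k S f"
proof (induction k arbitrary: f)
  case 0
  then show ?case by (simp add: differentiable_imp_continuous_on)
next
  case (Suc k)
  then show ?case by (metis Ck_on.simps(2))
qed

lemma Ck_on_subset:
  assumes "open T" "T \<subseteq> S" "Ck_on k S f"
  shows "Ck_on k T f"
  using assms(3)
proof (induction k arbitrary: f)
  case 0
  then show ?case using assms continuous_on_subset by auto
next
  case (Suc k)
  then show ?case using assms differentiable_on_subset by (metis Ck_on.simps(2))
qed

lemma Ck_on_has_derivative:
  assumes "open S" "Ck_on (Suc k) S f" "x \<in> S"
  shows "(f has_derivative frechet_derivative f (at x)) (at x)"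
  using assms by (auto simp: differentiable_on_eq_differentiable_at frechet_derivative_works)

text \<open>The recursion of \<open>Ck_on\<close> is phrased through
  \<open>frechet_derivative\<close>; on an open set any formula for the derivative may replace it,
  by uniqueness. The closure rules below enter the recursion this way.\<close>

lemma Ck_on_SucI:
  assumes "open S" "\<And>x. x \<in> S \<Longrightarrow> (f has_derivative f' x) (at x)"
    "\<And>v. Ck_on k S (\<lambda>x. f' x v)"
  shows "Ck_on (Suc k) S f"
proof -
  have e: "frechet_derivative f (at x) = f' x" if "x \<in> S" for x
    using frechet_derivative_at[OF assms(2)[OF that]] by simp
  have "f differentiable_on S"
    using assms(2) by (meson differentiable_at_withinI differentiable_def differentiable_on_def)
  moreover have "Ck_on k S (\<lambda>x. frechet_derivative f (at x) v)" for v
    by (rule Ck_on_cong[OF assms(1) _ assms(3)[of v]]) (simp add: e)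
  ultimately show ?thesis by simp
qed

lemma Ck_on_const: "open S \<Longrightarrow> Ck_on k S (\<lambda>x. c)"
proof (induction k arbitrary: c)
  case 0
  then show ?case by simp
next
  case (Suc k)
  show ?case by (rule Ck_on_SucI[where f' = "\<lambda>x v. 0"]) (use Suc in auto)
qed

lemma Ck_on_bounded_linear: "open S \<Longrightarrow> bounded_linear h \<Longrightarrow> Ck_on k S h"
proof (cases k)
  case (Suc k')
  assume "open S" "bounded_linear h"
  then show ?thesis unfolding Suc
    by (intro Ck_on_SucI[where f' = "\<lambda>x. h"] bounded_linear_imp_has_derivative Ck_on_const)
qed (simp add: linear_continuous_on)

lemma Ck_on_add:
  assumes "open S" "Ck_on k S f" "Ck_on k S g"
  shows "Ck_on k S (\<lambda>x. f x + g x)"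
  using assms(2,3)
proof (induction k arbitrary: f g)
  case 0
  then show ?case by (auto intro: continuous_intros)
next
  case (Suc k)
  show ?case
  proof (rule Ck_on_SucI[where f' = "\<lambda>x v. frechet_derivative f (at x) v + frechet_derivative g (at x) v"])
    fix x assume "x \<in> S"
    then show "((\<lambda>x. f x + g x) has_derivative
        (\<lambda>v. frechet_derivative f (at x) v + frechet_derivative g (at x) v)) (at x)"
      using Suc.prems assms(1) by (intro has_derivative_add Ck_on_has_derivative)
  qed (use Suc assms(1) in auto)
qed

lemma Ck_on_bilinear:
  assumes h: "bounded_bilinear h" and "open S" "Ck_on k S f" "Ck_on k S g"
  shows "Ck_on k S (\<lambda>x. h (f x) (g x))"
  using assms(3,4)
proof (induction k arbitrary: f g)
  case 0
  then show ?case using bounded_bilinear.continuous_on[OF h] by auto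
next
  case (Suc k)
  show ?case
  proof (rule Ck_on_SucI[where f' = "\<lambda>x v. h (f x) (frechet_derivative g (at x) v) +
      h (frechet_derivative f (at x) v) (g x)"])
    fix x assume "x \<in> S"
    then show "((\<lambda>x. h (f x) (g x)) has_derivative (\<lambda>v. h (f x) (frechet_derivative g (at x) v) +
      h (frechet_derivative f (at x) v) (g x))) (at x)"
      using Suc.prems assms(2) by (intro bounded_bilinear.FDERIV[OF h] Ck_on_has_derivative)
  next
    fix v
    show "Ck_on k S (\<lambda>x. h (f x) (frechet_derivative g (at x) v) + h (frechet_derivative f (at x) v) (g x))"
      using Suc.prems by (intro Ck_on_add assms Suc.IH Ck_on_Suc_imp[of k S f] Ck_on_Suc_imp[of k S g]) auto
  qed fact
qed

lemma Ck_on_inverse: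
  fixes f :: "'a::real_normed_vector \<Rightarrow> real"
  assumes "open S" "Ck_on k S f" "\<And>x. x \<in> S \<Longrightarrow> f x \<noteq> 0"
  shows "Ck_on k S (\<lambda>x. inverse (f x))"
  using assms(2)
proof (induction k)
  case 0
  then show ?case using assms by (auto intro!: continuous_intros)
next
  case (Suc k)
  note mult = Ck_on_bilinear[OF bounded_bilinear_mult assms(1)]
  have k: "Ck_on k S (\<lambda>x. inverse (f x))" using Suc Ck_on_Suc_imp by blast
  show ?case
  proof (rule Ck_on_SucI[where f' = "\<lambda>x v. (- 1) * (inverse (f x) * frechet_derivative f (at x) v * inverse (f x))"])
    fix x assume "x \<in> S"
    then show "((\<lambda>x. inverse (f x)) has_derivative
       (\<lambda>v. (- 1) * (inverse (f x) * frechet_derivative f (at x) v * inverse (f x)))) (at x)"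
      using assms Suc.prems Ck_on_has_derivative[OF assms(1) Suc.prems]
      by (auto intro!: derivative_eq_intros simp: fun_eq_iff)
  next
    fix v
    show "Ck_on k S (\<lambda>x. (- 1) * (inverse (f x) * frechet_derivative f (at x) v * inverse (f x)))"
      using Suc.prems by (intro mult k Ck_on_const assms) auto
  qed fact
qed

lemma Ck_on_sum:
  assumes "open S" "\<And>i. i \<in> I \<Longrightarrow> Ck_on k S (f i)"
  shows "Ck_on k S (\<lambda>x. \<Sum>i\<in>I. f i x)"
  using assms(2)
  by (induction I rule: infinite_finite_induct) (auto intro!: Ck_on_add Ck_on_const assms(1))

text \<open>\<open>Ck_on\<close> controls derivatives in fixed directions only. Expanding in
  \<open>Basis\<close> turns a derivative whose direction moves with the point into a finite sum of
  those, which is what the chain rule calls for.\<close>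

lemma linear_euclidean_expansion:
  fixes h :: "'a::euclidean_space \<Rightarrow> 'b::real_vector"
  assumes "linear h"
  shows "h v = (\<Sum>b\<in>Basis. (v \<bullet> b) *\<^sub>R h b)"
proof -
  have "h v = h (\<Sum>b\<in>Basis. (v \<bullet> b) *\<^sub>R b)" by (simp add: euclidean_representation)
  also have "\<dots> = (\<Sum>b\<in>Basis. (v \<bullet> b) *\<^sub>R h b)"
    by (simp add: linear_sum[OF assms] linear_scale[OF assms])
  finally show ?thesis .
qed

text \<open>Induction with \<open>g\<close> fixed and \<open>f\<close> varying: the chain rule
  produces directional derivatives of \<open>f\<close> along \<open>g\<close>, to which the
  induction hypothesis applies because \<open>g\<close> is of the lower class as well.\<close>

lemma Ck_on_compose:
  fixes f :: "'b::euclidean_space \<Rightarrow> 'c::real_normed_vector"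
    and g :: "'a::real_normed_vector \<Rightarrow> 'b"
  assumes "open S" "open T" "g ` S \<subseteq> T" "Ck_on k T f" "Ck_on k S g"
  shows "Ck_on k S (\<lambda>x. f (g x))"
  using assms(4,5)
proof (induction k arbitrary: f)
  case 0
  then show ?case using assms(3) continuous_on_compose2 by fastforce
next
  case (Suc k)
  have d: "(f has_derivative frechet_derivative f (at (g x))) (at (g x))" if "x \<in> S" for x
    using Ck_on_has_derivative[OF assms(2) Suc.prems(1)] assms(3) that by blast
  show ?case
  proof (rule Ck_on_SucI[where f' = "\<lambda>x v. \<Sum>b\<in>Basis. (frechet_derivative g (at x) v \<bullet> b) *\<^sub>R
      frechet_derivative f (at (g x)) b"])
    fix x assume x: "x \<in> S"
    have "((\<lambda>x. f (g x)) has_derivative (\<lambda>v. frechet_derivative f (at (g x)) (frechet_derivative g (at x) v))) (at x)"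
      using diff_chain_at[OF Ck_on_has_derivative[OF assms(1) Suc.prems(2) x] d[OF x]]
      by (simp add: o_def)
    moreover have "linear (frechet_derivative f (at (g x)))"
      using d[OF x] has_derivative_linear by blast
    ultimately show "((\<lambda>x. f (g x)) has_derivative
      (\<lambda>v. \<Sum>b\<in>Basis. (frechet_derivative g (at x) v \<bullet> b) *\<^sub>R frechet_derivative f (at (g x)) b)) (at x)"
      using linear_euclidean_expansion by (metis (no_types, lifting) ext)
  next
    fix v
    have "Ck_on k S (\<lambda>x. frechet_derivative f (at (g x)) b)" for b
      using Suc.prems Ck_on_Suc_imp[OF Suc.prems(2)] by (intro Suc.IH) auto
    moreover have "Ck_on k S (\<lambda>x. frechet_derivative g (at x) v)" using Suc.prems by auto
    ultimately show "Ck_on k S (\<lambda>x. \<Sum>b\<in>Basis. (frechet_derivative g (at x) v \<bullet> b) *\<^sub>R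
        frechet_derivative f (at (g x)) b)"
      by (intro Ck_on_sum assms(1) Ck_on_bilinear[OF bounded_bilinear_scaleR]
          Ck_on_bilinear[OF bounded_bilinear_inner] Ck_on_const)
  qed fact
qed

section \<open>Closure properties of smooth maps\<close>

lemma smooth_on_open: "smooth_on S f \<Longrightarrow> open S"
  by (simp add: smooth_on_def)

lemma smooth_on_cong:
  "smooth_on S f \<Longrightarrow> (\<And>x. x \<in> S \<Longrightarrow> f x = g x) \<Longrightarrow> smooth_on S g"
  unfolding smooth_on_def using Ck_on_cong by blast

lemma smooth_on_subset: "smooth_on S f \<Longrightarrow> open T \<Longrightarrow> T \<subseteq> S \<Longrightarrow> smooth_on T f"
  unfolding smooth_on_def using Ck_on_subset by blast

lemma smooth_on_has_derivative:
  "smooth_on S f \<Longrightarrow> x \<in> S \<Longrightarrow> (f has_derivative frechet_derivative f (at x)) (at x)"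
  unfolding smooth_on_def using Ck_on_has_derivative by blast

lemma smooth_on_linear_derivative:
  "smooth_on S f \<Longrightarrow> x \<in> S \<Longrightarrow> linear (frechet_derivative f (at x))"
  using smooth_on_has_derivative has_derivative_linear by blast

lemma smooth_on_continuous_on: "smooth_on S f \<Longrightarrow> continuous_on S f"
  unfolding smooth_on_def by (metis Ck_on.simps(1))

lemma smooth_on_isCont: "smooth_on S f \<Longrightarrow> x \<in> S \<Longrightarrow> isCont f x"
  using smooth_on_has_derivative has_derivative_continuous by blast

lemma smooth_on_const: "open S \<Longrightarrow> smooth_on S (\<lambda>x. c)"
  by (simp add: smooth_on_def Ck_on_const)

lemma smooth_on_bounded_linear: "open S \<Longrightarrow> bounded_linear h \<Longrightarrow> smooth_on S h"
  by (simp add: smooth_on_def Ck_on_bounded_linear)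

lemma smooth_on_id: "open S \<Longrightarrow> smooth_on S (\<lambda>x. x)"
  by (intro smooth_on_bounded_linear) (auto simp: bounded_linear_ident)

lemma smooth_on_add: "smooth_on S f \<Longrightarrow> smooth_on S g \<Longrightarrow> smooth_on S (\<lambda>x. f x + g x)"
  by (simp add: smooth_on_def Ck_on_add)

lemma smooth_on_bilinear:
  "bounded_bilinear h \<Longrightarrow> smooth_on S f \<Longrightarrow> smooth_on S g \<Longrightarrow> smooth_on S (\<lambda>x. h (f x) (g x))"
  by (simp add: smooth_on_def Ck_on_bilinear)

lemmas smooth_on_scaleR = smooth_on_bilinear[OF bounded_bilinear_scaleR]
lemmas smooth_on_mult = smooth_on_bilinear[OF bounded_bilinear_mult]
lemmas smooth_on_inner = smooth_on_bilinear[OF bounded_bilinear_inner]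
lemmas smooth_on_blinfun_apply = smooth_on_bilinear[OF bounded_bilinear_blinfun_apply]

lemma smooth_on_minus: "smooth_on S f \<Longrightarrow> smooth_on S (\<lambda>x. - f x)"
  using smooth_on_scaleR[OF smooth_on_const[of S "-1"], of f] by (auto simp: smooth_on_open)

lemma smooth_on_diff: "smooth_on S f \<Longrightarrow> smooth_on S g \<Longrightarrow> smooth_on S (\<lambda>x. f x - g x)"
  using smooth_on_add[OF _ smooth_on_minus, of S f g] by auto

lemma smooth_on_divide:
  fixes f g :: "'a::real_normed_vector \<Rightarrow> real"
  shows "smooth_on S f \<Longrightarrow> smooth_on S g \<Longrightarrow> (\<And>x. x \<in> S \<Longrightarrow> g x \<noteq> 0) \<Longrightarrow> smooth_on S (\<lambda>x. f x / g x)"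
  unfolding divide_inverse
  by (intro smooth_on_mult) (auto simp: smooth_on_def Ck_on_inverse)

lemma smooth_on_sum:
  "open S \<Longrightarrow> (\<And>i. i \<in> I \<Longrightarrow> smooth_on S (f i)) \<Longrightarrow> smooth_on S (\<lambda>x. \<Sum>i\<in>I. f i x)"
  by (simp add: smooth_on_def Ck_on_sum)

lemma smooth_on_compose:
  fixes f :: "'b::euclidean_space \<Rightarrow> 'c::real_normed_vector"
  shows "smooth_on T f \<Longrightarrow> smooth_on S g \<Longrightarrow> g ` S \<subseteq> T \<Longrightarrow> smooth_on S (\<lambda>x. f (g x))"
  unfolding smooth_on_def using Ck_on_compose by blast

text \<open>The intermediate space need not be Euclidean, so \<open>smooth_on_compose\<close> does
  not cover this; \<open>h\<close> is instead the value at the constant r = 1 of a bilinear map in r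
  and y.\<close>

lemma smooth_on_linear_compose:
  assumes h: "bounded_linear h" and g: "smooth_on S g"
  shows "smooth_on S (\<lambda>x. h (g x))"
proof -
  have b: "bounded_bilinear (\<lambda>(r::real) y. r *\<^sub>R h y)"
    using bounded_bilinear.comp[OF bounded_bilinear_scaleR bounded_linear_ident h] .
  show ?thesis
    using smooth_on_bilinear[OF b smooth_on_const[of S 1] g] smooth_on_open[OF g] by simp
qed

lemma smooth_on_Pair:
  assumes "smooth_on S f" "smooth_on S g"
  shows "smooth_on S (\<lambda>x. (f x, g x))"
proof -
  have "smooth_on S (\<lambda>x. (f x, 0) + (0, g x))"
    by (intro smooth_on_add smooth_on_linear_compose[OF _ assms(1)] smooth_on_linear_compose[OF _ assms(2)]
        bounded_linear_Pair bounded_linear_ident bounded_linear_zero)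
  then show ?thesis by simp
qed

lemma smooth_on_derivative: "smooth_on S f \<Longrightarrow> smooth_on S (\<lambda>x. frechet_derivative f (at x) v)"
  unfolding smooth_on_def using Ck_on.simps(2) by blast

lemma smooth_on_derivative_apply:
  fixes f :: "'b::euclidean_space \<Rightarrow> 'c::real_normed_vector"
  assumes "smooth_on T f" "smooth_on S g" "g ` S \<subseteq> T" "smooth_on S h"
  shows "smooth_on S (\<lambda>x. frechet_derivative f (at (g x)) (h x))"
proof (rule smooth_on_cong)
  show "smooth_on S (\<lambda>x. \<Sum>b\<in>Basis. (h x \<bullet> b) *\<^sub>R frechet_derivative f (at (g x)) b)"
    using assms smooth_on_open
    by (intro smooth_on_sum smooth_on_scaleR smooth_on_inner smooth_on_const
        smooth_on_compose[OF smooth_on_derivative[OF assms(1)] assms(2)]) auto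
  show "(\<Sum>b\<in>Basis. (h x \<bullet> b) *\<^sub>R frechet_derivative f (at (g x)) b) = frechet_derivative f (at (g x)) (h x)"
    if "x \<in> S" for x
    using linear_euclidean_expansion[OF smooth_on_linear_derivative[OF assms(1)]] assms(3) that
    by (metis image_subset_iff)
qed

lemma smooth_on_open_vimage:
  assumes "smooth_on S f" "open T"
  shows "open {x \<in> S. f x \<in> T}"
proof -
  have "open (f -` T \<inter> S)"
    using smooth_on_continuous_on[OF assms(1)] smooth_on_open[OF assms(1)] assms(2)
    by (metis continuous_on_open_vimage)
  moreover have "f -` T \<inter> S = {x \<in> S. f x \<in> T}" by auto
  ultimately show ?thesis by simp
qed

lemma smooth_on_open_nonzero: "smooth_on S f \<Longrightarrow> open {x \<in> S. f x \<noteq> (0::'b::real_normed_vector)}"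
  using smooth_on_open_vimage[of S f "- {0}"] by auto

section \<open>Derivatives along lines and the symmetry of second derivatives\<close>

lemma has_derivative_line:
  assumes "(f has_derivative f') (at (x + t *\<^sub>R v))"
  shows "((\<lambda>t. f (x + t *\<^sub>R v)) has_vector_derivative f' v) (at t)"
proof -
  have "((\<lambda>t. x + t *\<^sub>R v) has_derivative (\<lambda>h. h *\<^sub>R v)) (at t)"
    by (auto intro!: derivative_eq_intros)
  from diff_chain_at[OF this assms] show ?thesis
    using linear_scale[OF has_derivative_linear[OF assms]]
    by (simp add: o_def has_vector_derivative_def)
qed

text \<open>Both mixed derivatives are limits of the same second difference quotient.\<close>

lemma mixed_derivative_mvt:
  fixes f :: "'a::euclidean_space \<Rightarrow> real"
  assumes f: "smooth_on S f" and sub: "\<And>s t. 0 \<le> s \<Longrightarrow> s \<le> h \<Longrightarrow> 0 \<le> t \<Longrightarrow> t \<le> h \<Longrightarrow> m + s *\<^sub>R v + t *\<^sub>R w \<in> S"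
    and h: "0 < h"
  obtains s t where "0 \<le> s" "s \<le> h" "0 \<le> t" "t \<le> h"
    "f (m + h *\<^sub>R v + h *\<^sub>R w) - f (m + h *\<^sub>R v) - f (m + h *\<^sub>R w) + f m =
      h * (h * frechet_derivative (\<lambda>x. frechet_derivative f (at x) v) (at (m + s *\<^sub>R v + t *\<^sub>R w)) w)"
proof -
  \<comment> \<open>The first difference in direction \<open>w\<close>, as a function of the step in
    direction \<open>v\<close>. The mean value theorem is applied to it, and then to its derivative
    in the other direction.\<close>
  let ?g = "\<lambda>s. f ((m + h *\<^sub>R w) + s *\<^sub>R v) - f (m + s *\<^sub>R v)"
  let ?D = "\<lambda>x. frechet_derivative f (at x) v"
  have d: "(?g has_real_derivative ?D ((m + h *\<^sub>R w) + s *\<^sub>R v) - ?D (m + s *\<^sub>R v)) (at s)"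
    if "0 \<le> s" "s \<le> h" for s
    unfolding has_real_derivative_iff_has_vector_derivative
    by (intro has_vector_derivative_diff has_derivative_line smooth_on_has_derivative[OF f])
       (use sub[OF that, of h] sub[OF that, of 0] h in \<open>auto simp: algebra_simps\<close>)
  obtain s where s: "0 < s" "s < h" "?g h - ?g 0 = (h - 0) * (?D ((m + h *\<^sub>R w) + s *\<^sub>R v) - ?D (m + s *\<^sub>R v))"
    using MVT2[OF h, of ?g "\<lambda>s. ?D ((m + h *\<^sub>R w) + s *\<^sub>R v) - ?D (m + s *\<^sub>R v)"] d by blast
  have d2: "((\<lambda>t. ?D ((m + s *\<^sub>R v) + t *\<^sub>R w)) has_real_derivative
      frechet_derivative ?D (at ((m + s *\<^sub>R v) + t *\<^sub>R w)) w) (at t)" if "0 \<le> t" "t \<le> h" for t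
    unfolding has_real_derivative_iff_has_vector_derivative
    by (intro has_derivative_line smooth_on_has_derivative[OF smooth_on_derivative[OF f]])
       (use sub[of s, OF _ _ that] s in auto)
  obtain t where t: "0 < t" "t < h" "?D ((m + s *\<^sub>R v) + h *\<^sub>R w) - ?D ((m + s *\<^sub>R v) + 0 *\<^sub>R w) =
      (h - 0) * frechet_derivative ?D (at ((m + s *\<^sub>R v) + t *\<^sub>R w)) w"
    using MVT2[OF h, of "\<lambda>t. ?D ((m + s *\<^sub>R v) + t *\<^sub>R w)"
        "\<lambda>t. frechet_derivative ?D (at ((m + s *\<^sub>R v) + t *\<^sub>R w)) w"] d2 by blast
  have "f (m + h *\<^sub>R v + h *\<^sub>R w) - f (m + h *\<^sub>R v) - f (m + h *\<^sub>R w) + f m = ?g h - ?g 0"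
    by (simp add: algebra_simps)
  also have "\<dots> = h * (h * frechet_derivative ?D (at (m + s *\<^sub>R v + t *\<^sub>R w)) w)"
    using s t by (simp add: algebra_simps)
  finally show ?thesis using that[of s t] s t by simp
qed

lemma second_derivative_symmetric_real:
  fixes f :: "'a::euclidean_space \<Rightarrow> real"
  assumes f: "smooth_on S f" and m: "m \<in> S"
  shows "frechet_derivative (\<lambda>x. frechet_derivative f (at x) v) (at m) w =
         frechet_derivative (\<lambda>x. frechet_derivative f (at x) w) (at m) v"
proof -
  let ?A = "\<lambda>x. frechet_derivative (\<lambda>x. frechet_derivative f (at x) v) (at x) w"
  let ?B = "\<lambda>x. frechet_derivative (\<lambda>x. frechet_derivative f (at x) w) (at x) v"
  have A: "isCont ?A m" and B: "isCont ?B m"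
    using f m by (auto intro!: smooth_on_isCont smooth_on_derivative)
  have "\<bar>?A m - ?B m\<bar> < 2 * e" if e: "e > 0" for e
  proof -
    obtain d1 where d1: "d1 > 0" "\<And>x. dist x m < d1 \<Longrightarrow> dist (?A x) (?A m) < e"
      using A[unfolded continuous_at_eps_delta, rule_format, OF e] by blast
    obtain d2 where d2: "d2 > 0" "\<And>x. dist x m < d2 \<Longrightarrow> dist (?B x) (?B m) < e"
      using B[unfolded continuous_at_eps_delta, rule_format, OF e] by blast
    obtain d3 where d3: "d3 > 0" "ball m d3 \<subseteq> S"
      using smooth_on_open[OF f] m openE by blast
    define d where "d = min d1 (min d2 d3)"
    have d: "d > 0" "d \<le> d1" "d \<le> d2" "d \<le> d3" using d1 d2 d3 by (auto simp: d_def)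
    \<comment> \<open>This size keeps the parallelogram with sides \<open>h\<close> times
      \<open>v\<close> and \<open>h\<close> times \<open>w\<close> within distance \<open>d\<close>
      of \<open>m\<close>: the half gives strictness, the 1 keeps the denominator positive if both
      vectors are zero.\<close>
    define h where "h = d / 2 / (norm v + norm w + 1)"
    have pos: "norm v + norm w + 1 > 0" by (smt (verit) norm_ge_zero)
    have "h * (norm v + norm w + 1) = d / 2"
      unfolding h_def by (rule nonzero_eq_divide_eq[THEN iffD1, OF _ refl]) (use pos in auto)
    then have h: "h > 0" "h * (norm v + norm w + 1) < d"
      using d(1) pos by (simp add: h_def, linarith)
    have near: "dist (m + s *\<^sub>R a + t *\<^sub>R b) m < d"
      if "0 \<le> s" "s \<le> h" "0 \<le> t" "t \<le> h" "(a, b) \<in> {(v, w), (w, v)}" for s t a b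
    proof -
      have "dist (m + s *\<^sub>R a + t *\<^sub>R b) m = norm (s *\<^sub>R a + t *\<^sub>R b)" by (simp add: dist_norm)
      also have "\<dots> \<le> s * norm a + t * norm b" using norm_triangle_ineq[of "s *\<^sub>R a" "t *\<^sub>R b"] that by simp
      also have "\<dots> \<le> h * norm a + h * norm b" using that by (intro add_mono mult_right_mono) auto
      also have "\<dots> \<le> h * (norm v + norm w + 1)" using that(5) h(1) by (auto simp: distrib_left add.commute)
      finally show ?thesis using h by simp
    qed
    have nearS: "m + s *\<^sub>R a + t *\<^sub>R b \<in> S"
      if "0 \<le> s" "s \<le> h" "0 \<le> t" "t \<le> h" "(a, b) \<in> {(v, w), (w, v)}" for s t a b
      using near[OF that] d d3(2) by (auto simp: subset_iff dist_commute)
    obtain s t where 1: "0 \<le> s" "s \<le> h" "0 \<le> t" "t \<le> h"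
      "f (m + h *\<^sub>R v + h *\<^sub>R w) - f (m + h *\<^sub>R v) - f (m + h *\<^sub>R w) + f m = h * (h * ?A (m + s *\<^sub>R v + t *\<^sub>R w))"
      using mixed_derivative_mvt[OF f _ h(1), of m v w] nearS by blast
    obtain s' t' where 2: "0 \<le> s'" "s' \<le> h" "0 \<le> t'" "t' \<le> h"
      "f (m + h *\<^sub>R w + h *\<^sub>R v) - f (m + h *\<^sub>R w) - f (m + h *\<^sub>R v) + f m = h * (h * ?B (m + s' *\<^sub>R w + t' *\<^sub>R v))"
      using mixed_derivative_mvt[OF f _ h(1), of m w v] nearS by blast
    have "h * (h * ?A (m + s *\<^sub>R v + t *\<^sub>R w)) = h * (h * ?B (m + s' *\<^sub>R w + t' *\<^sub>R v))"
      unfolding 1(5)[symmetric] 2(5)[symmetric] by (simp add: algebra_simps)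
    then have "?A (m + s *\<^sub>R v + t *\<^sub>R w) = ?B (m + s' *\<^sub>R w + t' *\<^sub>R v)" using h by simp
    moreover have "dist (?A (m + s *\<^sub>R v + t *\<^sub>R w)) (?A m) < e"
      using near[OF 1(1-4)] d by (intro d1(2)) fastforce
    moreover have "dist (?B (m + s' *\<^sub>R w + t' *\<^sub>R v)) (?B m) < e"
      using near[OF 2(1-4)] d by (intro d2(2)) fastforce
    ultimately show ?thesis by (simp add: dist_real_def)
  qed
  \<comment> \<open>If the difference were positive, this choice of \<open>e\<close> would make it
    smaller than itself.\<close>
  from this[of "\<bar>?A m - ?B m\<bar> / 2"] show ?thesis by fastforce
qed

lemma frechet_derivative_inner_left:
  assumes "smooth_on S f" "x \<in> S"
  shows "frechet_derivative (\<lambda>x. f x \<bullet> b) (at x) v = frechet_derivative f (at x) v \<bullet> b"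
  using frechet_derivative_at[OF has_derivative_inner_left[OF smooth_on_has_derivative[OF assms]], of b]
  by metis

lemma second_derivative_symmetric:
  fixes f :: "'a::euclidean_space \<Rightarrow> 'b::euclidean_space"
  assumes f: "smooth_on S f" and m: "m \<in> S"
  shows "frechet_derivative (\<lambda>x. frechet_derivative f (at x) v) (at m) w =
         frechet_derivative (\<lambda>x. frechet_derivative f (at x) w) (at m) v"
proof (rule euclidean_eqI)
  fix b :: 'b
  have fb: "smooth_on S (\<lambda>x. f x \<bullet> b)" using f smooth_on_open by (intro smooth_on_inner smooth_on_const) auto
  have e: "frechet_derivative (\<lambda>x. frechet_derivative f (at x) v) (at m) w \<bullet> b =
     frechet_derivative (\<lambda>x. frechet_derivative (\<lambda>x. f x \<bullet> b) (at x) v) (at m) w" for v w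
  proof -
    have "((\<lambda>x. frechet_derivative (\<lambda>x. f x \<bullet> b) (at x) v) has_derivative
       (\<lambda>w. frechet_derivative (\<lambda>x. frechet_derivative f (at x) v) (at m) w \<bullet> b)) (at m)"
      by (rule has_derivative_transform_within_open[OF has_derivative_inner_left[OF
            smooth_on_has_derivative[OF smooth_on_derivative[OF f] m]] smooth_on_open[OF f] m])
         (simp add: frechet_derivative_inner_left[OF f])
    from frechet_derivative_at[OF this] show ?thesis by metis
  qed
  show "frechet_derivative (\<lambda>x. frechet_derivative f (at x) v) (at m) w \<bullet> b =
        frechet_derivative (\<lambda>x. frechet_derivative f (at x) w) (at m) v \<bullet> b"
    unfolding e by (rule second_derivative_symmetric_real[OF fb m])
qed

section \<open>Smooth retractions and tangent spaces\<close>

text \<open>This takes the place of charts: tangent vectors become the fixed vectors of the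
  derivative of \<open>R\<close>, and forms on \<open>A\<close> can be differentiated along the
  images of straight lines. For \<open>prolong1\<close> such a map can be written down
  explicitly.\<close>

definition smooth_retraction :: "'a::euclidean_space set \<Rightarrow> 'a set \<Rightarrow> ('a \<Rightarrow> 'a) \<Rightarrow> bool" where
  "smooth_retraction A W R \<longleftrightarrow> smooth_on W R \<and> R ` W \<subseteq> A \<and> (\<forall>x\<in>A \<inter> W. R x = x)"

lemma smooth_retraction_subset:
  "smooth_retraction A W R \<Longrightarrow> open W' \<Longrightarrow> W' \<subseteq> W \<Longrightarrow> smooth_retraction A W' R"
  unfolding smooth_retraction_def using smooth_on_subset by blast

lemma curve_at_line:
  fixes R :: "'a::euclidean_space \<Rightarrow> 'b::real_normed_vector"
  assumes R: "smooth_on W R" "R ` W \<subseteq> A" and p: "p \<in> W"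
  shows "curve_at A (R p) (\<lambda>t. R (p + t *\<^sub>R v))"
proof -
  have sm: "smooth_on UNIV (\<lambda>t::real. p + t *\<^sub>R v)"
    by (intro smooth_on_add smooth_on_scaleR smooth_on_const smooth_on_id) auto
  have "open {t \<in> UNIV. p + t *\<^sub>R v \<in> W}"
    using smooth_on_open_vimage[OF sm smooth_on_open[OF R(1)]] .
  moreover have "0 \<in> {t \<in> UNIV. p + t *\<^sub>R v \<in> W}" using p by simp
  ultimately obtain e where e: "e > 0" "ball 0 e \<subseteq> {t \<in> UNIV. p + t *\<^sub>R v \<in> W}"
    using openE by blast
  have b: "{- e<..<e} = ball 0 e" by (auto simp: dist_real_def)
  have "smooth_on {- e<..<e} (\<lambda>t. R (p + t *\<^sub>R v))"
    by (rule smooth_on_compose[OF R(1) smooth_on_subset[OF sm]]) (use e b in auto)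
  moreover have "(\<lambda>t. R (p + t *\<^sub>R v)) ` {- e<..<e} \<subseteq> A" using e b R(2) by auto
  ultimately show ?thesis unfolding curve_at_def using e(1) by auto
qed

lemma tangent_space_line:
  fixes R :: "'a::euclidean_space \<Rightarrow> 'b::real_normed_vector"
  assumes R: "smooth_on W R" "R ` W \<subseteq> A" and p: "p \<in> W"
  shows "frechet_derivative R (at p) v \<in> tangent_space A (R p)"
proof -
  have "((\<lambda>t. R (p + t *\<^sub>R v)) has_vector_derivative frechet_derivative R (at p) v) (at 0)"
    by (rule has_derivative_line) (use smooth_on_has_derivative[OF R(1) p] in simp)
  with curve_at_line[OF assms, of v] show ?thesis unfolding tangent_space_def by blast
qed

lemma curve_at_near:
  assumes c: "curve_at A x \<gamma>" and W: "open W" "x \<in> W"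
  obtains e where "e > 0" "smooth_on {- e<..<e} \<gamma>" "\<gamma> ` {- e<..<e} \<subseteq> A \<inter> W" "\<gamma> 0 = x"
proof -
  obtain e where e: "e > 0" "smooth_on {- e<..<e} \<gamma>" "\<gamma> ` {- e<..<e} \<subseteq> A" "\<gamma> 0 = x"
    using c unfolding curve_at_def by blast
  have "open {t \<in> {- e<..<e}. \<gamma> t \<in> W}" using smooth_on_open_vimage[OF e(2) W(1)] .
  moreover have "0 \<in> {t \<in> {- e<..<e}. \<gamma> t \<in> W}" using e W by simp
  ultimately obtain d where d: "d > 0" "ball 0 d \<subseteq> {t \<in> {- e<..<e}. \<gamma> t \<in> W}"
    using openE by blast
  have b: "{- d<..<d} = ball 0 d" by (auto simp: dist_real_def)
  show ?thesis
  proof (rule that[of d])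
    have "{- d<..<d} \<subseteq> {- e<..<e}" using d(2) b by fast
    then show "smooth_on {- d<..<d} \<gamma>"
      using smooth_on_subset[OF e(2), of "{- d<..<d}"] by simp
    show "\<gamma> ` {- d<..<d} \<subseteq> A \<inter> W" using d(2) e(3) unfolding b by fastforce
  qed (use d e in auto)
qed

text \<open>A curve in \<open>A\<close> stays in \<open>U\<close> for short times, so any smooth
  local extension \<open>h\<close> of \<open>k\<close> computes the derivative of \<open>k\<close>
  along it; the result depends on the velocity only.\<close>

lemma tangent_space_derivative:
  fixes h :: "'a::euclidean_space \<Rightarrow> 'b::real_normed_vector"
  assumes c: "curve_at A x \<gamma>" "(\<gamma> has_vector_derivative v) (at 0)"
    and h: "smooth_on U h" "x \<in> U" and eq: "\<And>y. y \<in> A \<inter> U \<Longrightarrow> h y = k y"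
  shows "((\<lambda>t. k (\<gamma> t)) has_vector_derivative frechet_derivative h (at x) v) (at 0)"
proof -
  obtain e where e: "e > 0" "smooth_on {- e<..<e} \<gamma>" "\<gamma> ` {- e<..<e} \<subseteq> A \<inter> U" "\<gamma> 0 = x"
    using curve_at_near[OF c(1) smooth_on_open[OF h(1)] h(2)] by blast
  have "(h has_derivative frechet_derivative h (at x)) (at (\<gamma> 0))"
    using smooth_on_has_derivative[OF h] e by simp
  from diff_chain_at[OF c(2)[unfolded has_vector_derivative_def] this]
  have "((\<lambda>t. h (\<gamma> t)) has_vector_derivative frechet_derivative h (at x) v) (at 0)"
    by (simp add: has_vector_derivative_def o_def linear_scale[OF smooth_on_linear_derivative[OF h]])
  then show ?thesis
    by (rule has_vector_derivative_transform_within_open[where S = "{- e<..<e}"])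
       (use e(1,3) eq in \<open>auto simp: image_subset_iff\<close>)
qed

text \<open>A curve in \<open>A\<close> satisfies R o \<gamma> = \<gamma>, which differentiates to
  one direction. Conversely \<open>R\<close> pushes the line through \<open>x\<close> with direction
  \<open>v\<close> into \<open>A\<close>, and the image has velocity \<open>v\<close> if
  \<open>v\<close> is fixed.\<close>

lemma tangent_space_retraction:
  assumes R: "smooth_retraction A W R" and x: "x \<in> A" "x \<in> W"
  shows "v \<in> tangent_space A x \<longleftrightarrow> frechet_derivative R (at x) v = v"
proof
  assume "v \<in> tangent_space A x"
  then obtain \<gamma> where g: "curve_at A x \<gamma>" "(\<gamma> has_vector_derivative v) (at 0)"
    unfolding tangent_space_def by blast
  have "((\<lambda>t. \<gamma> t) has_vector_derivative frechet_derivative R (at x) v) (at 0)"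
    by (rule tangent_space_derivative[OF g, where h = R and U = W]) (use R x in \<open>auto simp: smooth_retraction_def\<close>)
  with g(2) show "frechet_derivative R (at x) v = v" using vector_derivative_unique_at by blast
next
  assume "frechet_derivative R (at x) v = v"
  then show "v \<in> tangent_space A x"
    using tangent_space_line[of W R A x v] R x by (auto simp: smooth_retraction_def)
qed

lemma subspace_tangent_space:
  assumes R: "smooth_retraction A W R" and x: "x \<in> A" "x \<in> W"
  shows "subspace (tangent_space A x)"
proof -
  have "linear (frechet_derivative R (at x))"
    using R x smooth_on_linear_derivative by (auto simp: smooth_retraction_def)
  then show ?thesis
    by (auto simp: subspace_def tangent_space_retraction[OF assms] linear_add linear_scale linear_0)
qed

lemma derivative_zero_on_tangent_space:
  fixes h :: "'a::euclidean_space \<Rightarrow> 'b::real_normed_vector"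
  assumes h: "smooth_on U h" "x \<in> U" "\<And>y. y \<in> A \<inter> U \<Longrightarrow> h y = c"
    and v: "v \<in> tangent_space A x"
  shows "frechet_derivative h (at x) v = 0"
proof -
  obtain \<gamma> where g: "curve_at A x \<gamma>" "(\<gamma> has_vector_derivative v) (at 0)"
    using v unfolding tangent_space_def by blast
  have "((\<lambda>t. c) has_vector_derivative frechet_derivative h (at x) v) (at 0)"
    using tangent_space_derivative[OF g h(1,2), of "\<lambda>_. c"] h(3) by auto
  then show ?thesis using vector_derivative_unique_at has_vector_derivative_const by metis
qed

text \<open>This justifies the definite description in \<open>differential\<close>. A suitable curve
  exists because a curve in \<open>A\<close> stays in the relatively open \<open>N\<close> near 0;
  the value is unique because each such curve is evaluated by the same extension
  \<open>g\<close>.\<close>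

lemma differential_eq:
  fixes f :: "'a::euclidean_space \<Rightarrow> real"
  assumes N: "openin (top_of_set A) N" "m \<in> N"
    and g: "smooth_on U g" "m \<in> U" "\<And>y. y \<in> N \<inter> U \<Longrightarrow> g y = f y"
    and v: "v \<in> tangent_space A m"
  shows "differential N f m v = frechet_derivative g (at m) v"
  unfolding differential_def
proof (rule the_equality)
  obtain \<gamma> where c: "curve_at A m \<gamma>" "(\<gamma> has_vector_derivative v) (at 0)"
    using v unfolding tangent_space_def by blast
  obtain T where T: "open T" "N = A \<inter> T" using N(1) by (auto simp: openin_open)
  then obtain e where "e > 0" "smooth_on {- e<..<e} \<gamma>" "\<gamma> ` {- e<..<e} \<subseteq> A \<inter> T" "\<gamma> 0 = m"
    using curve_at_near[OF c(1)] N(2) by blast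
  then have c': "curve_at N m \<gamma>" using T(2) by (auto simp: curve_at_def)
  show "\<exists>\<gamma>. curve_at N m \<gamma> \<and> (\<gamma> has_vector_derivative v) (at 0) \<and>
      ((\<lambda>t. f (\<gamma> t)) has_real_derivative frechet_derivative g (at m) v) (at 0)"
    using tangent_space_derivative[OF c' c(2) g] c' c(2)
    by (auto simp: has_real_derivative_iff_has_vector_derivative)
next
  fix c assume "\<exists>\<gamma>. curve_at N m \<gamma> \<and> (\<gamma> has_vector_derivative v) (at 0) \<and>
      ((\<lambda>t. f (\<gamma> t)) has_real_derivative c) (at 0)"
  then obtain \<gamma> where c: "curve_at N m \<gamma>" "(\<gamma> has_vector_derivative v) (at 0)"
    "((\<lambda>t. f (\<gamma> t)) has_vector_derivative c) (at 0)"
    by (auto simp: has_real_derivative_iff_has_vector_derivative)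
  show "c = frechet_derivative g (at m) v"
    using tangent_space_derivative[OF c(1,2) g] c(3) vector_derivative_unique_at by blast
qed

section \<open>Exterior derivatives on submanifolds\<close>

text \<open>The term with the second derivative of the retraction is symmetric in \<open>v\<close> and \<open>w\<close> and cancels
  in the exterior derivative.\<close>

lemma form_along_retraction:
  fixes \<eta> :: "'a::euclidean_space \<Rightarrow> 'a \<Rightarrow>\<^sub>L real"
  assumes R: "smooth_retraction A W R" and m: "m \<in> A" "m \<in> W"
    and v: "v \<in> tangent_space A m" and w: "w \<in> tangent_space A m"
    and \<eta>: "smooth_on V \<eta>" "m \<in> V"
  shows "((\<lambda>t. blinfun_apply (\<eta> (R (m + t *\<^sub>R v))) (frechet_derivative R (at (m + t *\<^sub>R v)) w))
    has_vector_derivative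
      blinfun_apply (\<eta> m) (frechet_derivative (\<lambda>p. frechet_derivative R (at p) w) (at m) v) +
      blinfun_apply (frechet_derivative \<eta> (at m) v) w) (at 0)"
proof -
  have sR: "smooth_on W R" and Rm: "R m = m" using R m by (auto simp: smooth_retraction_def)
  have vw: "frechet_derivative R (at m) v = v" "frechet_derivative R (at m) w = w"
    using tangent_space_retraction[OF R m] v w by auto
  have "(\<eta> has_derivative frechet_derivative \<eta> (at m)) (at (R m))"
    using smooth_on_has_derivative[OF \<eta>] Rm by simp
  from diff_chain_at[OF smooth_on_has_derivative[OF sR m(2)] this]
  have 1: "((\<lambda>p. \<eta> (R p)) has_derivative (\<lambda>h. frechet_derivative \<eta> (at m) (frechet_derivative R (at m) h))) (at m)"
    by (simp add: o_def)
  have 2: "((\<lambda>p. frechet_derivative R (at p) w) has_derivative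
      frechet_derivative (\<lambda>p. frechet_derivative R (at p) w) (at m)) (at m)"
    by (rule smooth_on_has_derivative[OF smooth_on_derivative[OF sR] m(2)])
  have "((\<lambda>p. blinfun_apply (\<eta> (R p)) (frechet_derivative R (at p) w)) has_derivative
    (\<lambda>h. blinfun_apply (\<eta> (R m)) (frechet_derivative (\<lambda>p. frechet_derivative R (at p) w) (at m) h) +
      blinfun_apply (frechet_derivative \<eta> (at m) (frechet_derivative R (at m) h)) (frechet_derivative R (at m) w)))
    (at (m + 0 *\<^sub>R v))"
    using bounded_bilinear.FDERIV[OF bounded_bilinear_blinfun_apply 1 2] by simp
  from has_derivative_line[OF this] show ?thesis by (simp add: vw Rm)
qed

text \<open>The rule d(z \<kappa>) = dz \<and> \<kappa> + z d\<kappa> for an identity that holds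
  only on vectors tangent to \<open>A\<close>. It can be differentiated because the derivative of
  \<open>R\<close> applied to a fixed \<open>w\<close> is a tangent field along images of
  \<open>R\<close>; the terms with dz drop since the \<kappa> vanish on \<open>v\<close> and
  \<open>w\<close>.\<close>

lemma ext_deriv_ideal:
  fixes \<eta> :: "'a::euclidean_space \<Rightarrow> 'a \<Rightarrow>\<^sub>L real" and z :: "'i \<Rightarrow> 'a \<Rightarrow> real"
  assumes R: "smooth_retraction A W R" and m: "m \<in> A" "m \<in> W"
    and v: "v \<in> tangent_space A m" and w: "w \<in> tangent_space A m"
    and \<eta>: "smooth_on V \<eta>" "m \<in> V"
    and \<kappa>: "\<And>i. i \<in> I \<Longrightarrow> smooth_on V (\<kappa> i)"
    and z: "\<And>i. i \<in> I \<Longrightarrow> smooth_on V (z i)"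
    and eq: "\<And>p u. p \<in> A \<Longrightarrow> p \<in> V \<Longrightarrow> u \<in> tangent_space A p \<Longrightarrow>
      blinfun_apply (\<eta> p) u = (\<Sum>i\<in>I. z i p * blinfun_apply (\<kappa> i p) u)"
    and zero: "\<And>i. i \<in> I \<Longrightarrow> blinfun_apply (\<kappa> i m) v = 0" "\<And>i. i \<in> I \<Longrightarrow> blinfun_apply (\<kappa> i m) w = 0"
  shows "ext_deriv \<eta> m v w = (\<Sum>i\<in>I. z i m * ext_deriv (\<kappa> i) m v w)"
proof -
  let ?d2 = "\<lambda>v w. frechet_derivative (\<lambda>p. frechet_derivative R (at p) w) (at m) v"
  have sR: "smooth_on W R" and Rm: "R m = m" using R m by (auto simp: smooth_retraction_def)
  have key: "blinfun_apply (\<eta> m) (?d2 v w) + blinfun_apply (frechet_derivative \<eta> (at m) v) w =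
     (\<Sum>i\<in>I. z i m * (blinfun_apply (\<kappa> i m) (?d2 v w) + blinfun_apply (frechet_derivative (\<kappa> i) (at m) v) w))"
    if v: "v \<in> tangent_space A m" and w: "w \<in> tangent_space A m"
      and zero: "\<And>i. i \<in> I \<Longrightarrow> blinfun_apply (\<kappa> i m) w = 0" for v w
  proof -
    have vw: "frechet_derivative R (at m) v = v" "frechet_derivative R (at m) w = w"
      using tangent_space_retraction[OF R m] v w by auto
    have zd: "((\<lambda>t. z i (R (m + t *\<^sub>R v))) has_vector_derivative frechet_derivative (z i) (at m) v) (at 0)"
      if i: "i \<in> I" for i
    proof -
      have "(z i has_derivative frechet_derivative (z i) (at m)) (at (R m))"
        using smooth_on_has_derivative[OF z[OF i] \<eta>(2)] Rm by simp
      from diff_chain_at[OF smooth_on_has_derivative[OF sR m(2)] this]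
      have "((\<lambda>p. z i (R p)) has_derivative
          (\<lambda>h. frechet_derivative (z i) (at m) (frechet_derivative R (at m) h))) (at (m + 0 *\<^sub>R v))"
        by (simp add: o_def)
      from has_derivative_line[OF this] show ?thesis by (simp add: vw)
    qed
    have "open {p \<in> W. R p \<in> V}"
      using smooth_on_open_vimage[OF sR smooth_on_open[OF \<eta>(1)]] .
    moreover have "m \<in> {p \<in> W. R p \<in> V}" using m \<eta>(2) Rm by simp
    moreover have "smooth_on UNIV (\<lambda>t::real. m + t *\<^sub>R v)"
      by (intro smooth_on_add smooth_on_scaleR smooth_on_const smooth_on_id) auto
    ultimately have o: "open {t \<in> UNIV. m + t *\<^sub>R v \<in> {p \<in> W. R p \<in> V}}" (is "open ?T")
      using smooth_on_open_vimage by blast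
    have "((\<lambda>t. \<Sum>i\<in>I. z i (R (m + t *\<^sub>R v)) * blinfun_apply (\<kappa> i (R (m + t *\<^sub>R v))) (frechet_derivative R (at (m + t *\<^sub>R v)) w))
      has_vector_derivative (\<Sum>i\<in>I. z i (R (m + 0 *\<^sub>R v)) * (blinfun_apply (\<kappa> i m) (?d2 v w) + blinfun_apply (frechet_derivative (\<kappa> i) (at m) v) w)
         + frechet_derivative (z i) (at m) v *
           blinfun_apply (\<kappa> i (R (m + 0 *\<^sub>R v))) (frechet_derivative R (at (m + 0 *\<^sub>R v)) w))) (at 0)"
      by (intro has_vector_derivative_sum has_vector_derivative_mult zd
          form_along_retraction[OF R m v w \<kappa> \<eta>(2)])
    then have "((\<lambda>t. \<Sum>i\<in>I. z i (R (m + t *\<^sub>R v)) * blinfun_apply (\<kappa> i (R (m + t *\<^sub>R v))) (frechet_derivative R (at (m + t *\<^sub>R v)) w))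
      has_vector_derivative (\<Sum>i\<in>I. z i m * (blinfun_apply (\<kappa> i m) (?d2 v w) + blinfun_apply (frechet_derivative (\<kappa> i) (at m) v) w))) (at 0)"
      by (simp add: Rm vw zero)
    then have "((\<lambda>t. blinfun_apply (\<eta> (R (m + t *\<^sub>R v))) (frechet_derivative R (at (m + t *\<^sub>R v)) w))
      has_vector_derivative (\<Sum>i\<in>I. z i m * (blinfun_apply (\<kappa> i m) (?d2 v w) + blinfun_apply (frechet_derivative (\<kappa> i) (at m) v) w))) (at 0)"
    proof (rule has_vector_derivative_transform_within_open[OF _ o])
      show "0 \<in> ?T" using m \<eta>(2) Rm by simp
      fix t assume "t \<in> ?T"
      then show "(\<Sum>i\<in>I. z i (R (m + t *\<^sub>R v)) * blinfun_apply (\<kappa> i (R (m + t *\<^sub>R v))) (frechet_derivative R (at (m + t *\<^sub>R v)) w))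
        = blinfun_apply (\<eta> (R (m + t *\<^sub>R v))) (frechet_derivative R (at (m + t *\<^sub>R v)) w)"
        using R tangent_space_line[OF sR, of A]
        by (intro eq[symmetric]) (auto simp: smooth_retraction_def)
    qed
    then show ?thesis
      using form_along_retraction[OF R m v w \<eta>] vector_derivative_unique_at by blast
  qed
  have sym: "?d2 v w = ?d2 w v" by (rule second_derivative_symmetric[OF sR m(2)])
  have "ext_deriv \<eta> m v w =
    (\<Sum>i\<in>I. z i m * (blinfun_apply (\<kappa> i m) (?d2 v w) + blinfun_apply (frechet_derivative (\<kappa> i) (at m) v) w)) -
    (\<Sum>i\<in>I. z i m * (blinfun_apply (\<kappa> i m) (?d2 w v) + blinfun_apply (frechet_derivative (\<kappa> i) (at m) w) v))"
    using key[OF v w zero(2)] key[OF w v zero(1)] sym by (simp add: ext_deriv_def)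
  also have "\<dots> = (\<Sum>i\<in>I. z i m * ext_deriv (\<kappa> i) m v w)"
    unfolding sum_subtractf[symmetric]
    by (intro sum.cong refl) (simp add: ext_deriv_def sym algebra_simps)
  finally show ?thesis .
qed

section \<open>Planes and linear algebra\<close>

text \<open>Stated by coefficients because \<open>independent {v, w}\<close> also holds when
  \<open>v\<close> and \<open>w\<close> are the same nonzero vector.\<close>

definition indep2 :: "'a::real_vector \<Rightarrow> 'a \<Rightarrow> bool" where
  "indep2 v w \<longleftrightarrow> (\<forall>a b. a *\<^sub>R v + b *\<^sub>R w = 0 \<longrightarrow> a = 0 \<and> b = 0)"

lemma indep2D: "indep2 v w \<Longrightarrow> a *\<^sub>R v + b *\<^sub>R w = 0 \<Longrightarrow> a = 0 \<and> b = 0"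
  by (simp add: indep2_def)

lemma indep2_commute: "indep2 v w \<Longrightarrow> indep2 w v"
  unfolding indep2_def by (metis add.commute)

lemma span2_iff: "x \<in> span {v, w} \<longleftrightarrow> (\<exists>a b. x = a *\<^sub>R v + b *\<^sub>R (w::'a::real_vector))"
proof
  assume "x \<in> span {v, w}"
  then show "\<exists>a b. x = a *\<^sub>R v + b *\<^sub>R w"
    by (auto simp: span_insert span_singleton) (metis add.commute diff_add_cancel)
qed (auto intro!: span_add span_scale intro: span_base)

lemma indep2_independent: "indep2 v w \<Longrightarrow> independent {v, w} \<and> v \<noteq> w"
proof -
  assume i: "indep2 v w"
  have ne: "v \<noteq> w" using indep2D[OF i, of 1 "-1"] by auto
  have w: "w \<noteq> 0" using indep2D[OF i, of 0 1] by auto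
  have "v \<notin> span {w}"
  proof
    assume "v \<in> span {w}"
    then obtain k where "v = k *\<^sub>R w" by (auto simp: span_singleton)
    then show False using indep2D[OF i, of 1 "- k"] by simp
  qed
  then show ?thesis using ne w by (simp add: independent_insert)
qed

lemma dim_span2: "indep2 v w \<Longrightarrow> dim (span {v, w}) = 2"
  using indep2_independent[of v w] dim_eq_card[of "{v, w}" "span {v, w}"] by (auto simp: span_span)

lemma dim2_basis:
  fixes R :: "'a::real_vector set"
  assumes "subspace R" "dim R = 2"
  obtains v w where "R = span {v, w}" "indep2 v w" "v \<in> R" "w \<in> R"
proof -
  obtain B where B: "B \<subseteq> R" "independent B" "R \<subseteq> span B" "card B = 2"
    using basis_exists[of R] assms by metis
  then obtain v w where vw: "B = {v, w}" "v \<noteq> w" by (meson card_2_iff)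
  have "indep2 v w" unfolding indep2_def
  proof (intro allI impI)
    fix a b assume e: "a *\<^sub>R v + b *\<^sub>R w = 0"
    have "(\<Sum>x\<in>B. (if x = v then a else b) *\<^sub>R x) = 0" using vw e by simp
    then have "\<forall>x\<in>B. (if x = v then a else b) = 0"
      using B(2) vw independentD[of B B "\<lambda>x. if x = v then a else b"] by auto
    then show "a = 0 \<and> b = 0" using vw by auto
  qed
  moreover have "R = span {v, w}" using B vw assms(1) span_minimal by blast
  ultimately show ?thesis using that B vw by auto
qed

lemma span2_eqI:
  fixes v w :: "'a::real_vector"
  assumes "subspace R" "dim R = 2" "indep2 v w" "v \<in> R" "w \<in> R"
  shows "R = span {v, w}"
proof -
  obtain x y where xy: "R = span {x, y}" "indep2 x y" using dim2_basis assms by metis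
  obtain a b c d where v: "v = a *\<^sub>R x + b *\<^sub>R y" and w: "w = c *\<^sub>R x + d *\<^sub>R y"
    using assms(4,5) unfolding xy span2_iff by auto
  \<comment> \<open>Cramer's rule: \<open>?e\<close> is the determinant of the change of
    basis.\<close>
  let ?e = "a * d - b * c"
  have 1: "?e *\<^sub>R x = d *\<^sub>R v - b *\<^sub>R w" "?e *\<^sub>R y = a *\<^sub>R w - c *\<^sub>R v"
    unfolding v w by (simp_all add: algebra_simps)
  have "?e \<noteq> 0"
  proof
    assume "?e = 0"
    then have "d *\<^sub>R v + (- b) *\<^sub>R w = 0" "(- c) *\<^sub>R v + a *\<^sub>R w = 0" using 1 by simp_all
    from indep2D[OF assms(3) this(1)] indep2D[OF assms(3) this(2)] have "v = 0" using v by simp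
    then show False using indep2D[OF assms(3), of 1 0] by simp
  qed
  then have "x = (1 / ?e) *\<^sub>R (d *\<^sub>R v - b *\<^sub>R w)" "y = (1 / ?e) *\<^sub>R (a *\<^sub>R w - c *\<^sub>R v)"
    unfolding 1[symmetric] by simp_all
  then have "x \<in> span {v, w}" "y \<in> span {v, w}"
    by (metis span_scale span_diff span_base insertCI)+
  then have "R \<subseteq> span {v, w}" unfolding xy by (intro span_minimal) auto
  moreover have "span {v, w} \<subseteq> R" using assms by (intro span_minimal) auto
  ultimately show ?thesis by auto
qed

lemma common_zero_imp:
  fixes \<phi> \<psi> :: "'a::real_vector \<Rightarrow> real"
  assumes "linear \<phi>" "linear \<psi>" "r \<in> span {v, w}" "r \<noteq> 0" "\<phi> r = 0" "\<psi> r = 0"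
  shows "\<phi> v * \<psi> w - \<phi> w * \<psi> v = 0"
proof -
  obtain a b where "r = a *\<^sub>R v + b *\<^sub>R w" using assms(3) unfolding span2_iff by blast
  with assms have ab: "a \<noteq> 0 \<or> b \<noteq> 0" "\<phi> (a *\<^sub>R v + b *\<^sub>R w) = 0" "\<psi> (a *\<^sub>R v + b *\<^sub>R w) = 0"
    by auto
  then have 1: "a * \<phi> v + b * \<phi> w = 0" and 2: "a * \<psi> v + b * \<psi> w = 0"
    using assms(1,2) by (simp_all add: linear_add linear_scale)
  have "a * (\<phi> v * \<psi> w - \<phi> w * \<psi> v) = (a * \<phi> v + b * \<phi> w) * \<psi> w - \<phi> w * (a * \<psi> v + b * \<psi> w)"
    "b * (\<phi> v * \<psi> w - \<phi> w * \<psi> v) = \<phi> v * (a * \<psi> v + b * \<psi> w) - (a * \<phi> v + b * \<phi> w) * \<psi> v"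
    by (simp_all add: algebra_simps)
  with 1 2 ab(1) show ?thesis by auto
qed

text \<open>The left-hand side is the value of \<open>\<phi> \<and> \<psi>\<close> on a basis of the plane.\<close>

lemma common_zero_plane:
  fixes \<phi> \<psi> :: "'a::real_vector \<Rightarrow> real"
  assumes "linear \<phi>" "linear \<psi>" "indep2 v w"
  shows "\<phi> v * \<psi> w - \<phi> w * \<psi> v = 0 \<longleftrightarrow> (\<exists>r\<in>span {v, w}. r \<noteq> 0 \<and> \<phi> r = 0 \<and> \<psi> r = 0)"
proof
  assume e: "\<phi> v * \<psi> w - \<phi> w * \<psi> v = 0"
  have ne: "a *\<^sub>R v + b *\<^sub>R w \<noteq> 0" if "a \<noteq> 0 \<or> b \<noteq> 0" for a b
    using indep2D[OF assms(3)] that by blast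
  have lin: "\<phi> (a *\<^sub>R v + b *\<^sub>R w) = a * \<phi> v + b * \<phi> w" "\<psi> (a *\<^sub>R v + b *\<^sub>R w) = a * \<psi> v + b * \<psi> w" for a b
    using assms by (simp_all add: linear_add linear_scale)
  \<comment> \<open>A nonzero kernel vector of the singular 2 by 2 matrix of values of \<phi> and
    \<psi> on \<open>v\<close>, \<open>w\<close>: a nonzero row turned by a right angle, or any
    vector if both rows are zero.\<close>
  consider "\<phi> v \<noteq> 0 \<or> \<phi> w \<noteq> 0" | "\<phi> v = 0" "\<phi> w = 0" "\<psi> v \<noteq> 0 \<or> \<psi> w \<noteq> 0"
    | "\<phi> v = 0" "\<phi> w = 0" "\<psi> v = 0" "\<psi> w = 0" by blast
  then obtain a b where "a \<noteq> 0 \<or> b \<noteq> 0" "\<phi> (a *\<^sub>R v + b *\<^sub>R w) = 0" "\<psi> (a *\<^sub>R v + b *\<^sub>R w) = 0"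
  proof cases
    case 1
    have "\<phi> (\<phi> w *\<^sub>R v + (- \<phi> v) *\<^sub>R w) = 0" "\<psi> (\<phi> w *\<^sub>R v + (- \<phi> v) *\<^sub>R w) = 0"
      using e by (simp_all only: lin) (simp_all add: algebra_simps)
    with 1 show ?thesis using that[of "\<phi> w" "- \<phi> v"] by auto
  next
    case 2
    have "\<phi> (\<psi> w *\<^sub>R v + (- \<psi> v) *\<^sub>R w) = 0" "\<psi> (\<psi> w *\<^sub>R v + (- \<psi> v) *\<^sub>R w) = 0"
      using 2 by (simp_all only: lin) (simp_all add: algebra_simps)
    with 2 show ?thesis using that[of "\<psi> w" "- \<psi> v"] by auto
  next
    case 3
    then show ?thesis using that[of 1 0] by auto
  qed
  with ne[of a b] show "\<exists>r\<in>span {v, w}. r \<noteq> 0 \<and> \<phi> r = 0 \<and> \<psi> r = 0"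
    by (intro bexI[of _ "a *\<^sub>R v + b *\<^sub>R w"]) (auto simp: span2_iff)
next
  assume "\<exists>r\<in>span {v, w}. r \<noteq> 0 \<and> \<phi> r = 0 \<and> \<psi> r = 0"
  then show "\<phi> v * \<psi> w - \<phi> w * \<psi> v = 0" using common_zero_imp[OF assms(1,2)] by blast
qed

section \<open>Orthogonal projectors onto planes given by a basis\<close>

definition gram :: "'a::real_inner \<Rightarrow> 'a \<Rightarrow> real" where
  "gram v w = (v \<bullet> v) * (w \<bullet> w) - (v \<bullet> w) * (v \<bullet> w)"

text \<open>The normal equations solved by Cramer's rule. The formula is rational in the basis, so
  the projector onto a smoothly moving plane is smooth wherever \<open>gram\<close> is
  nonzero.\<close>

definition plane_proj :: "'a::real_inner \<Rightarrow> 'a \<Rightarrow> 'a \<Rightarrow> 'a" where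
  "plane_proj v w u = (((w \<bullet> w) * (v \<bullet> u) - (v \<bullet> w) * (w \<bullet> u)) / gram v w) *\<^sub>R v +
     (((v \<bullet> v) * (w \<bullet> u) - (v \<bullet> w) * (v \<bullet> u)) / gram v w) *\<^sub>R w"

lemma gram_nonzero_iff: "gram v w \<noteq> 0 \<longleftrightarrow> indep2 v w"
proof
  assume g: "gram v w \<noteq> 0"
  show "indep2 v w" unfolding indep2_def
  proof (intro allI impI)
    fix a b assume e: "a *\<^sub>R v + b *\<^sub>R w = 0"
    have "(a *\<^sub>R v + b *\<^sub>R w) \<bullet> v = 0" "(a *\<^sub>R v + b *\<^sub>R w) \<bullet> w = 0" by (simp_all only: e inner_zero_left)
    then have 1: "a * (v \<bullet> v) + b * (v \<bullet> w) = 0" and 2: "a * (v \<bullet> w) + b * (w \<bullet> w) = 0"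
      by (simp_all add: inner_add_left inner_commute[of w v])
    have "a * gram v w = (a * (v \<bullet> v) + b * (v \<bullet> w)) * (w \<bullet> w) - (a * (v \<bullet> w) + b * (w \<bullet> w)) * (v \<bullet> w)"
      "b * gram v w = (a * (v \<bullet> w) + b * (w \<bullet> w)) * (v \<bullet> v) - (a * (v \<bullet> v) + b * (v \<bullet> w)) * (v \<bullet> w)"
      by (simp_all add: gram_def algebra_simps)
    with 1 2 g show "a = 0 \<and> b = 0" by auto
  qed
next
  assume i: "indep2 v w"
  show "gram v w \<noteq> 0"
  proof
    assume g: "gram v w = 0"
    \<comment> \<open>The equality case of the Cauchy-Schwarz inequality: this combination has
      square norm \<open>(w \<bullet> w) * gram v w\<close>.\<close>
    let ?u = "(w \<bullet> w) *\<^sub>R v + (- (v \<bullet> w)) *\<^sub>R w"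
    have "?u \<bullet> ?u = (w \<bullet> w) * gram v w"
      by (simp add: inner_add_left inner_add_right inner_commute[of w v] gram_def algebra_simps)
    then have "?u = 0" using g by simp
    from indep2D[OF i this] have "w = 0" by simp
    then show False using indep2D[OF i, of 0 1] by simp
  qed
qed

lemma linear_plane_proj: "linear (plane_proj v w)"
  by (rule linearI) (simp_all add: plane_proj_def inner_add_right algebra_simps add_divide_distrib diff_divide_distrib)

lemma plane_proj_span: "plane_proj v w u \<in> span {v, w}"
  unfolding plane_proj_def span2_iff by blast

lemma plane_proj_basis:
  assumes "indep2 v w"
  shows "plane_proj v w v = v" "plane_proj v w w = w"
  using assms[folded gram_nonzero_iff]
  by (simp_all add: plane_proj_def inner_commute[of w v] mult.commute flip: gram_def)

lemma plane_proj_id: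
  assumes "indep2 v w" "u \<in> span {v, w}"
  shows "plane_proj v w u = u"
  using assms(2) plane_proj_basis[OF assms(1)]
  by (auto simp: span2_iff linear_add[OF linear_plane_proj] linear_scale[OF linear_plane_proj])

lemma range_plane_proj: "indep2 v w \<Longrightarrow> range (plane_proj v w) = span {v, w}"
proof (intro subset_antisym subsetI)
  fix u assume "indep2 v w" "u \<in> span {v, w}"
  then have "u = plane_proj v w u" by (simp add: plane_proj_id)
  then show "u \<in> range (plane_proj v w)" by (rule range_eqI)
qed (auto simp: plane_proj_span)

lemma plane_proj_selfadjoint: "plane_proj v w u \<bullet> u' = u \<bullet> plane_proj v w u'"
  unfolding plane_proj_def inner_add_left inner_add_right inner_scaleR_left inner_scaleR_right
    inner_commute[of u v] inner_commute[of u w]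
  by (simp add: divide_inverse algebra_simps)

text \<open>The difference of the two projectors at \<open>u\<close> lies in the common range.
  Moving both across the inner product by self-adjointness, where they fix that difference, shows
  that its square norm is 0.\<close>

lemma plane_proj_unique:
  assumes i: "indep2 v w" and P: "\<And>u u'. P u \<bullet> u' = u \<bullet> P u'" "\<And>u. P (P u) = P u"
    and rng: "range P = span {v, w}"
  shows "P u = plane_proj v w u"
proof -
  let ?d = "P u - plane_proj v w u"
  have fix_P: "P y = y" if "y \<in> span {v, w}" for y using that P(2) rng by (metis rangeE)
  have d: "?d \<in> span {v, w}" using rng plane_proj_span by (blast intro: span_diff)
  have "?d \<bullet> ?d = u \<bullet> P ?d - u \<bullet> plane_proj v w ?d"
    by (simp add: inner_diff_left P(1) plane_proj_selfadjoint)
  also have "\<dots> = 0" using fix_P[OF d] plane_proj_id[OF i d] by simp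
  finally show ?thesis by simp
qed

text \<open>The dual frame may be chosen smooth: the last dual vector is a fixed vector corrected by the
  previous ones and then rescaled.\<close>

lemma smooth_dual_frame:
  fixes b :: "nat \<Rightarrow> 'a::euclidean_space \<Rightarrow> 'b::euclidean_space"
  assumes W: "open W" "m \<in> W" and b: "\<And>i. i < k \<Longrightarrow> smooth_on W (b i)"
    and ind: "\<And>j. j < k \<Longrightarrow> b j m \<notin> span ((\<lambda>i. b i m) ` {..<j})"
  shows "\<exists>W' \<beta>. open W' \<and> m \<in> W' \<and> W' \<subseteq> W \<and> (\<forall>i<k. smooth_on W' (\<beta> i)) \<and>
    (\<forall>p\<in>W'. \<forall>i<k. \<forall>j<k. \<beta> i p \<bullet> b j p = (if i = j then 1 else 0))"
  using b ind
proof (induction k)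
  case 0
  then show ?case using W by blast
next
  case (Suc k)
  obtain W' \<beta> where W': "open W'" "m \<in> W'" "W' \<subseteq> W" and \<beta>: "\<And>i. i < k \<Longrightarrow> smooth_on W' (\<beta> i)"
    and dual: "\<And>p i j. p \<in> W' \<Longrightarrow> i < k \<Longrightarrow> j < k \<Longrightarrow> \<beta> i p \<bullet> b j p = (if i = j then 1 else 0)"
    using Suc.IH Suc.prems by (metis less_Suc_eq)
  obtain y z where yz: "y \<in> span ((\<lambda>i. b i m) ` {..<k})"
    "\<And>w. w \<in> span ((\<lambda>i. b i m) ` {..<k}) \<Longrightarrow> orthogonal z w" "b k m = y + z"
    using orthogonal_subspace_decomp_exists[of "(\<lambda>i. b i m) ` {..<k}" "b k m"] by blast
  have "z \<noteq> 0" using yz Suc.prems(2)[of k] by auto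
  \<comment> \<open>The part of \<open>b k m\<close> orthogonal to the earlier vectors, scaled to
    pair to 1 with \<open>b k m\<close>; it is the fixed vector from which the last dual vector is
    built.\<close>
  define q where "q = (1 / (z \<bullet> z)) *\<^sub>R z"
  have q: "q \<bullet> b i m = 0" if "i < k" for i
    using yz(2)[of "b i m"] that by (auto simp: q_def orthogonal_def span_base)
  have qk: "q \<bullet> b k m = 1"
    using yz(2)[OF yz(1)] \<open>z \<noteq> 0\<close> by (simp add: q_def yz(3) inner_add_right orthogonal_def)
  define g where "g p = q - (\<Sum>i<k. (q \<bullet> b i p) *\<^sub>R \<beta> i p)" for p
  have sb: "smooth_on W' (b i)" if "i < Suc k" for i
    using smooth_on_subset[OF Suc.prems(1)[OF that] W'(1,3)] .
  have g: "smooth_on W' g" unfolding g_def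
    by (intro smooth_on_diff smooth_on_sum smooth_on_scaleR smooth_on_inner smooth_on_const W'(1) \<beta> sb) auto
  have go: "g p \<bullet> b j p = 0" if "p \<in> W'" "j < k" for p j
  proof -
    have "g p \<bullet> b j p = q \<bullet> b j p - (\<Sum>i<k. (q \<bullet> b i p) * (\<beta> i p \<bullet> b j p))"
      by (simp add: g_def inner_diff_left inner_sum_left)
    also have "(\<Sum>i<k. (q \<bullet> b i p) * (\<beta> i p \<bullet> b j p)) = (\<Sum>i<k. if i = j then q \<bullet> b i p else 0)"
      using that dual by (intro sum.cong) auto
    finally show ?thesis using that by simp
  qed
  define h where "h p = g p \<bullet> b k p" for p
  have h: "smooth_on W' h" unfolding h_def by (intro smooth_on_inner g sb) simp
  have hm: "h m = 1" using q qk by (simp add: h_def g_def)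
  define W2 where "W2 = {p \<in> W'. h p \<noteq> 0}"
  have W2: "open W2" "m \<in> W2" "W2 \<subseteq> W'" using smooth_on_open_nonzero[OF h] W' hm by (auto simp: W2_def)
  define e where "e p = (1 / h p) *\<^sub>R g p" for p
  have e: "smooth_on W2 e" unfolding e_def
    by (intro smooth_on_scaleR smooth_on_divide smooth_on_const W2 smooth_on_subset[OF h] smooth_on_subset[OF g])
       (auto simp: W2_def)
  have e0: "e p \<bullet> b j p = 0" if "p \<in> W2" "j < k" for p j using go that W2 by (auto simp: e_def)
  have e1: "e p \<bullet> b k p = 1" if "p \<in> W2" for p using that by (simp add: e_def h_def[symmetric] W2_def)
  \<comment> \<open>Since \<open>e\<close> is orthogonal to the earlier fields, subtracting
    multiples of it repairs the pairings with \<open>b k\<close> and leaves the others as they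
    are.\<close>
  define \<gamma> where "\<gamma> i = (if i = k then e else (\<lambda>p. \<beta> i p - (\<beta> i p \<bullet> b k p) *\<^sub>R e p))" for i
  have "smooth_on W2 (\<gamma> i)" if "i < Suc k" for i
  proof (cases "i = k")
    case False
    then have "i < k" using that by simp
    then have "smooth_on W2 (\<beta> i)" "smooth_on W2 (b k)"
      using smooth_on_subset[OF \<beta> W2(1,3)] smooth_on_subset[OF sb W2(1,3)] by auto
    then show ?thesis using False by (auto simp: \<gamma>_def intro!: smooth_on_diff smooth_on_scaleR smooth_on_inner e)
  qed (simp add: \<gamma>_def e)
  moreover have "\<gamma> i p \<bullet> b j p = (if i = j then 1 else 0)" if "p \<in> W2" "i < Suc k" "j < Suc k" for p i j
    using that e0[OF that(1)] e1[OF that(1)] dual[of p] W2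
    by (auto simp: \<gamma>_def inner_diff_left less_Suc_eq)
  ultimately show ?case using W2 W' by (intro exI[of _ W2] exI[of _ \<gamma>]) auto
qed

section \<open>Nondegeneracy of contact forms\<close>

text \<open>Reindexing by the transposition reverses the sign and preserves \<open>h\<close>, so the
  sum equals its own negative.\<close>

lemma signed_sum_symmetric_zero:
  fixes h :: "(nat \<Rightarrow> nat) \<Rightarrow> real"
  assumes ab: "a < n" "b < n" "a \<noteq> b" and h: "\<And>\<sigma>. h (\<sigma> \<circ> Transposition.transpose a b) = h \<sigma>"
  shows "(\<Sum>\<sigma> | \<sigma> permutes {..<n}. real_of_int (sign \<sigma>) * h \<sigma>) = 0"
proof -
  let ?S = "\<Sum>\<sigma> | \<sigma> permutes {..<n}. real_of_int (sign \<sigma>) * h \<sigma>"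
  have t: "Transposition.transpose a b permutes {..<n}" using ab by (intro permutes_swap_id) auto
  have pt: "permutation (Transposition.transpose a b)" using t permutation_permutes by blast
  have "?S = (\<Sum>\<sigma> | \<sigma> permutes {..<n}. real_of_int (sign (\<sigma> \<circ> Transposition.transpose a b)) * h (\<sigma> \<circ> Transposition.transpose a b))"
    by (rule sum_permutations_compose_right[OF t])
  also have "\<dots> = (\<Sum>\<sigma> | \<sigma> permutes {..<n}. - (real_of_int (sign \<sigma>) * h \<sigma>))"
  proof (intro sum.cong refl)
    fix \<sigma> assume "\<sigma> \<in> {\<sigma>. \<sigma> permutes {..<n}}"
    then have "permutation \<sigma>" using permutation_permutes by blast
    then show "real_of_int (sign (\<sigma> \<circ> Transposition.transpose a b)) * h (\<sigma> \<circ> Transposition.transpose a b) = - (real_of_int (sign \<sigma>) * h \<sigma>)"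
      using pt ab by (simp add: sign_compose sign_swap_id h)
  qed
  also have "\<dots> = - ?S" by (simp add: sum_negf)
  finally show ?thesis by simp
qed

text \<open>The sum is a wedge product of five 1-forms; when a factor occurs twice, the
  transposition of its two positions is a symmetry of the summand.\<close>

lemma signed_sum_repeated_zero:
  fixes t f g h k :: "nat \<Rightarrow> real"
  assumes "t \<in> {f, g, h, k} \<or> f \<in> {g, h, k} \<or> g \<in> {h, k} \<or> h = k"
  shows "(\<Sum>\<sigma> | \<sigma> permutes {..<5}. real_of_int (sign \<sigma>) * (t (\<sigma> 0) * (f (\<sigma> 1) * (g (\<sigma> 2) * (h (\<sigma> 3) * k (\<sigma> 4)))))) = 0"
proof -
  have z: ?thesis if "a < 5" "b < 5" "a \<noteq> b"
    "\<And>\<sigma>::nat \<Rightarrow> nat. (\<lambda>\<sigma>. t (\<sigma> 0) * (f (\<sigma> 1) * (g (\<sigma> 2) * (h (\<sigma> 3) * k (\<sigma> 4))))) (\<sigma> \<circ> Transposition.transpose a b) =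
      (\<lambda>\<sigma>. t (\<sigma> 0) * (f (\<sigma> 1) * (g (\<sigma> 2) * (h (\<sigma> 3) * k (\<sigma> 4))))) \<sigma>" for a b
    using signed_sum_symmetric_zero[OF that(1-3), of "\<lambda>\<sigma>. t (\<sigma> 0) * (f (\<sigma> 1) * (g (\<sigma> 2) * (h (\<sigma> 3) * k (\<sigma> 4))))"] that(4)
    by simp
  consider "t = f" | "t = g" | "t = h" | "t = k" | "f = g" | "f = h" | "f = k" | "g = h" | "g = k" | "h = k"
    using assms by blast
  then show ?thesis
  proof cases
    case 1 then show ?thesis by (intro z[of 0 1]) (auto simp: Transposition.transpose_def)
  next case 2 then show ?thesis by (intro z[of 0 2]) (auto simp: Transposition.transpose_def)
  next case 3 then show ?thesis by (intro z[of 0 3]) (auto simp: Transposition.transpose_def)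
  next case 4 then show ?thesis by (intro z[of 0 4]) (auto simp: Transposition.transpose_def)
  next case 5 then show ?thesis by (intro z[of 1 2]) (auto simp: Transposition.transpose_def)
  next case 6 then show ?thesis by (intro z[of 1 3]) (auto simp: Transposition.transpose_def)
  next case 7 then show ?thesis by (intro z[of 1 4]) (auto simp: Transposition.transpose_def)
  next case 8 then show ?thesis by (intro z[of 2 3]) (auto simp: Transposition.transpose_def)
  next case 9 then show ?thesis by (intro z[of 2 4]) (auto simp: Transposition.transpose_def)
  next case 10 then show ?thesis by (intro z[of 3 4]) (auto simp: Transposition.transpose_def)
  qed
qed

text \<open>Apart from the last summand, \<omega> is built from three 1-forms only, so in its square
  each term repeats one of them. The last summand contains \<open>t\<close> and is killed by the
  factor \<alpha>.\<close>

lemma wedge_1_2_2_eq_0: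
  fixes t x1 x2 x3 \<tau> :: "nat \<Rightarrow> real"
  assumes \<alpha>: "\<And>i. \<alpha> (e i) = t i"
    and \<omega>: "\<And>i j. \<omega> (e i) (e j) = A * (x1 i * x2 j - x2 i * x1 j) + B * (x1 i * x3 j - x3 i * x1 j) +
      C * (x2 i * x3 j - x3 i * x2 j) + (t i * \<tau> j - \<tau> i * t j)"
  shows "wedge_1_2_2 \<alpha> \<omega> e = 0"
proof -
  let ?P = "{\<sigma>. \<sigma> permutes {..<5::nat}}"
  \<comment> \<open>The four decomposable summands of \<omega> are encoded as coefficient
    \<open>c k\<close> and factors \<open>g k\<close>, \<open>h k\<close>, so that the square
    becomes a double sum over k and l.\<close>
  define c where "c = (\<lambda>k::nat. [A, B, C, 1] ! k)"
  define g where "g = (\<lambda>k::nat. [x1, x1, x2, t] ! k)"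
  define h where "h = (\<lambda>k::nat. [x2, x3, x3, \<tau>] ! k)"
  have 4: "{..<4::nat} = {0, 1, 2, 3}" by auto
  have om: "\<omega> (e i) (e j) = (\<Sum>k<4. c k * (g k i * h k j - h k i * g k j))" for i j
    unfolding \<omega> 4 by (simp add: c_def g_def h_def numeral_2_eq_2 numeral_3_eq_3)
  have pair: "(\<Sum>\<sigma>\<in>?P. real_of_int (sign \<sigma>) * (t (\<sigma> 0) * ((p (\<sigma> 1) * q (\<sigma> 2) - q (\<sigma> 1) * p (\<sigma> 2)) *
      (p' (\<sigma> 3) * q' (\<sigma> 4) - q' (\<sigma> 3) * p' (\<sigma> 4))))) = 0"
    if "t \<in> {p, q, p', q'} \<or> p \<in> {p', q'} \<or> q \<in> {p', q'}" for p q p' q'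
  proof -
    have "(\<Sum>\<sigma>\<in>?P. real_of_int (sign \<sigma>) * (t (\<sigma> 0) * ((p (\<sigma> 1) * q (\<sigma> 2) - q (\<sigma> 1) * p (\<sigma> 2)) *
      (p' (\<sigma> 3) * q' (\<sigma> 4) - q' (\<sigma> 3) * p' (\<sigma> 4))))) =
      (\<Sum>\<sigma>\<in>?P. real_of_int (sign \<sigma>) * (t (\<sigma> 0) * (p (\<sigma> 1) * (q (\<sigma> 2) * (p' (\<sigma> 3) * q' (\<sigma> 4)))))) -
      (\<Sum>\<sigma>\<in>?P. real_of_int (sign \<sigma>) * (t (\<sigma> 0) * (p (\<sigma> 1) * (q (\<sigma> 2) * (q' (\<sigma> 3) * p' (\<sigma> 4)))))) -
      (\<Sum>\<sigma>\<in>?P. real_of_int (sign \<sigma>) * (t (\<sigma> 0) * (q (\<sigma> 1) * (p (\<sigma> 2) * (p' (\<sigma> 3) * q' (\<sigma> 4)))))) +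
      (\<Sum>\<sigma>\<in>?P. real_of_int (sign \<sigma>) * (t (\<sigma> 0) * (q (\<sigma> 1) * (p (\<sigma> 2) * (q' (\<sigma> 3) * p' (\<sigma> 4))))))"
      unfolding sum_subtractf[symmetric] sum.distrib[symmetric]
      by (intro sum.cong refl) (simp add: algebra_simps)
    also have "\<dots> = 0"
    proof -
      have "t \<in> {p, q, p', q'} \<or> p \<in> {q, p', q'} \<or> q \<in> {p', q'} \<or> p' = q'"
        "t \<in> {p, q, q', p'} \<or> p \<in> {q, q', p'} \<or> q \<in> {q', p'} \<or> q' = p'"
        "t \<in> {q, p, p', q'} \<or> q \<in> {p, p', q'} \<or> p \<in> {p', q'} \<or> p' = q'"
        "t \<in> {q, p, q', p'} \<or> q \<in> {p, q', p'} \<or> p \<in> {q', p'} \<or> q' = p'"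
        using that by auto
      note z = this[THEN signed_sum_repeated_zero]
      show ?thesis unfolding z by simp
    qed
    finally show ?thesis .
  qed
  have "wedge_1_2_2 \<alpha> \<omega> e = (\<Sum>\<sigma>\<in>?P. \<Sum>k<4. \<Sum>l<4. c k * c l * (real_of_int (sign \<sigma>) * (t (\<sigma> 0) *
      ((g k (\<sigma> 1) * h k (\<sigma> 2) - h k (\<sigma> 1) * g k (\<sigma> 2)) * (g l (\<sigma> 3) * h l (\<sigma> 4) - h l (\<sigma> 3) * g l (\<sigma> 4))))))"
    unfolding wedge_1_2_2_def \<alpha> om
  proof (intro sum.cong refl)
    fix \<sigma> :: "nat \<Rightarrow> nat"
    show "real_of_int (sign \<sigma>) * t (\<sigma> 0) * (\<Sum>k<4. c k * (g k (\<sigma> 1) * h k (\<sigma> 2) - h k (\<sigma> 1) * g k (\<sigma> 2))) *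
      (\<Sum>k<4. c k * (g k (\<sigma> 3) * h k (\<sigma> 4) - h k (\<sigma> 3) * g k (\<sigma> 4))) =
      (\<Sum>k<4. \<Sum>l<4. c k * c l * (real_of_int (sign \<sigma>) * (t (\<sigma> 0) *
      ((g k (\<sigma> 1) * h k (\<sigma> 2) - h k (\<sigma> 1) * g k (\<sigma> 2)) * (g l (\<sigma> 3) * h l (\<sigma> 4) - h l (\<sigma> 3) * g l (\<sigma> 4))))))"
      unfolding mult.assoc[of "real_of_int (sign \<sigma>) * t (\<sigma> 0)"] sum_product
      unfolding sum_distrib_left by (intro sum.cong refl) (simp only: mult.assoc mult.left_commute)
  qed
  also have "\<dots> = (\<Sum>k<4. \<Sum>\<sigma>\<in>?P. \<Sum>l<4. c k * c l * (real_of_int (sign \<sigma>) * (t (\<sigma> 0) *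
      ((g k (\<sigma> 1) * h k (\<sigma> 2) - h k (\<sigma> 1) * g k (\<sigma> 2)) * (g l (\<sigma> 3) * h l (\<sigma> 4) - h l (\<sigma> 3) * g l (\<sigma> 4))))))"
    by (rule sum.swap)
  also have "\<dots> = (\<Sum>k<4. \<Sum>l<4. \<Sum>\<sigma>\<in>?P. c k * c l * (real_of_int (sign \<sigma>) * (t (\<sigma> 0) *
      ((g k (\<sigma> 1) * h k (\<sigma> 2) - h k (\<sigma> 1) * g k (\<sigma> 2)) * (g l (\<sigma> 3) * h l (\<sigma> 4) - h l (\<sigma> 3) * g l (\<sigma> 4))))))"
    by (intro sum.cong refl sum.swap)
  also have "\<dots> = 0"
  proof (rule sum.neutral, rule ballI, rule sum.neutral, rule ballI)
    fix k l :: nat assume "k \<in> {..<4}" "l \<in> {..<4}"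
    then have "t \<in> {g k, h k, g l, h l} \<or> g k \<in> {g l, h l} \<or> h k \<in> {g l, h l}"
      unfolding 4 by (auto simp: g_def h_def numeral_2_eq_2 numeral_3_eq_3)
    from pair[OF this] show "(\<Sum>\<sigma>\<in>?P. c k * c l * (real_of_int (sign \<sigma>) * (t (\<sigma> 0) *
      ((g k (\<sigma> 1) * h k (\<sigma> 2) - h k (\<sigma> 1) * g k (\<sigma> 2)) * (g l (\<sigma> 3) * h l (\<sigma> 4) - h l (\<sigma> 3) * g l (\<sigma> 4)))))) = 0"
      by (simp only: sum_distrib_left[symmetric])
  qed
  finally show ?thesis .
qed

text \<open>Choose \<open>r\<close> transverse to the kernel of \<alpha>. If a nonzero
  \<open>v\<close> were in the radical on that kernel, then by the dimension bound \<omega> would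
  involve at most three coordinates of the kernel besides terms containing \<alpha>, and the wedge
  product would vanish.\<close>

lemma wedge_1_2_2_nondegenerate:
  fixes T :: "'a::euclidean_space set"
  assumes T: "subspace T" "dim T \<le> 5" and \<alpha>: "linear \<alpha>" and \<omega>: "bilinear \<omega>" "\<And>u. \<omega> u u = 0"
    and e: "\<And>i. e i \<in> T" "wedge_1_2_2 \<alpha> \<omega> e \<noteq> 0"
    and v: "v \<in> T" "\<alpha> v = 0" "\<And>w. w \<in> T \<Longrightarrow> \<alpha> w = 0 \<Longrightarrow> \<omega> v w = 0"
  shows "v = 0"
proof (rule ccontr)
  assume v0: "v \<noteq> 0"
  have anti: "\<omega> x y = - \<omega> y x" for x y
  proof -
    have "\<omega> (x + y) (x + y) = \<omega> x x + \<omega> x y + \<omega> y x + \<omega> y y"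
      by (simp add: bilinear_ladd[OF \<omega>(1)] bilinear_radd[OF \<omega>(1)])
    then show ?thesis using \<omega>(2) by simp
  qed
  have "\<exists>r\<in>T. \<alpha> r \<noteq> 0"
  proof (rule ccontr)
    assume "\<not> ?thesis"
    then have "wedge_1_2_2 \<alpha> \<omega> e = 0" using e(1) by (auto simp: wedge_1_2_2_def)
    with e(2) show False by simp
  qed
  then obtain r0 where r0: "r0 \<in> T" "\<alpha> r0 \<noteq> 0" by blast
  define r where "r = (1 / \<alpha> r0) *\<^sub>R r0"
  have r: "r \<in> T" "\<alpha> r = 1" using r0 T \<alpha> by (auto simp: r_def subspace_scale linear_scale)
  have "r \<notin> span {v}" using r v \<alpha> by (auto simp: span_singleton linear_scale)
  then have ind: "independent {r, v}" "r \<noteq> v" using v0 by (auto simp: independent_insert span_base)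
  obtain B where B: "{r, v} \<subseteq> B" "B \<subseteq> T" "independent B" "T \<subseteq> span B"
    using maximal_independent_subset_extend[of "{r, v}" T] r v ind by blast
  have finB: "finite B" using B(3) independent_imp_finite by blast
  have "card B \<le> 5" using independent_card_le_dim[OF B(2,3)] T(2) by simp
  then have "card (B - {r, v}) \<le> 3" using B(1) ind(2) finB by (simp add: card_Diff_subset)
  then obtain c1 c2 c3 where c: "B - {r, v} \<subseteq> {c1, c2, c3}" "c1 \<in> T" "c2 \<in> T" "c3 \<in> T"
  proof -
    obtain xs where xs: "set xs = B - {r, v}" "length xs \<le> 3"
      using \<open>card (B - {r, v}) \<le> 3\<close> finB by (metis finite_Diff finite_distinct_list distinct_card)
    \<comment> \<open>The remaining basis vectors, padded with 0 up to three; the padding is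
      harmless because only spanning matters below.\<close>
    define f where "f i = (if i < length xs then xs ! i else 0)" for i
    have "B - {r, v} \<subseteq> {f 0, f 1, f 2}"
    proof
      fix x assume "x \<in> B - {r, v}"
      then obtain i where "i < length xs" "x = xs ! i" using xs by (metis in_set_conv_nth)
      moreover from this have "i = 0 \<or> i = 1 \<or> i = 2" using xs(2) by linarith
      ultimately show "x \<in> {f 0, f 1, f 2}" by (auto simp: f_def)
    qed
    moreover have "f i \<in> T" for i
      using xs(1) B(2) nth_mem[of i xs] T(1) by (auto simp: f_def subspace_0)
    ultimately show ?thesis using that by blast
  qed
  \<comment> \<open>Projection onto the kernel of \<alpha> along \<open>r\<close>.\<close>
  define d where "d x = x - \<alpha> x *\<^sub>R r" for x
  have d: "d x \<in> T" "\<alpha> (d x) = 0" if "x \<in> T" for x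
    using that r T \<alpha> by (auto simp: d_def subspace_diff subspace_scale linear_diff linear_scale)
  have "\<exists>x0 x1 x2 x3. d (e i) = x0 *\<^sub>R v + (x1 *\<^sub>R d c1 + (x2 *\<^sub>R d c2 + x3 *\<^sub>R d c3))" for i
  proof -
    have "T \<subseteq> span (insert r (insert v (insert c1 (insert c2 {c3}))))"
      using B(4) c(1) span_mono[of B "insert r (insert v (insert c1 (insert c2 {c3})))"] by blast
    then have "e i \<in> span (insert r (insert v (insert c1 (insert c2 {c3}))))" using e(1) by blast
    then obtain k0 k1 k2 k3 k4 where
      k: "e i - k0 *\<^sub>R r - k1 *\<^sub>R v - k2 *\<^sub>R c1 - k3 *\<^sub>R c2 = k4 *\<^sub>R c3"
      unfolding span_insert by (auto simp: span_singleton)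
    have e': "e i = k0 *\<^sub>R r + k1 *\<^sub>R v + k2 *\<^sub>R c1 + k3 *\<^sub>R c2 + k4 *\<^sub>R c3"
      using k by (simp add: algebra_simps)
    have "d (e i) = k1 *\<^sub>R v + (k2 *\<^sub>R d c1 + (k3 *\<^sub>R d c2 + k4 *\<^sub>R d c3))"
      unfolding d_def e' using v(2) r(2) by (simp add: linear_add[OF \<alpha>] linear_scale[OF \<alpha>] algebra_simps)
    then show ?thesis by blast
  qed
  then obtain x0 x1 x2 x3 where x: "\<And>i. d (e i) = x0 i *\<^sub>R v + (x1 i *\<^sub>R d c1 + (x2 i *\<^sub>R d c2 + x3 i *\<^sub>R d c3))"
    by metis
  have ei: "e i = \<alpha> (e i) *\<^sub>R r + d (e i)" for i by (simp add: d_def)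
  note bil = bilinear_ladd[OF \<omega>(1)] bilinear_radd[OF \<omega>(1)] bilinear_lmul[OF \<omega>(1)] bilinear_rmul[OF \<omega>(1)]
  have vd: "\<omega> v (d c) = 0" "\<omega> (d c) v = 0" if "c \<in> T" for c
    using v(3)[OF d[OF that]] anti[of "d c" v] by simp_all
  have "wedge_1_2_2 \<alpha> \<omega> e = 0"
  proof (rule wedge_1_2_2_eq_0[where t = "\<lambda>i. \<alpha> (e i)" and \<tau> = "\<lambda>j. \<omega> r (d (e j))"])
    fix i j
    have dd: "\<omega> (d (e i)) (d (e j)) = \<omega> (d c1) (d c2) * (x1 i * x2 j - x2 i * x1 j) +
      \<omega> (d c1) (d c3) * (x1 i * x3 j - x3 i * x1 j) + \<omega> (d c2) (d c3) * (x2 i * x3 j - x3 i * x2 j)"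
      unfolding x bil using vd c \<omega>(2) anti[of "d c2" "d c1"] anti[of "d c3" "d c1"] anti[of "d c3" "d c2"]
      by (simp add: algebra_simps)
    have "\<omega> (e i) (e j) = \<alpha> (e i) * \<omega> r (d (e j)) + \<alpha> (e j) * \<omega> (d (e i)) r + \<omega> (d (e i)) (d (e j))"
      by (subst ei[of i], subst ei[of j]) (simp add: bil \<omega>(2))
    then show "\<omega> (e i) (e j) = \<omega> (d c1) (d c2) * (x1 i * x2 j - x2 i * x1 j) +
      \<omega> (d c1) (d c3) * (x1 i * x3 j - x3 i * x1 j) + \<omega> (d c2) (d c3) * (x2 i * x3 j - x3 i * x2 j) +
      (\<alpha> (e i) * \<omega> r (d (e j)) - \<omega> r (d (e i)) * \<alpha> (e j))"
      unfolding dd using anti[of "d (e i)" r] by simp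
  qed simp
  with e(2) show False by simp
qed

section \<open>Two-forms vanishing on isotropic planes\<close>

text \<open>Here \<open>A = \<Phi> k\<^sub>1 l\<^sub>2\<close> and \<open>B = \<Phi> k\<^sub>2 l\<^sub>2\<close> are the only free components of \<open>\<Phi>\<close>: the hypothesis is a
  polynomial identity in \<open>q, r\<close>, whose coefficients determine the others.\<close>

lemma form_vanishing_on_isotropic_planes:
  fixes \<Phi> :: "'e::euclidean_space \<Rightarrow> 'e \<Rightarrow> real" and \<Omega> :: "'e \<Rightarrow> 'e \<Rightarrow> 'f::euclidean_space"
  assumes \<Phi>: "bilinear \<Phi>" "\<And>u. \<Phi> u u = 0" and \<Omega>: "bilinear \<Omega>" "\<And>u. \<Omega> u u = 0"
    and \<alpha>: "linear \<alpha>" "\<alpha> F1 = \<Phi> k1 l2" "\<alpha> F2 = \<Phi> k2 l2"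
    and val: "\<Omega> k1 k2 = 0" "\<Omega> k1 l1 = F2 - a *\<^sub>R F1" "\<Omega> k1 l2 = F1" "\<Omega> k2 l1 = (- b) *\<^sub>R F1" "\<Omega> k2 l2 = F2"
      "\<Omega> l1 l2 = c1 *\<^sub>R F1 + c2 *\<^sub>R F2"
    and van: "\<And>q r. \<Phi> (l1 + (- c1 - a * q - b * r) *\<^sub>R k1 + (q - c2) *\<^sub>R k2) (l2 + q *\<^sub>R k1 + r *\<^sub>R k2) = 0"
    and u: "u \<in> span {l1, l2, k1, k2}" and w: "w \<in> span {l1, l2, k1, k2}"
  shows "\<Phi> u w = \<alpha> (\<Omega> u w)"
proof -
  note bil = bilinear_ladd[OF \<Phi>(1)] bilinear_radd[OF \<Phi>(1)] bilinear_lmul[OF \<Phi>(1)] bilinear_rmul[OF \<Phi>(1)]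
  have antiP: "\<Phi> x y = - \<Phi> y x" for x y
  proof -
    have "\<Phi> (x + y) (x + y) = \<Phi> x x + \<Phi> x y + \<Phi> y x + \<Phi> y y"
      by (simp add: bil)
    then show ?thesis using \<Phi>(2) by simp
  qed
  have antiO: "\<Omega> x y = - \<Omega> y x" for x y
  proof -
    have "\<Omega> (x + y) (x + y) = \<Omega> x x + \<Omega> x y + \<Omega> y x + \<Omega> y y"
      by (simp add: bilinear_ladd[OF \<Omega>(1)] bilinear_radd[OF \<Omega>(1)])
    then have "\<Omega> x y + \<Omega> y x = 0" using \<Omega>(2) by simp
    then show ?thesis by (rule eq_neg_iff_add_eq_0[THEN iffD2])
  qed
  let ?A = "\<Phi> k1 l2" and ?B = "\<Phi> k2 l2" and ?K = "\<Phi> k1 k2"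
  have van': "\<Phi> l1 l2 - q * \<Phi> k1 l1 - r * \<Phi> k2 l1 + (- c1 - a * q - b * r) * ?A + (q - c2) * ?B +
     ((- c1 - a * q - b * r) * r - (q - c2) * q) * ?K = 0" for q r
    using van[of q r, unfolded bil real_scaleR_def \<Phi>(2) antiP[of l1 k1] antiP[of l1 k2] antiP[of k2 k1]]
    by (simp add: algebra_simps)
  \<comment> \<open>The second difference in \<open>q\<close> isolates the coefficient
    \<open>- ?K\<close> of the square of \<open>q\<close>; the remaining relations come from the
    constant and linear terms.\<close>
  have K: "?K = 0" using van'[of 0 0] van'[of 1 0] van'[of "-1" 0] by (simp add: algebra_simps)
  have p12: "\<Phi> l1 l2 = c1 * ?A + c2 * ?B" using van'[of 0 0] K by simp
  have p11: "\<Phi> k1 l1 = ?B - a * ?A" using van'[of 1 0] p12 K by (simp add: algebra_simps)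
  have p21: "\<Phi> k2 l1 = - b * ?A" using van'[of 0 1] p12 K by (simp add: algebra_simps)
  have bilO: "bilinear (\<lambda>x y. \<alpha> (\<Omega> x y))"
    using \<Omega>(1) linear_compose[OF _ \<alpha>(1)] unfolding bilinear_def o_def by blast
  have base: "\<Phi> k1 k2 = \<alpha> (\<Omega> k1 k2)" "\<Phi> k1 l1 = \<alpha> (\<Omega> k1 l1)" "\<Phi> k1 l2 = \<alpha> (\<Omega> k1 l2)"
    "\<Phi> k2 l1 = \<alpha> (\<Omega> k2 l1)" "\<Phi> k2 l2 = \<alpha> (\<Omega> k2 l2)" "\<Phi> l1 l2 = \<alpha> (\<Omega> l1 l2)"
    unfolding val using K p12 p11 p21
    by (simp_all add: \<alpha>(2,3) linear_0[OF \<alpha>(1)] linear_diff[OF \<alpha>(1)] linear_add[OF \<alpha>(1)] linear_scale[OF \<alpha>(1)]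
      linear_neg[OF \<alpha>(1)])
  have sw: "\<Phi> y x = \<alpha> (\<Omega> y x)" if "\<Phi> x y = \<alpha> (\<Omega> x y)" for x y
    using that antiP[of y x] antiO[of y x] by (simp add: linear_neg[OF \<alpha>(1)])
  show ?thesis
  proof (rule bilinear_eq[OF \<Phi>(1) bilO subset_refl subset_refl u w])
    fix x y assume "x \<in> {l1, l2, k1, k2}" "y \<in> {l1, l2, k1, k2}"
    then show "\<Phi> x y = \<alpha> (\<Omega> x y)"
      using base sw[OF base(1)] sw[OF base(2)] sw[OF base(3)] sw[OF base(4)] sw[OF base(5)] sw[OF base(6)]
      by (auto simp: \<Phi>(2) \<Omega>(2) linear_0[OF \<alpha>(1)])
  qed
qed

section \<open>Local contact geometry\<close>

lemma bilinear_ext_deriv: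
  assumes "smooth_on U \<theta>" "x \<in> U"
  shows "bilinear (ext_deriv \<theta> x)"
proof -
  have l: "linear (frechet_derivative \<theta> (at x))" by (rule smooth_on_linear_derivative[OF assms])
  show ?thesis unfolding bilinear_def
    by (intro conjI allI linearI)
       (simp_all add: ext_deriv_def linear_add[OF l] linear_scale[OF l] blinfun.add_left blinfun.add_right
        blinfun.scaleR_left blinfun.scaleR_right algebra_simps)
qed

lemma ext_deriv_self: "ext_deriv \<theta> x v v = 0"
  by (simp add: ext_deriv_def)

lemma ext_deriv_swap: "ext_deriv \<theta> x v w = - ext_deriv \<theta> x w v"
  by (simp add: ext_deriv_def)

lemma smooth_on_ext_deriv:
  fixes \<theta> :: "'b::euclidean_space \<Rightarrow> 'b \<Rightarrow>\<^sub>L real"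
  assumes "smooth_on U \<theta>" "smooth_on S y" "y ` S \<subseteq> U" "smooth_on S u" "smooth_on S w"
  shows "smooth_on S (\<lambda>p. ext_deriv \<theta> (y p) (u p) (w p))"
  unfolding ext_deriv_def
  by (intro smooth_on_diff smooth_on_blinfun_apply smooth_on_derivative_apply[OF assms(1-3)] assms)

lemma wedge_nonzero_imp:
  assumes "wedge_1_2_2 \<alpha> \<omega> e \<noteq> 0"
  shows "\<exists>i. \<alpha> (e i) \<noteq> 0"
proof (rule ccontr)
  assume "\<not> ?thesis"
  then have "wedge_1_2_2 \<alpha> \<omega> e = 0" by (simp add: wedge_1_2_2_def)
  with assms show False by simp
qed

text \<open>The tangential part of the fixed vector \<open>r0\<close> is transverse to the contact
  planes throughout the chart. As \<open>\<rho>\<close> maps \<open>X\<close> into itself, \<theta>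
  and \<open>\<rho>\<close> may be evaluated at \<open>\<rho> x\<close> for points off
  \<open>M\<close>.\<close>

locale contact_chart =
  fixes M :: "(real^'n::finite) set" and C :: "real^'n \<Rightarrow> (real^'n) set"
    and X :: "(real^'n) set" and \<rho> :: "real^'n \<Rightarrow> real^'n"
    and \<theta> :: "real^'n \<Rightarrow> ((real^'n) \<Rightarrow>\<^sub>L real)" and r0 :: "real^'n"
  assumes retraction: "smooth_retraction M X \<rho>" and rho_X: "\<rho> ` X \<subseteq> X"
    and contact_form: "local_contact_form M C X \<theta>"
    and r0: "x \<in> X \<Longrightarrow> blinfun_apply (\<theta> x) (frechet_derivative \<rho> (at x) r0) \<noteq> 0"
    and dim_T: "x \<in> M \<Longrightarrow> x \<in> X \<Longrightarrow> dim (tangent_space M x) \<le> 5"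
begin

abbreviation "d\<theta> \<equiv> ext_deriv \<theta>"

abbreviation "T x \<equiv> frechet_derivative \<rho> (at x)"

text \<open>On \<open>M\<close> this is the projector onto \<open>C x\<close>: tangential part
  first, then along the transverse field. The formula is smooth on all of \<open>X\<close>, so fixed
  ambient vectors yield smooth contact fields.\<close>

definition "Q x u = T x u - (blinfun_apply (\<theta> x) (T x u) / blinfun_apply (\<theta> x) (T x r0)) *\<^sub>R T x r0"

lemma smooth_rho: "smooth_on X \<rho>" and rho_M: "x \<in> X \<Longrightarrow> \<rho> x \<in> M" and rho_id: "x \<in> M \<Longrightarrow> x \<in> X \<Longrightarrow> \<rho> x = x"
  using retraction by (auto simp: smooth_retraction_def)

lemma smooth_theta: "smooth_on X \<theta>"
  using contact_form by (simp add: local_contact_form_def)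

lemma linear_T: "x \<in> X \<Longrightarrow> linear (T x)"
  using smooth_rho smooth_on_linear_derivative by blast

lemma linear_theta: "linear (blinfun_apply (\<theta> x))"
  by (simp add: blinfun.bounded_linear_right bounded_linear.linear)

lemma bilinear_dtheta: "x \<in> X \<Longrightarrow> bilinear (d\<theta> x)"
  by (rule bilinear_ext_deriv[OF smooth_theta])

lemma linear_Q:
  assumes "x \<in> X" shows "linear (Q x)"
  unfolding Q_def
  by (rule linearI) (simp_all add: linear_add[OF linear_T[OF assms]] linear_scale[OF linear_T[OF assms]]
      blinfun.add_right blinfun.scaleR_right add_divide_distrib algebra_simps)

lemma theta_Q: "x \<in> X \<Longrightarrow> blinfun_apply (\<theta> x) (Q x u) = 0"
  using r0[of x] by (simp add: Q_def blinfun.diff_right blinfun.scaleR_right)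

section \<open>Symplectic linear algebra in a contact plane\<close>

context
  fixes x assumes x: "x \<in> M" "x \<in> X"
begin

lemma T_iff: "v \<in> tangent_space M x \<longleftrightarrow> T x v = v"
  by (rule tangent_space_retraction[OF retraction x])

lemma subspace_T: "subspace (tangent_space M x)"
  by (rule subspace_tangent_space[OF retraction x])

lemma T_mem: "T x v \<in> tangent_space M x"
  using tangent_space_line[OF smooth_rho, of M x v] x rho_M rho_id by auto

lemma C_iff: "v \<in> C x \<longleftrightarrow> v \<in> tangent_space M x \<and> blinfun_apply (\<theta> x) v = 0"
  using contact_form x unfolding local_contact_form_def by blast

lemma subspace_C: "subspace (C x)"
  using subspace_T by (auto simp: subspace_def C_iff blinfun.add_right blinfun.scaleR_right)

lemma Q_mem: "Q x u \<in> C x"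
  unfolding C_iff using theta_Q[OF x(2)] subspace_diff[OF subspace_T T_mem subspace_scale[OF subspace_T T_mem]]
  by (auto simp: Q_def)

lemma Q_id: "v \<in> C x \<Longrightarrow> Q x v = v"
  by (simp add: Q_def C_iff T_iff)

lemma dtheta_nondegenerate:
  assumes v: "v \<in> C x" "\<And>w. w \<in> C x \<Longrightarrow> d\<theta> x v w = 0"
  shows "v = 0"
proof -
  obtain e where e: "\<And>i. e i \<in> tangent_space M x" "wedge_1_2_2 (blinfun_apply (\<theta> x)) (d\<theta> x) e \<noteq> 0"
    using contact_form x unfolding local_contact_form_def by blast
  show ?thesis
    by (rule wedge_1_2_2_nondegenerate[OF subspace_T dim_T[OF x] linear_theta bilinear_dtheta[OF x(2)]
          ext_deriv_self e]) (use v in \<open>auto simp: C_iff\<close>)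
qed

lemma dim_C: "dim (C x) \<le> 4"
proof -
  have t: "T x r0 \<in> tangent_space M x" "T x r0 \<notin> C x" using T_mem r0[OF x(2)] C_iff by auto
  then have "C x \<subset> tangent_space M x" using C_iff by blast
  then have "span (C x) \<subset> span (tangent_space M x)"
    using subspace_C subspace_T by (metis span_eq_iff)
  from dim_psubset[OF this] dim_T[OF x] show ?thesis by simp
qed

text \<open>If every contact vector annihilated by \<open>w\<close> were also annihilated by
  \<open>v\<close>, then \<open>v\<close> minus a multiple of \<open>w\<close> would lie in the
  radical of d\<theta>, against independence.\<close>

lemma dual_vector:
  assumes v: "v \<in> C x" "w \<in> C x" "indep2 v w"
  obtains f where "f \<in> C x" "d\<theta> x v f = 1" "d\<theta> x w f = 0"
proof -
  note bil = bilinear_dtheta[OF x(2)]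
  have "w \<noteq> 0" using indep2D[OF v(3), of 0 1] by auto
  then obtain c where c: "c \<in> C x" "d\<theta> x w c \<noteq> 0" using dtheta_nondegenerate v(2) by blast
  define c2 where "c2 = (1 / d\<theta> x w c) *\<^sub>R c"
  have c2: "c2 \<in> C x" "d\<theta> x w c2 = 1"
    using c subspace_C by (auto simp: c2_def subspace_scale bilinear_rmul[OF bil])
  have "\<exists>f\<in>C x. d\<theta> x w f = 0 \<and> d\<theta> x v f \<noteq> 0"
  proof (rule ccontr)
    assume n: "\<not> ?thesis"
    have "d\<theta> x (v - d\<theta> x v c2 *\<^sub>R w) f = 0" if f: "f \<in> C x" for f
    proof -
      have "f - d\<theta> x w f *\<^sub>R c2 \<in> C x" using f c2 subspace_C by (simp add: subspace_diff subspace_scale)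
      moreover have "d\<theta> x w (f - d\<theta> x w f *\<^sub>R c2) = 0"
        using c2 by (simp add: bilinear_rsub[OF bil] bilinear_rmul[OF bil])
      ultimately have "d\<theta> x v (f - d\<theta> x w f *\<^sub>R c2) = 0" using n by blast
      then show ?thesis
        by (simp add: bilinear_rsub[OF bil] bilinear_rmul[OF bil] bilinear_lsub[OF bil] bilinear_lmul[OF bil])
    qed
    moreover have "v - d\<theta> x v c2 *\<^sub>R w \<in> C x" using v subspace_C by (simp add: subspace_diff subspace_scale)
    ultimately have "v - d\<theta> x v c2 *\<^sub>R w = 0" using dtheta_nondegenerate by blast
    then show False using indep2D[OF v(3), of 1 "- d\<theta> x v c2"] by simp
  qed
  then obtain f where f: "f \<in> C x" "d\<theta> x w f = 0" "d\<theta> x v f \<noteq> 0" by blast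
  show ?thesis
    by (rule that[of "(1 / d\<theta> x v f) *\<^sub>R f"])
       (use f subspace_C in \<open>auto simp: subspace_scale bilinear_rmul[OF bil]\<close>)
qed

lemma dual_vectors:
  assumes v: "v \<in> C x" "w \<in> C x" "indep2 v w" "d\<theta> x v w = 0"
  obtains f g where "f \<in> C x" "g \<in> C x" "d\<theta> x v f = 1" "d\<theta> x w f = 0" "d\<theta> x v g = 0" "d\<theta> x w g = 1" "d\<theta> x f g = 0"
proof -
  note bil = bilinear_dtheta[OF x(2)]
  obtain f where f: "f \<in> C x" "d\<theta> x v f = 1" "d\<theta> x w f = 0" by (rule dual_vector[OF v(1-3)])
  obtain g where g: "g \<in> C x" "d\<theta> x w g = 1" "d\<theta> x v g = 0"
    by (rule dual_vector[OF v(2,1) indep2_commute[OF v(3)]])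
  \<comment> \<open>Since \<open>d\<theta> x f v\<close> is -1, this multiple of \<open>v\<close>
    makes the dual pair isotropic; isotropy of \<open>v\<close>, \<open>w\<close> preserves the
    pairings of \<open>g\<close> with them.\<close>
  define h where "h = g + d\<theta> x f g *\<^sub>R v"
  show ?thesis
  proof (rule that[of f h])
    show "h \<in> C x" using g v subspace_C by (simp add: h_def subspace_add subspace_scale)
  qed (use f g v(4) ext_deriv_swap[of \<theta> x f v] ext_deriv_swap[of \<theta> x w v] in
    \<open>auto simp: h_def bilinear_radd[OF bil] bilinear_rmul[OF bil] ext_deriv_self\<close>)
qed

text \<open>Otherwise \<open>v\<close>, \<open>w\<close>, \<open>c\<close> and dual vectors
  \<open>f\<close>, \<open>g\<close> would be five independent vectors in a space of dimension at
  most 4: pairing with \<open>v\<close> detects \<open>f\<close>, and pairing with \<open>w\<close>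
  detects \<open>g\<close>.\<close>

lemma isotropic_maximal:
  assumes v: "v \<in> C x" "w \<in> C x" "indep2 v w" "d\<theta> x v w = 0"
    and c: "c \<in> C x" "d\<theta> x v c = 0" "d\<theta> x w c = 0"
  shows "c \<in> span {v, w}"
proof (rule ccontr)
  assume n: "c \<notin> span {v, w}"
  note bil = bilinear_dtheta[OF x(2)]
  obtain f g where f: "f \<in> C x" "g \<in> C x" "d\<theta> x v f = 1" "d\<theta> x w f = 0" "d\<theta> x v g = 0" "d\<theta> x w g = 1" "d\<theta> x f g = 0"
    by (rule dual_vectors[OF v])
  have vv: "d\<theta> x v v = 0" "d\<theta> x w w = 0" "d\<theta> x w v = 0" using v(4) ext_deriv_swap[of \<theta> x w v] by (auto simp: ext_deriv_self)
  have i1: "independent {v, w}" "v \<noteq> w" using indep2_independent[OF v(3)] by auto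
  have i2: "independent {c, v, w}" "c \<notin> {v, w}" using i1 n by (auto simp: independent_insert span_base)
  have "d\<theta> x v y = 0 \<and> d\<theta> x w y = 0" if "y \<in> span {c, v, w}" for y
    using that
  proof (induction rule: span_induct_alt)
    case base
    then show ?case by (simp add: bilinear_rzero[OF bil])
  next
    case (step a y z)
    then show ?case using c v vv by (auto simp: bilinear_radd[OF bil] bilinear_rmul[OF bil])
  qed
  then have fn: "f \<notin> span {c, v, w}" using f by auto
  then have i3: "independent {f, c, v, w}" "f \<notin> {c, v, w}" using i2 by (auto simp: independent_insert span_base)
  have "d\<theta> x w y = 0" if "y \<in> span {f, c, v, w}" for y
    using that
  proof (induction rule: span_induct_alt)
    case base
    then show ?case by (simp add: bilinear_rzero[OF bil])
  next
    case (step a y z)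
    then show ?case using c v vv f by (auto simp: bilinear_radd[OF bil] bilinear_rmul[OF bil])
  qed
  then have gn: "g \<notin> span {f, c, v, w}" using f by auto
  then have i4: "independent {g, f, c, v, w}" "g \<notin> {f, c, v, w}" using i3 by (auto simp: independent_insert span_base)
  have "card {g, f, c, v, w} \<le> dim (C x)"
    using independent_card_le_dim[OF _ i4(1)] f c v by auto
  moreover have "card {g, f, c, v, w} = 5" using i1 i2 i3 i4 by auto
  ultimately show False using dim_C by simp
qed

text \<open>The definition quantifies over all local contact forms. Any other one equals z \<theta>
  on tangent vectors, so on the contact plane its exterior derivative is z d\<theta> by
  \<open>ext_deriv_ideal\<close>.\<close>

lemma lagrangian_plane_iff:
  "lagrangian_plane M C x L \<longleftrightarrow> subspace L \<and> dim L = 2 \<and> L \<subseteq> C x \<and> (\<forall>v\<in>L. \<forall>w\<in>L. d\<theta> x v w = 0)"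
proof
  assume "lagrangian_plane M C x L"
  then show "subspace L \<and> dim L = 2 \<and> L \<subseteq> C x \<and> (\<forall>v\<in>L. \<forall>w\<in>L. d\<theta> x v w = 0)"
    unfolding lagrangian_plane_def using x contact_form by blast
next
  assume L: "subspace L \<and> dim L = 2 \<and> L \<subseteq> C x \<and> (\<forall>v\<in>L. \<forall>w\<in>L. d\<theta> x v w = 0)"
  have "ext_deriv \<theta>' x v w = 0" if U: "x \<in> U" "local_contact_form M C U \<theta>'" and vw: "v \<in> L" "w \<in> L" for U \<theta>' v w
  proof -
    have s': "smooth_on U \<theta>'" using U(2) by (simp add: local_contact_form_def)
    have o: "open (X \<inter> U)" using smooth_on_open[OF s'] smooth_on_open[OF smooth_rho] by blast
    have vC: "v \<in> C x" "w \<in> C x" using L vw by auto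
    \<comment> \<open>The ratio of the two contact forms, read off on the transverse field; on the
      contact plane both vanish.\<close>
    define z where "z p = blinfun_apply (\<theta>' p) (T p r0) / blinfun_apply (\<theta> p) (T p r0)" for p
    have "ext_deriv \<theta>' x v w = (\<Sum>i\<in>{()}. z x * ext_deriv \<theta> x v w)"
    proof (rule ext_deriv_ideal[OF retraction x _ _ smooth_on_subset[OF s' o]])
      show "v \<in> tangent_space M x" "w \<in> tangent_space M x" using vC C_iff by auto
      show "smooth_on (X \<inter> U) \<theta>" by (rule smooth_on_subset[OF smooth_theta o]) simp
      show "smooth_on (X \<inter> U) z" unfolding z_def
        using r0 by (intro smooth_on_divide smooth_on_blinfun_apply smooth_on_subset[OF s' o]
            smooth_on_subset[OF smooth_theta o] smooth_on_subset[OF smooth_on_derivative[OF smooth_rho] o]) auto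
      show "blinfun_apply (\<theta> x) v = 0" "blinfun_apply (\<theta> x) w = 0" using vC C_iff by auto
      fix p u assume p: "p \<in> M" "p \<in> X \<inter> U" and u: "u \<in> tangent_space M p"
      have pX: "p \<in> X" using p by simp
      have u': "Q p u = u - (blinfun_apply (\<theta> p) u / blinfun_apply (\<theta> p) (T p r0)) *\<^sub>R T p r0"
        using tangent_space_retraction[OF retraction p(1) pX] u by (simp add: Q_def)
      have "Q p u \<in> tangent_space M p"
        unfolding u' using subspace_tangent_space[OF retraction p(1) pX] u
          tangent_space_line[OF smooth_rho, of M p r0] pX rho_M rho_id[OF p(1) pX]
        by (auto intro!: subspace_diff subspace_scale)
      then have "Q p u \<in> C p"
        using contact_form p pX theta_Q[OF pX] unfolding local_contact_form_def by blast
      then have "blinfun_apply (\<theta>' p) (Q p u) = 0" using U(2) p unfolding local_contact_form_def by blast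
      then show "blinfun_apply (\<theta>' p) u = (\<Sum>i\<in>{()}. z p * blinfun_apply (\<theta> p) u)"
        unfolding u' by (simp add: z_def blinfun.diff_right blinfun.scaleR_right)
    qed (use x U in auto)
    then show ?thesis using L vw by simp
  qed
  with L show "lagrangian_plane M C x L" unfolding lagrangian_plane_def by blast
qed

end

end

text \<open>In a slice chart the orthogonal projection onto the linear slice becomes a retraction
  onto \<open>M\<close>; the domain is then shrunk until the transversality and stability conditions
  hold.\<close>

lemma contact_chart_exists:
  fixes M :: "(real^'n::finite) set"
  assumes M: "contact_manifold5 M C" and x0: "x0 \<in> M"
  obtains X \<rho> \<theta> r0 where "contact_chart M C X \<rho> \<theta> r0" "x0 \<in> X"
proof -
  have "submanifold 5 M" using M by (simp add: contact_manifold5_def)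
  then obtain U V \<Phi> \<Psi> and S :: "(real^'n) set" where U: "x0 \<in> U" "smooth_on U \<Phi>" "smooth_on V \<Psi>" "\<Phi> ` U = V" "\<Psi> ` V = U"
    "\<And>y. y \<in> U \<Longrightarrow> \<Psi> (\<Phi> y) = y" "\<And>z. z \<in> V \<Longrightarrow> \<Phi> (\<Psi> z) = z" "subspace S" "dim S = 5" "\<Phi> ` (M \<inter> U) = V \<inter> S"
    using x0 unfolding submanifold_def by metis
  obtain U' \<theta> where U': "x0 \<in> U'" "local_contact_form M C U' \<theta>"
    using M x0 unfolding contact_manifold5_def by blast
  obtain B where B: "B \<subseteq> S" "pairwise orthogonal B" "\<And>x. x \<in> B \<Longrightarrow> norm x = 1" "independent B" "span B = S"
    using orthonormal_basis_subspace[OF U(8)] by metis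
  have finB: "finite B" using B(4) independent_imp_finite by blast
  define \<pi> where "\<pi> u = (\<Sum>b\<in>B. (u \<bullet> b) *\<^sub>R b)" for u
  have pi_S: "\<pi> u \<in> S" for u unfolding \<pi>_def using B U(8) by (auto intro!: subspace_sum subspace_scale)
  have pi_id: "\<pi> u = u" if "u \<in> S" for u
    unfolding \<pi>_def using orthonormal_basis_expand[OF B(2,3) _ finB] B(5) that by simp
  have lin_pi: "linear \<pi>" unfolding \<pi>_def
    by (rule linearI) (simp_all add: inner_add_left algebra_simps sum.distrib scaleR_sum_right)
  then have bl_pi: "bounded_linear \<pi>" by (simp add: linear_conv_bounded_linear)
  have s1: "smooth_on U (\<lambda>x. \<pi> (\<Phi> x))" by (rule smooth_on_linear_compose[OF bl_pi U(2)])
  define X0 where "X0 = {x \<in> U. \<pi> (\<Phi> x) \<in> V}"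
  have X0: "open X0" unfolding X0_def by (rule smooth_on_open_vimage[OF s1 smooth_on_open[OF U(3)]])
  define \<rho> where "\<rho> x = \<Psi> (\<pi> (\<Phi> x))" for x
  have s2: "smooth_on X0 \<rho>" unfolding \<rho>_def
    by (rule smooth_on_compose[OF U(3) smooth_on_subset[OF s1 X0]]) (auto simp: X0_def)
  have rM: "\<rho> x \<in> M \<inter> U" if "x \<in> X0" for x
  proof -
    have "\<pi> (\<Phi> x) \<in> V \<inter> S" using that pi_S by (simp add: X0_def)
    then obtain y where "y \<in> M \<inter> U" "\<pi> (\<Phi> x) = \<Phi> y" unfolding U(10)[symmetric] by blast
    then show ?thesis using U(6) by (simp add: \<rho>_def)
  qed
  have MU: "x \<in> X0 \<and> \<rho> x = x" if "x \<in> M" "x \<in> U" for x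
  proof -
    have "\<Phi> x \<in> V \<inter> S" using U(10) that by blast
    then show ?thesis using that U(6) by (simp add: X0_def \<rho>_def pi_id)
  qed
  have ret0: "smooth_retraction M X0 \<rho>"
    unfolding smooth_retraction_def using s2 rM MU X0_def by blast
  have dimT: "dim (tangent_space M x) \<le> 5" if x: "x \<in> M" "x \<in> X0" for x
  proof -
    have xU: "x \<in> U" "\<pi> (\<Phi> x) \<in> V" using x by (auto simp: X0_def)
    let ?D = "frechet_derivative \<Psi> (at (\<pi> (\<Phi> x)))"
    have "(\<rho> has_derivative (\<lambda>v. ?D (\<pi> (frechet_derivative \<Phi> (at x) v)))) (at x)"
      using diff_chain_at[OF bounded_linear.has_derivative[OF bl_pi smooth_on_has_derivative[OF U(2) xU(1)]]
          smooth_on_has_derivative[OF U(3) xU(2)]] by (simp add: \<rho>_def[abs_def] o_def)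
    note D = frechet_derivative_at[OF this, symmetric]
    \<comment> \<open>Tangent vectors are fixed by the derivative of \<open>\<rho>\<close>, which
      factors through the 5-dimensional slice.\<close>
    have "tangent_space M x \<subseteq> ?D ` S"
    proof
      fix v assume "v \<in> tangent_space M x"
      then have "v = ?D (\<pi> (frechet_derivative \<Phi> (at x) v))"
        using tangent_space_retraction[OF ret0 x, of v] unfolding D by simp
      then show "v \<in> ?D ` S" using pi_S by (rule image_eqI)
    qed
    then have "dim (tangent_space M x) \<le> dim (?D ` S)" by (rule dim_subset)
    also have "\<dots> \<le> dim S" by (rule dim_image_le[OF smooth_on_linear_derivative[OF U(3) xU(2)]])
    finally show ?thesis using U(9) by simp
  qed
  have sth: "smooth_on U' \<theta>" using U'(2) by (simp add: local_contact_form_def)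
  obtain e where "\<And>i::nat. e i \<in> tangent_space M x0" "wedge_1_2_2 (blinfun_apply (\<theta> x0)) (ext_deriv \<theta> x0) e \<noteq> 0"
    using U' x0 unfolding local_contact_form_def by blast
  then obtain r0 where r0: "r0 \<in> tangent_space M x0" "blinfun_apply (\<theta> x0) r0 \<noteq> 0"
    using wedge_nonzero_imp by blast
  have x00: "x0 \<in> X0" "\<rho> x0 = x0" using MU[OF x0 U(1)] by auto
  have o1: "open (X0 \<inter> U')" using X0 smooth_on_open[OF sth] by blast
  have s3: "smooth_on (X0 \<inter> U') (\<lambda>x. blinfun_apply (\<theta> x) (frechet_derivative \<rho> (at x) r0))"
    by (intro smooth_on_blinfun_apply smooth_on_subset[OF sth o1]
        smooth_on_subset[OF smooth_on_derivative[OF s2] o1]) auto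
  define X1 where "X1 = {x \<in> X0 \<inter> U'. blinfun_apply (\<theta> x) (frechet_derivative \<rho> (at x) r0) \<noteq> 0}"
  have X1: "open X1" unfolding X1_def by (rule smooth_on_open_nonzero[OF s3])
  have s4: "smooth_on X1 \<rho>" by (rule smooth_on_subset[OF s2 X1]) (auto simp: X1_def)
  \<comment> \<open>As \<open>\<rho>\<close> fixes its image, also requiring \<open>\<rho> x\<close>
    to be in \<open>X1\<close> gives a set that \<open>\<rho>\<close> maps into itself.\<close>
  define X where "X = {x \<in> X1. \<rho> x \<in> X1}"
  have X: "open X" unfolding X_def by (rule smooth_on_open_vimage[OF s4 X1])
  have sub: "X \<subseteq> X0" "X \<subseteq> U'" "X \<subseteq> X1" by (auto simp: X_def X1_def)
  show ?thesis
  proof (rule that[of X \<rho> \<theta> r0])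
    show "x0 \<in> X"
      using x00 U' r0 tangent_space_retraction[OF ret0 x0 x00(1)] by (simp add: X_def X1_def)
    show "contact_chart M C X \<rho> \<theta> r0"
    proof
      show "smooth_retraction M X \<rho>" by (rule smooth_retraction_subset[OF ret0 X sub(1)])
      show "\<rho> ` X \<subseteq> X"
      proof
        fix y assume "y \<in> \<rho> ` X"
        then obtain x where x: "x \<in> X" "y = \<rho> x" by blast
        have "y \<in> M" "y \<in> U" using rM[of x] sub x by auto
        then have "\<rho> y = y" using MU by blast
        then show "y \<in> X" using x by (simp add: X_def)
      qed
      show "local_contact_form M C X \<theta>"
        using U'(2) sub smooth_on_subset[OF sth X sub(2)] unfolding local_contact_form_def by blast
      show "blinfun_apply (\<theta> x) (frechet_derivative \<rho> (at x) r0) \<noteq> 0" if "x \<in> X" for x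
        using that sub by (auto simp: X1_def)
      show "dim (tangent_space M x) \<le> 5" if "x \<in> M" "x \<in> X" for x using dimT that sub by auto
    qed
  qed
qed

section \<open>A smooth retraction onto the first prolongation\<close>

lemma bounded_bilinear_matrix_vector_mult:
  "bounded_bilinear ((*v) :: real^'n::finite^'m::finite \<Rightarrow> real^'n \<Rightarrow> real^'m)"
proof -
  have "bilinear ((*v) :: real^'n^'m \<Rightarrow> real^'n \<Rightarrow> real^'m)"
    unfolding bilinear_def
    by (intro conjI allI linearI)
       (simp_all add: matrix_vector_mult_add_rdistrib matrix_vector_right_distrib vec.scale
         scaleR_matrix_vector_assoc matrix_vector_mult_scaleR)
  then show ?thesis by (simp add: bilinear_conv_bounded_bilinear)
qed

lemmas smooth_on_matrix_vector_mult = smooth_on_bilinear[OF bounded_bilinear_matrix_vector_mult]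

lemma transpose_eq_iff_selfadjoint:
  fixes P :: "real^'n::finite^'n"
  shows "transpose P = P \<longleftrightarrow> (\<forall>u w. (P *v u) \<bullet> w = u \<bullet> (P *v w))"
proof
  assume "transpose P = P"
  then show "\<forall>u w. (P *v u) \<bullet> w = u \<bullet> (P *v w)" by (metis dot_lmul_matrix transpose_matrix_vector)
next
  assume a: "\<forall>u w. (P *v u) \<bullet> w = u \<bullet> (P *v w)"
  have "transpose P *v u = P *v u" for u
  proof (rule vector_eq_ldot[THEN iffD1], rule allI)
    fix w show "w \<bullet> (transpose P *v u) = w \<bullet> (P *v u)"
      using a by (metis dot_lmul_matrix inner_commute transpose_matrix_vector)
  qed
  then show "transpose P = P" by (simp add: matrix_eq)
qed

lemma idempotent_iff:
  fixes P :: "real^'n::finite^'n"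
  shows "P ** P = P \<longleftrightarrow> (\<forall>u. P *v (P *v u) = P *v u)"
  by (simp add: matrix_eq matrix_vector_mul_assoc)

lemma smooth_on_matrix:
  fixes L :: "'a::real_normed_vector \<Rightarrow> real^'n::finite \<Rightarrow> real^'m::finite"
  assumes S: "open S" and L: "\<And>b. smooth_on S (\<lambda>p. L p b)"
  shows "smooth_on S (\<lambda>p. matrix (L p))"
proof -
  have "smooth_on S (\<lambda>p. \<Sum>i\<in>UNIV. \<Sum>j\<in>UNIV. (L p (axis j 1) \<bullet> axis i 1) *\<^sub>R axis i (axis j (1::real)))"
    by (intro smooth_on_sum S smooth_on_scaleR smooth_on_inner L smooth_on_const)
  moreover have "(\<Sum>i\<in>UNIV. \<Sum>j\<in>UNIV. (L p (axis j 1) \<bullet> axis i 1) *\<^sub>R axis i (axis j (1::real))) = matrix (L p)" for p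
  proof -
    have e: "L p b \<bullet> axis i 1 = L p b $ i" for b i by (simp add: inner_axis)
    have "(\<Sum>i\<in>UNIV. \<Sum>j\<in>UNIV. (L p (axis j 1) \<bullet> axis i 1) *\<^sub>R axis i (axis j (1::real))) $ k $ l = matrix (L p) $ k $ l" for k l
    proof -
      have "(\<Sum>i\<in>UNIV. \<Sum>j\<in>UNIV. (L p (axis j 1) \<bullet> axis i 1) *\<^sub>R axis i (axis j (1::real))) $ k $ l =
        (\<Sum>i\<in>UNIV. \<Sum>j\<in>UNIV. if i = k then (if j = l then L p (axis j 1) $ i else 0) else 0)"
        unfolding e by (auto intro!: sum.cong simp: axis_def sum_component)
      also have "\<dots> = (\<Sum>i\<in>UNIV. if i = k then L p (axis l 1) $ i else 0)"
        by (intro sum.cong refl) auto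
      finally show ?thesis by (simp add: matrix_def)
    qed
    then show ?thesis by (simp add: vec_eq_iff)
  qed
  ultimately show ?thesis by (simp add: smooth_on_def)
qed

lemma smooth_on_plane_proj:
  assumes "smooth_on S v" "smooth_on S w" "smooth_on S u" "\<And>p. p \<in> S \<Longrightarrow> gram (v p) (w p) \<noteq> 0"
  shows "smooth_on S (\<lambda>p. plane_proj (v p) (w p) (u p))"
proof -
  have "smooth_on S (\<lambda>p. gram (v p) (w p))"
    unfolding gram_def by (intro smooth_on_diff smooth_on_mult smooth_on_inner assms)
  then show ?thesis unfolding plane_proj_def
    by (intro smooth_on_add smooth_on_scaleR smooth_on_divide smooth_on_diff smooth_on_mult smooth_on_inner assms)
qed

definition plane_matrix :: "real^'n::finite \<Rightarrow> real^'n \<Rightarrow> real^'n^'n" where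
  "plane_matrix v w = matrix (plane_proj v w)"

lemma plane_matrix_mult: "plane_matrix v w *v u = plane_proj v w u"
  unfolding plane_matrix_def by (simp add: matrix_works linear_plane_proj linear_matrix_vector_mul_eq)

lemma plane_matrix_projector:
  assumes "indep2 v w"
  shows "transpose (plane_matrix v w) = plane_matrix v w" "plane_matrix v w ** plane_matrix v w = plane_matrix v w"
    "range ((*v) (plane_matrix v w)) = span {v, w}"
  using plane_proj_id[OF assms plane_proj_span] range_plane_proj[OF assms]
  by (auto simp: transpose_eq_iff_selfadjoint idempotent_iff plane_matrix_mult plane_proj_selfadjoint)

lemma smooth_on_plane_matrix:
  assumes "smooth_on S v" "smooth_on S w" "\<And>p. p \<in> S \<Longrightarrow> gram (v p) (w p) \<noteq> 0"
  shows "smooth_on S (\<lambda>p. plane_matrix (v p) (w p))"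
  unfolding plane_matrix_def using assms smooth_on_open
  by (intro smooth_on_matrix smooth_on_plane_proj smooth_on_const) auto

lemma plane_matrix_unique:
  assumes "indep2 v w" "transpose P = P" "P ** P = P" "range ((*v) P) = span {v, w}"
  shows "P = plane_matrix v w"
proof -
  have "P *v u = plane_proj v w u" for u
    using assms by (intro plane_proj_unique) (auto simp: transpose_eq_iff_selfadjoint idempotent_iff)
  then show ?thesis by (simp add: matrix_eq plane_matrix_mult)
qed

context contact_chart
begin

lemma prolong1_iff:
  assumes "fst m \<in> X"
  shows "m \<in> prolong1 M C \<longleftrightarrow> fst m \<in> M \<and> transpose (snd m) = snd m \<and> snd m ** snd m = snd m \<and>
    dim (plane1 m) = 2 \<and> plane1 m \<subseteq> C (fst m) \<and> (\<forall>v\<in>plane1 m. \<forall>w\<in>plane1 m. d\<theta> (fst m) v w = 0)"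
proof -
  have "subspace (plane1 m)"
    unfolding plane1_def by (metis matrix_vector_mul_linear linear_subspace_image subspace_UNIV)
  then show ?thesis
    using lagrangian_plane_iff[OF _ assms] by (cases m) (auto simp: prolong1_def)
qed

lemma plane_matrix_prolong1:
  assumes "x \<in> M" "x \<in> X" "v \<in> C x" "w \<in> C x" "indep2 v w" "d\<theta> x v w = 0"
  shows "(x, plane_matrix v w) \<in> prolong1 M C"
proof -
  note bil = bilinear_dtheta[OF assms(2)]
  have p: "plane1 (x, plane_matrix v w) = span {v, w}"
    using plane_matrix_projector(3)[OF assms(5)] by (simp add: plane1_def)
  have "span {v, w} \<subseteq> C x" using assms subspace_C[OF assms(1,2)] by (intro span_minimal) auto
  moreover have "d\<theta> x a b = 0" if "a \<in> span {v, w}" "b \<in> span {v, w}" for a b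
    using that assms(6) ext_deriv_swap[of \<theta> x w v] unfolding span2_iff
    by (auto simp: bilinear_ladd[OF bil] bilinear_radd[OF bil] bilinear_lmul[OF bil] bilinear_rmul[OF bil] ext_deriv_self)
  ultimately show ?thesis
    using assms by (simp add: prolong1_iff p plane_matrix_projector dim_span2[unfolded dim_span])
qed

lemma smooth_on_Q:
  assumes "smooth_on S y" "y ` S \<subseteq> X" "smooth_on S u"
  shows "smooth_on S (\<lambda>p. Q (y p) (u p))"
  unfolding Q_def using assms r0 smooth_on_open
  by (intro smooth_on_diff smooth_on_scaleR smooth_on_divide smooth_on_blinfun_apply smooth_on_const
      smooth_on_derivative_apply[OF smooth_rho assms(1,2)] smooth_on_compose[OF smooth_theta assms(1,2)]) auto

end

text \<open>The fixed vectors \<open>a1\<close>, \<open>a2\<close> trivialise the tautological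
  planes: projecting them by \<open>snd m\<close> gives a smooth frame of \<open>plane1 m\<close>.
  The retraction covers \<open>\<rho>\<close>, so the bundle projection can be followed through its
  derivative.\<close>

locale prolong_chart = contact_chart M C X \<rho> \<theta> r0
  for M :: "(real^'n::finite) set" and C :: "real^'n \<Rightarrow> (real^'n) set"
    and X :: "(real^'n) set" and \<rho> :: "real^'n \<Rightarrow> real^'n"
    and \<theta> :: "real^'n \<Rightarrow> ((real^'n) \<Rightarrow>\<^sub>L real)" and r0 :: "real^'n" +
  fixes W :: "'n space1 set" and R :: "'n space1 \<Rightarrow> 'n space1" and a1 a2 :: "real^'n"
  assumes retraction1: "smooth_retraction (prolong1 M C) W R"
    and fst_W: "m \<in> W \<Longrightarrow> fst m \<in> X" and fst_R: "m \<in> W \<Longrightarrow> fst (R m) = \<rho> (fst m)"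
    and a_indep: "m \<in> prolong1 M C \<Longrightarrow> m \<in> W \<Longrightarrow> indep2 (snd m *v a1) (snd m *v a2)"

text \<open>A pair \<open>(x, P)\<close> is retracted by projecting \<open>P a\<^sub>1, P a\<^sub>2\<close> to the contact plane and then making
  the second vector orthogonal to the first with respect to \<open>d\<theta>\<close>.\<close>

lemma (in contact_chart) prolong_chart_exists:
  assumes m0: "m0 \<in> prolong1 M C" "fst m0 \<in> X"
    and a: "a1 \<in> plane1 m0" "a2 \<in> plane1 m0" "indep2 a1 a2"
  obtains W R where "prolong_chart M C X \<rho> \<theta> r0 W R a1 a2" "m0 \<in> W"
proof -
  define x0 where "x0 = fst m0"
  note m0' = m0(1)[unfolded prolong1_iff[OF m0(2)], folded x0_def]
  have x0: "x0 \<in> M" "x0 \<in> X" using m0' m0 by (auto simp: x0_def)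
  have P0a: "snd m0 *v a1 = a1" "snd m0 *v a2 = a2"
    using a m0' by (auto simp: plane1_def idempotent_iff)
  have aC: "a1 \<in> C x0" "a2 \<in> C x0" using a m0' by auto
  \<comment> \<open>A partner of \<open>a1\<close> under d\<theta>: extended to a field
    \<open>z\<close>, it still pairs nontrivially with the first frame vector near
    \<open>m0\<close>, and the second one can be corrected along it.\<close>
  obtain z0 where z0: "z0 \<in> C x0" "d\<theta> x0 a1 z0 = 1" "d\<theta> x0 a2 z0 = 0"
    by (rule dual_vector[OF x0 aC a(3)])
  define y where "y m = \<rho> (fst m)" for m :: "'n space1"
  define w1 where "w1 m = Q (y m) (snd m *v a1)" for m
  define w2 where "w2 m = Q (y m) (snd m *v a2)" for m
  define z where "z m = Q (y m) z0" for m
  define W0 where "W0 = {m::'n space1. fst m \<in> X}"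
  have "smooth_on UNIV (fst :: 'n space1 \<Rightarrow> _)"
    by (rule smooth_on_bounded_linear) (auto intro: bounded_linear_fst)
  then have W0: "open W0" using smooth_on_open_vimage[OF _ smooth_on_open[OF smooth_rho]] by (force simp: W0_def)
  have sfst: "smooth_on W0 (fst :: 'n space1 \<Rightarrow> _)" and ssnd: "smooth_on W0 (snd :: 'n space1 \<Rightarrow> _)"
    using W0 by (auto intro!: smooth_on_bounded_linear bounded_linear_fst bounded_linear_snd)
  have sy: "smooth_on W0 y" unfolding y_def by (rule smooth_on_compose[OF smooth_rho sfst]) (auto simp: W0_def)
  have yX: "y ` W0 \<subseteq> X" using rho_X by (auto simp: y_def W0_def)
  have yM: "y m \<in> M" if "m \<in> W0" for m using rho_M that by (auto simp: y_def W0_def)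
  have sw: "smooth_on W0 w1" "smooth_on W0 w2" "smooth_on W0 z"
    unfolding w1_def w2_def z_def
    by (intro smooth_on_Q sy yX smooth_on_matrix_vector_mult ssnd smooth_on_const W0)+
  define d where "d m = d\<theta> (y m) (w1 m) (z m)" for m
  have sd: "smooth_on W0 d" unfolding d_def by (intro smooth_on_ext_deriv[OF smooth_theta sy yX] sw)
  define W1 where "W1 = {m \<in> W0. d m \<noteq> 0}"
  have W1: "open W1" "W1 \<subseteq> W0" using smooth_on_open_nonzero[OF sd] by (auto simp: W1_def)
  \<comment> \<open>On \<open>prolong1\<close> the numerator is 0 by isotropy, so the correction is
    invisible there; elsewhere it makes the pair isotropic.\<close>
  define u2 where "u2 m = w2 m - (d\<theta> (y m) (w1 m) (w2 m) / d m) *\<^sub>R z m" for m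
  have su2: "smooth_on W1 u2" unfolding u2_def
    by (intro smooth_on_diff smooth_on_scaleR smooth_on_divide smooth_on_subset[OF sd W1]
        smooth_on_subset[OF smooth_on_ext_deriv[OF smooth_theta sy yX sw(1,2)] W1]
        smooth_on_subset[OF sw(2) W1] smooth_on_subset[OF sw(3) W1]) (auto simp: W1_def)
  have sw1: "smooth_on W1 w1" by (rule smooth_on_subset[OF sw(1) W1])
  define W where "W = {m \<in> W1. gram (w1 m) (u2 m) \<noteq> 0}"
  have "smooth_on W1 (\<lambda>m. gram (w1 m) (u2 m))"
    unfolding gram_def by (intro smooth_on_diff smooth_on_mult smooth_on_inner su2 sw1)
  from smooth_on_open_nonzero[OF this] have W: "open W" "W \<subseteq> W1" "W \<subseteq> W0"
    using W1 by (auto simp: W_def)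
  define R where "R m = (y m, plane_matrix (w1 m) (u2 m))" for m
  have on: "y m = fst m" "w1 m = snd m *v a1" "w2 m = snd m *v a2" "u2 m = snd m *v a2"
    if m: "m \<in> prolong1 M C" "m \<in> W0" for m
  proof -
    have mX: "fst m \<in> X" using m by (simp add: W0_def)
    note m' = m(1)[unfolded prolong1_iff[OF mX]]
    show y: "y m = fst m" using rho_id m' mX by (simp add: y_def)
    have p: "snd m *v a1 \<in> plane1 m" "snd m *v a2 \<in> plane1 m" by (auto simp: plane1_def)
    show w: "w1 m = snd m *v a1" "w2 m = snd m *v a2"
      unfolding w1_def w2_def y using Q_id[OF _ mX] p m' by auto
    show "u2 m = snd m *v a2" unfolding u2_def w y using p m' by simp
  qed
  have m0W0: "m0 \<in> W0" using m0 by (simp add: W0_def)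
  have "d m0 \<noteq> 0"
    using on[OF m0(1) m0W0] z0 P0a Q_id[OF x0 z0(1)] by (simp add: d_def z_def x0_def)
  then have "m0 \<in> W"
    using m0W0 on[OF m0(1) m0W0] P0a a(3) by (simp add: W_def W1_def gram_nonzero_iff)
  moreover have "prolong_chart M C X \<rho> \<theta> r0 W R a1 a2"
  proof
    show "fst m \<in> X" if "m \<in> W" for m using that W by (auto simp: W0_def)
    show "fst (R m) = \<rho> (fst m)" if "m \<in> W" for m by (simp add: R_def y_def)
    show ind: "indep2 (snd m *v a1) (snd m *v a2)" if "m \<in> prolong1 M C" "m \<in> W" for m
      using that on[OF that(1)] W by (auto simp: W_def gram_nonzero_iff)
    show "smooth_retraction (prolong1 M C) W R"
      unfolding smooth_retraction_def
    proof (intro conjI ballI subsetI)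
      show "smooth_on W R" unfolding R_def
        by (intro smooth_on_Pair smooth_on_subset[OF sy W(1,3)] smooth_on_plane_matrix
            smooth_on_subset[OF sw(1) W(1,3)] smooth_on_subset[OF su2 W(1,2)]) (simp add: W_def)
    next
      fix r assume "r \<in> R ` W"
      then obtain m where m: "m \<in> W" "r = R m" by blast
      have yy: "y m \<in> M" "y m \<in> X" using m(1) W(3) yX yM[of m] by blast+
      note bil = bilinear_dtheta[OF yy(2)]
      have C: "w1 m \<in> C (y m)" "w2 m \<in> C (y m)" "z m \<in> C (y m)"
        unfolding w1_def w2_def z_def using Q_mem[OF yy] by auto
      then have "u2 m \<in> C (y m)" unfolding u2_def using subspace_C[OF yy]
        by (intro subspace_diff subspace_scale)
      moreover have "d m \<noteq> 0" using m W by (auto simp: W1_def)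
      then have "d\<theta> (y m) (w1 m) (u2 m) = 0"
        unfolding u2_def by (simp add: bilinear_rsub[OF bil] bilinear_rmul[OF bil] d_def)
      ultimately show "r \<in> prolong1 M C"
        unfolding m R_def using C m by (intro plane_matrix_prolong1 yy) (auto simp: W_def gram_nonzero_iff)
    next
      fix m assume m: "m \<in> prolong1 M C \<inter> W"
      then have mW: "m \<in> W0" and mX: "fst m \<in> X" using W by (auto simp: W0_def)
      have mp: "m \<in> prolong1 M C" using m by simp
      note m' = mp[unfolded prolong1_iff[OF mX]]
      have i: "indep2 (snd m *v a1) (snd m *v a2)" using ind m by blast
      have "plane1 m = span {snd m *v a1, snd m *v a2}"
        by (rule span2_eqI[OF _ _ i])
           (use m' in \<open>auto simp: plane1_def intro!: linear_subspace_image matrix_vector_mul_linear subspace_UNIV\<close>)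
      then have "snd m = plane_matrix (snd m *v a1) (snd m *v a2)"
        using m' by (intro plane_matrix_unique i) (auto simp: plane1_def)
      then show "R m = m" using on[OF mp mW] by (simp add: R_def prod_eq_iff)
    qed
  qed
  ultimately show ?thesis using that by blast
qed

section \<open>The Cartan distribution of the first prolongation\<close>

text \<open>This linearises the equations of \<open>prolong1\<close>. The line itself may leave
  \<open>A\<close>, but a smooth function vanishing on \<open>A\<close> has zero derivative in
  tangent directions, and along a line the derivative is easy to compute.\<close>

lemma tangent_space_zero_line:
  fixes h :: "'a::euclidean_space \<Rightarrow> 'b::real_normed_vector"
  assumes h: "smooth_on U h" "x \<in> U" "\<And>y. y \<in> A \<inter> U \<Longrightarrow> h y = 0"
    and v: "v \<in> tangent_space A x" and d: "((\<lambda>t. h (x + t *\<^sub>R v)) has_vector_derivative d) (at 0)"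
  shows "d = 0"
proof -
  have "((\<lambda>t. h (x + t *\<^sub>R v)) has_vector_derivative frechet_derivative h (at x) v) (at 0)"
    by (rule has_derivative_line) (use smooth_on_has_derivative[OF h(1,2)] in simp)
  then show ?thesis
    using derivative_zero_on_tangent_space[OF h v] d vector_derivative_unique_at by metis
qed

text \<open>The curvature of the Cartan distribution is the restriction of this form.\<close>

definition curvature :: "('n::finite) space1 \<Rightarrow> 'n space1 \<Rightarrow> real^'n" where
  "curvature \<nu> \<mu> = snd \<nu> *v fst \<mu> - snd \<mu> *v fst \<nu>"

lemma bilinear_curvature: "bilinear curvature"
  unfolding bilinear_def curvature_def
  by (intro conjI allI linearI)
     (simp_all add: matrix_vector_mult_add_rdistrib matrix_vector_right_distrib
       scaleR_matrix_vector_assoc matrix_vector_mult_scaleR algebra_simps)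

lemma curvature_self: "curvature \<nu> \<nu> = 0"
  by (simp add: curvature_def)

text \<open>The symmetric tensor F w + w F as a matrix. For \<open>w\<close> in a plane and
  \<open>F\<close> orthogonal to it, this is the velocity of the orthogonal projector when the plane
  is tilted by u |-> (w \<bullet> u) F.\<close>

definition sym_prod :: "real^'n::finite \<Rightarrow> real^'n \<Rightarrow> real^'n^'n" where
  "sym_prod F w = matrix (\<lambda>u. (w \<bullet> u) *\<^sub>R F + (F \<bullet> u) *\<^sub>R w)"

lemma sym_prod_mult: "sym_prod F w *v u = (w \<bullet> u) *\<^sub>R F + (F \<bullet> u) *\<^sub>R w"
proof -
  have "linear (\<lambda>u. (w \<bullet> u) *\<^sub>R F + (F \<bullet> u) *\<^sub>R w)"
    by (rule linearI) (simp_all add: inner_add_right algebra_simps)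
  then show ?thesis unfolding sym_prod_def by (simp add: matrix_works linear_matrix_vector_mul_eq)
qed

lemma smooth_on_sym_prod:
  assumes "smooth_on S F" "smooth_on S w"
  shows "smooth_on S (\<lambda>p. sym_prod (F p) (w p))"
  unfolding sym_prod_def using assms smooth_on_open
  by (intro smooth_on_matrix smooth_on_add smooth_on_scaleR smooth_on_inner smooth_on_const) auto

text \<open>The condition \<open>B P + P B = B\<close> is the derivative of \<open>P P = P\<close>.\<close>

lemma projector_tangent_unique:
  fixes P B B' :: "real^'n::finite^'n"
  assumes P: "\<And>u w. (P *v u) \<bullet> w = u \<bullet> (P *v w)"
    and B: "\<And>u w. (B *v u) \<bullet> w = u \<bullet> (B *v w)" "\<And>u. B *v (P *v u) + P *v (B *v u) = B *v u"
    and B': "\<And>u w. (B' *v u) \<bullet> w = u \<bullet> (B' *v w)" "\<And>u. B' *v (P *v u) + P *v (B' *v u) = B' *v u"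
    and eq: "\<And>u. B *v (P *v u) = B' *v (P *v u)"
  shows "B = B'"
proof -
  have "B *v u = B' *v u" for u
  proof (rule vector_eq_rdot[THEN iffD1], rule allI)
    fix w
    have "(B *v u) \<bullet> w = (B *v (P *v u)) \<bullet> w + u \<bullet> (B *v (P *v w))"
      by (subst B(2)[symmetric]) (simp add: inner_add_left P B(1))
    moreover have "(B' *v u) \<bullet> w = (B' *v (P *v u)) \<bullet> w + u \<bullet> (B' *v (P *v w))"
      by (subst B'(2)[symmetric]) (simp add: inner_add_left P B'(1))
    ultimately show "(B *v u) \<bullet> w = (B' *v u) \<bullet> w" using eq by simp
  qed
  then show ?thesis by (simp add: matrix_eq)
qed

context prolong_chart
begin

abbreviation "PM \<equiv> prolong1 M C"

lemma smooth_R: "smooth_on W R" and R_mem: "m \<in> W \<Longrightarrow> R m \<in> PM" and R_id: "m \<in> PM \<Longrightarrow> m \<in> W \<Longrightarrow> R m = m"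
  using retraction1 by (auto simp: smooth_retraction_def)

lemma open_W: "open W"
  using smooth_R smooth_on_open by blast

lemma smooth_fst_W: "smooth_on W fst" and smooth_snd_W: "smooth_on W snd"
  using open_W by (auto intro!: smooth_on_bounded_linear bounded_linear_fst bounded_linear_snd)

lemma smooth_rho_fst: "smooth_on W (\<lambda>m. \<rho> (fst m))" and rho_fst_X: "(\<lambda>m. \<rho> (fst m)) ` W \<subseteq> X"
  using fst_W rho_X by (auto intro!: smooth_on_compose[OF smooth_rho smooth_fst_W])

lemma fst_derivative_R:
  assumes "m \<in> W"
  shows "fst (frechet_derivative R (at m) \<nu>) = T (fst m) (fst \<nu>)"
proof -
  have "((\<lambda>p. fst (R p)) has_derivative (\<lambda>v. fst (frechet_derivative R (at m) v))) (at m)"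
    by (rule has_derivative_fst[OF smooth_on_has_derivative[OF smooth_R assms]])
  then have 1: "((\<lambda>p. \<rho> (fst p)) has_derivative (\<lambda>v. fst (frechet_derivative R (at m) v))) (at m)"
    by (rule has_derivative_transform_within_open[OF _ open_W assms]) (simp add: fst_R)
  have "(\<rho> has_derivative T (fst m)) (at (fst m))"
    using smooth_on_has_derivative[OF smooth_rho fst_W[OF assms]] .
  from diff_chain_at[OF bounded_linear_imp_has_derivative[OF bounded_linear_fst] this]
  have 2: "((\<lambda>p. \<rho> (fst p)) has_derivative (\<lambda>v. T (fst m) (fst v))) (at m)"
    by (simp add: o_def)
  show ?thesis using has_derivative_unique[OF 1 2] by metis
qed

end

locale prolong_at = prolong_chart M C X \<rho> \<theta> r0 W R a1 a2
  for M :: "(real^'n::finite) set" and C :: "real^'n \<Rightarrow> (real^'n) set"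
    and X :: "(real^'n) set" and \<rho> :: "real^'n \<Rightarrow> real^'n"
    and \<theta> :: "real^'n \<Rightarrow> ((real^'n) \<Rightarrow>\<^sub>L real)" and r0 :: "real^'n"
    and W :: "'n space1 set" and R :: "'n space1 \<Rightarrow> 'n space1" and a1 a2 :: "real^'n" +
  fixes m :: "'n space1"
  assumes m: "m \<in> prolong1 M C" "m \<in> W"
begin

abbreviation "x \<equiv> fst m"
abbreviation "P \<equiv> snd m"
abbreviation "T1 \<equiv> tangent_space PM m"
abbreviation "C1 \<equiv> cartan1 M C m"
abbreviation "v1 \<equiv> P *v a1"
abbreviation "v2 \<equiv> P *v a2"

lemma x_X: "x \<in> X" and x_M: "x \<in> M"
  using fst_W[OF m(2)] m(1) prolong1_iff[of m] by auto

lemmas m_iff = m(1)[unfolded prolong1_iff[OF x_X]]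

lemma P_selfadjoint: "(P *v u) \<bullet> w = u \<bullet> (P *v w)" and P_idem: "P *v (P *v u) = P *v u"
  using m_iff by (auto simp: transpose_eq_iff_selfadjoint idempotent_iff)

lemma P_mem: "P *v u \<in> plane1 m" and P_C: "P *v u \<in> C x" and P_isotropic: "d\<theta> x (P *v u) (P *v w) = 0"
  using m_iff by (auto simp: plane1_def)

lemma plane1_iff: "u \<in> plane1 m \<longleftrightarrow> P *v u = u"
  using P_idem P_mem[of u] by (metis plane1_def rangeE)

lemma subspace_plane1: "subspace (plane1 m)"
  unfolding plane1_def by (metis matrix_vector_mul_linear linear_subspace_image subspace_UNIV)

lemma indep_v: "indep2 v1 v2"
  using a_indep m by blast

lemma plane1_span: "plane1 m = span {v1, v2}"
  by (rule span2_eqI[OF subspace_plane1 _ indep_v P_mem P_mem]) (use m_iff in simp)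

lemma subspace_T1: "subspace T1"
  by (rule subspace_tangent_space[OF retraction1 m])

lemma T1_iff: "\<nu> \<in> T1 \<longleftrightarrow> frechet_derivative R (at m) \<nu> = \<nu>"
  by (rule tangent_space_retraction[OF retraction1 m])

lemma derivative_R_T1: "frechet_derivative R (at m) \<nu> \<in> T1"
  using tangent_space_line[OF smooth_R _ m(2), of PM \<nu>] R_mem R_id[OF m] by (simp add: image_subset_iff)

lemma fst_T1: "\<nu> \<in> T1 \<Longrightarrow> fst \<nu> \<in> tangent_space M x"
  using fst_derivative_R[OF m(2), of \<nu>] T1_iff T_iff[OF x_M x_X] by auto

lemma C1_iff: "\<nu> \<in> C1 \<longleftrightarrow> \<nu> \<in> T1 \<and> P *v fst \<nu> = fst \<nu>"
  by (simp add: cartan1_def plane1_iff)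

lemma subspace_C1: "subspace C1"
  using subspace_T1 by (auto simp: subspace_def C1_iff matrix_vector_right_distrib matrix_vector_mult_scaleR)

section \<open>Linearised equations of the first prolongation\<close>

lemma T1_selfadjoint:
  assumes "\<nu> \<in> T1"
  shows "(snd \<nu> *v u) \<bullet> w = u \<bullet> (snd \<nu> *v w)"
proof -
  have "(snd \<nu> *v u) \<bullet> w - u \<bullet> (snd \<nu> *v w) = 0"
  proof (rule tangent_space_zero_line[where U = W and A = PM and x = m and
        h = "\<lambda>p. (snd p *v u) \<bullet> w - u \<bullet> (snd p *v w)"])
    show "smooth_on W (\<lambda>p. (snd p *v u) \<bullet> w - u \<bullet> (snd p *v w))"
      by (intro smooth_on_diff smooth_on_inner smooth_on_matrix_vector_mult smooth_snd_W smooth_on_const open_W)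
    show "(snd p *v u) \<bullet> w - u \<bullet> (snd p *v w) = 0" if "p \<in> PM \<inter> W" for p
      using that prolong1_iff[OF fst_W, of p] by (simp add: transpose_eq_iff_selfadjoint)
    show "((\<lambda>t. (snd (m + t *\<^sub>R \<nu>) *v u) \<bullet> w - u \<bullet> (snd (m + t *\<^sub>R \<nu>) *v w))
        has_vector_derivative (snd \<nu> *v u) \<bullet> w - u \<bullet> (snd \<nu> *v w)) (at 0)"
    proof -
      have "(\<lambda>t. (snd (m + t *\<^sub>R \<nu>) *v u) \<bullet> w - u \<bullet> (snd (m + t *\<^sub>R \<nu>) *v w)) =
        (\<lambda>t. ((P *v u) \<bullet> w - u \<bullet> (P *v w)) + t *\<^sub>R ((snd \<nu> *v u) \<bullet> w - u \<bullet> (snd \<nu> *v w)))"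
        by (auto simp: matrix_vector_mult_add_rdistrib inner_add_left inner_add_right
            scaleR_matrix_vector_assoc[symmetric] algebra_simps)
      moreover have "((\<lambda>t. ((P *v u) \<bullet> w - u \<bullet> (P *v w)) + t *\<^sub>R ((snd \<nu> *v u) \<bullet> w - u \<bullet> (snd \<nu> *v w)))
        has_vector_derivative (snd \<nu> *v u) \<bullet> w - u \<bullet> (snd \<nu> *v w)) (at 0)"
        by (auto intro!: derivative_eq_intros)
      ultimately show ?thesis by simp
    qed
  qed (use m assms in auto)
  then show ?thesis by simp
qed

lemma line_vector_mult:
  "((\<lambda>t. snd (m + t *\<^sub>R \<nu>) *v u) has_vector_derivative snd \<nu> *v u) (at 0)"
proof -
  have "(\<lambda>t. snd (m + t *\<^sub>R \<nu>) *v u) = (\<lambda>t. P *v u + t *\<^sub>R (snd \<nu> *v u))"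
    by (auto simp: matrix_vector_mult_add_rdistrib scaleR_matrix_vector_assoc[symmetric])
  moreover have "((\<lambda>t. P *v u + t *\<^sub>R (snd \<nu> *v u)) has_vector_derivative snd \<nu> *v u) (at 0)"
    by (auto intro!: derivative_eq_intros)
  ultimately show ?thesis by simp
qed

lemma T1_projector:
  assumes "\<nu> \<in> T1"
  shows "snd \<nu> *v (P *v u) + P *v (snd \<nu> *v u) = snd \<nu> *v u"
proof -
  have "P *v (snd \<nu> *v u) + snd \<nu> *v (P *v u) - snd \<nu> *v u = 0"
  proof (rule tangent_space_zero_line[where U = W and A = PM and x = m and
        h = "\<lambda>p. snd p *v (snd p *v u) - snd p *v u"])
    show "smooth_on W (\<lambda>p. snd p *v (snd p *v u) - snd p *v u)"
      by (intro smooth_on_diff smooth_on_matrix_vector_mult smooth_snd_W smooth_on_const open_W)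
    show "snd p *v (snd p *v u) - snd p *v u = 0" if "p \<in> PM \<inter> W" for p
      using that prolong1_iff[OF fst_W, of p] by (simp add: idempotent_iff)
    have s: "((\<lambda>t. snd (m + t *\<^sub>R \<nu>)) has_vector_derivative snd \<nu>) (at 0)"
      by (auto intro!: derivative_eq_intros)
    show "((\<lambda>t. snd (m + t *\<^sub>R \<nu>) *v (snd (m + t *\<^sub>R \<nu>) *v u) - snd (m + t *\<^sub>R \<nu>) *v u)
        has_vector_derivative P *v (snd \<nu> *v u) + snd \<nu> *v (P *v u) - snd \<nu> *v u) (at 0)"
      using bounded_bilinear.has_vector_derivative[OF bounded_bilinear_matrix_vector_mult s line_vector_mult]
      by (intro has_vector_derivative_diff line_vector_mult) simp
  qed (use m assms in auto)
  then show ?thesis by (simp add: algebra_simps)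
qed

text \<open>Infinitesimally a plane moves only in normal directions: apply the linearised projector
  equation to a vector of the plane.\<close>

lemma T1_off_diagonal:
  assumes "\<nu> \<in> T1"
  shows "P *v (snd \<nu> *v (P *v u)) = 0"
  using T1_projector[OF assms, of "P *v u"] by (simp add: P_idem)

text \<open>Linearises the statement that \<open>Q\<close> fixes the vectors of the plane;
  verticality keeps the base point, hence \<open>Q\<close>, constant along the line.\<close>

lemma vertical_C:
  assumes "\<nu> \<in> T1" "fst \<nu> = 0"
  shows "snd \<nu> *v (P *v u) \<in> C x"
proof -
  note lQ = linear_Q[OF x_X]
  have rx: "\<rho> x = x" by (rule rho_id[OF x_M x_X])
  have Qd: "Q x (snd \<nu> *v u) - snd \<nu> *v u = 0" for u
  proof (rule tangent_space_zero_line[where U = W and A = PM and x = m and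
        h = "\<lambda>p. Q (\<rho> (fst p)) (snd p *v u) - snd p *v u"])
    show "smooth_on W (\<lambda>p. Q (\<rho> (fst p)) (snd p *v u) - snd p *v u)"
      by (intro smooth_on_diff smooth_on_matrix_vector_mult smooth_snd_W smooth_on_const open_W
          smooth_on_Q smooth_rho_fst rho_fst_X)
    show "Q (\<rho> (fst p)) (snd p *v u) - snd p *v u = 0" if "p \<in> PM \<inter> W" for p
    proof -
      have p: "fst p \<in> X" "fst p \<in> M" "snd p *v u \<in> C (fst p)"
        using that fst_W[of p] prolong1_iff[OF fst_W, of p] by (auto simp: plane1_def)
      then show ?thesis by (simp add: rho_id Q_id)
    qed
    have "(\<lambda>t. Q (\<rho> (fst (m + t *\<^sub>R \<nu>))) (snd (m + t *\<^sub>R \<nu>) *v u)) =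
        (\<lambda>t. Q x (P *v u) + t *\<^sub>R Q x (snd \<nu> *v u))"
      by (auto simp: assms(2) rx matrix_vector_mult_add_rdistrib scaleR_matrix_vector_assoc[symmetric]
          linear_add[OF lQ] linear_scale[OF lQ])
    moreover have "((\<lambda>t. Q x (P *v u) + t *\<^sub>R Q x (snd \<nu> *v u)) has_vector_derivative Q x (snd \<nu> *v u)) (at 0)"
      by (auto intro!: derivative_eq_intros)
    ultimately show "((\<lambda>t. Q (\<rho> (fst (m + t *\<^sub>R \<nu>))) (snd (m + t *\<^sub>R \<nu>) *v u) - snd (m + t *\<^sub>R \<nu>) *v u)
        has_vector_derivative Q x (snd \<nu> *v u) - snd \<nu> *v u) (at 0)"
      by (intro has_vector_derivative_diff line_vector_mult) simp
  qed (use m assms in auto)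
  from Qd[of "P *v u"] have "snd \<nu> *v (P *v u) = Q x (snd \<nu> *v (P *v u))" by simp
  then show ?thesis using Q_mem[OF x_M x_X] by metis
qed

text \<open>Linearised isotropy. It is the reason why vertical vectors correspond to symmetric 2 by
  2 matrices and form a 3-dimensional space.\<close>

lemma vertical_symmetric:
  assumes "\<nu> \<in> T1" "fst \<nu> = 0"
  shows "d\<theta> x (P *v u) (snd \<nu> *v w) + d\<theta> x (snd \<nu> *v u) (P *v w) = 0"
proof (rule tangent_space_zero_line[where U = W and A = PM and x = m and
      h = "\<lambda>p. d\<theta> (\<rho> (fst p)) (snd p *v u) (snd p *v w)"])
  have rx: "\<rho> x = x" by (rule rho_id[OF x_M x_X])
  show "smooth_on W (\<lambda>p. d\<theta> (\<rho> (fst p)) (snd p *v u) (snd p *v w))"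
    by (intro smooth_on_ext_deriv[OF smooth_theta smooth_rho_fst rho_fst_X] smooth_on_matrix_vector_mult
        smooth_snd_W smooth_on_const open_W)
  show "d\<theta> (\<rho> (fst p)) (snd p *v u) (snd p *v w) = 0" if "p \<in> PM \<inter> W" for p
  proof -
    have "fst p \<in> X" "fst p \<in> M" "d\<theta> (fst p) (snd p *v u) (snd p *v w) = 0"
      using that fst_W[of p] prolong1_iff[OF fst_W, of p] by (auto simp: plane1_def)
    then show ?thesis by (simp add: rho_id)
  qed
  have "bounded_bilinear (d\<theta> x)"
    using bilinear_dtheta[OF x_X] by (simp add: bilinear_conv_bounded_bilinear)
  from bounded_bilinear.has_vector_derivative[OF this line_vector_mult line_vector_mult, of \<nu> u \<nu> w]
  show "((\<lambda>t. d\<theta> (\<rho> (fst (m + t *\<^sub>R \<nu>))) (snd (m + t *\<^sub>R \<nu>) *v u) (snd (m + t *\<^sub>R \<nu>) *v w))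
     has_vector_derivative d\<theta> x (P *v u) (snd \<nu> *v w) + d\<theta> x (snd \<nu> *v u) (P *v w)) (at 0)"
    by (simp add: assms(2) rx)
qed (use m assms in auto)

lemma isotropic_normal_zero:
  assumes "c \<in> C x" "P *v c = 0" "d\<theta> x v1 c = 0" "d\<theta> x v2 c = 0"
  shows "c = 0"
proof -
  have "c \<in> plane1 m" unfolding plane1_span
    using isotropic_maximal[OF x_M x_X P_C P_C indep_v P_isotropic assms(1,3,4)] .
  then show ?thesis using assms(2) plane1_iff by auto
qed

end

text \<open>\<open>F1\<close>, \<open>F2\<close> are normal to the plane inside the contact plane
  and dual to its frame under d\<theta>; \<open>w1\<close>, \<open>w2\<close> are the Euclidean dual
  basis within the plane. Symmetric products of the two kinds give the vertical directions.\<close>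

locale prolong_point = prolong_at M C X \<rho> \<theta> r0 W R a1 a2 m
  for M :: "(real^'n::finite) set" and C :: "real^'n \<Rightarrow> (real^'n) set"
    and X :: "(real^'n) set" and \<rho> :: "real^'n \<Rightarrow> real^'n"
    and \<theta> :: "real^'n \<Rightarrow> ((real^'n) \<Rightarrow>\<^sub>L real)" and r0 :: "real^'n"
    and W :: "'n space1 set" and R :: "'n space1 \<Rightarrow> 'n space1" and a1 a2 :: "real^'n" and m :: "'n space1" +
  fixes F1 F2 w1 w2 :: "real^'n"
  assumes F_C: "F1 \<in> C (fst m)" "F2 \<in> C (fst m)" and PF: "snd m *v F1 = 0" "snd m *v F2 = 0"
    and F_dual: "d\<theta> (fst m) (snd m *v a1) F1 = 1" "d\<theta> (fst m) (snd m *v a2) F1 = 0"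
      "d\<theta> (fst m) (snd m *v a1) F2 = 0" "d\<theta> (fst m) (snd m *v a2) F2 = 1"
    and Pw: "snd m *v w1 = w1" "snd m *v w2 = w2"
    and w_dual: "w1 \<bullet> (snd m *v a1) = 1" "w1 \<bullet> (snd m *v a2) = 0"
      "w2 \<bullet> (snd m *v a1) = 0" "w2 \<bullet> (snd m *v a2) = 1"
begin

text \<open>Counterparts of the coordinate frame of the Cartan distribution: \<nu>1, \<nu>2 lift the
  frame of the plane, as D_1, D_2 do, and the three \<kappa> below correspond to the derivatives by
  p_11, p_12, p_22.\<close>

abbreviation "\<nu>1 \<equiv> frechet_derivative R (at m) (v1, 0)"
abbreviation "\<nu>2 \<equiv> frechet_derivative R (at m) (v2, 0)"

abbreviation "\<kappa>11 \<equiv> (0 :: real^'n, sym_prod F1 w1)"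
abbreviation "\<kappa>12 \<equiv> (0 :: real^'n, sym_prod F2 w1 + sym_prod F1 w2)"
abbreviation "\<kappa>22 \<equiv> (0 :: real^'n, sym_prod F2 w2)"

lemmas dbil = bilinear_ladd[OF bilinear_dtheta[OF x_X]] bilinear_radd[OF bilinear_dtheta[OF x_X]]
  bilinear_lmul[OF bilinear_dtheta[OF x_X]] bilinear_rmul[OF bilinear_dtheta[OF x_X]]
  bilinear_lsub[OF bilinear_dtheta[OF x_X]] bilinear_rsub[OF bilinear_dtheta[OF x_X]]
  bilinear_rzero[OF bilinear_dtheta[OF x_X]] bilinear_lzero[OF bilinear_dtheta[OF x_X]]

section \<open>Vertical vectors as symmetric matrices and the pointwise frame\<close>

definition "sym_matrix s11 s12 s22 =
  s11 *\<^sub>R sym_prod F1 w1 + s12 *\<^sub>R (sym_prod F2 w1 + sym_prod F1 w2) + s22 *\<^sub>R sym_prod F2 w2"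

lemma F_inner: "F1 \<bullet> (P *v u) = 0" "F2 \<bullet> (P *v u) = 0" "F1 \<bullet> w1 = 0" "F1 \<bullet> w2 = 0" "F2 \<bullet> w1 = 0" "F2 \<bullet> w2 = 0"
  using P_selfadjoint[of F1] P_selfadjoint[of F2] PF Pw inner_zero_left by metis+

lemma w_inner: "w1 \<bullet> (P *v u) = w1 \<bullet> u" "w2 \<bullet> (P *v u) = w2 \<bullet> u"
  using P_selfadjoint[of w1 u] P_selfadjoint[of w2 u] Pw by simp_all

lemma sym_matrix_mult: "sym_matrix s11 s12 s22 *v u =
   (s11 * (w1 \<bullet> u) + s12 * (w2 \<bullet> u)) *\<^sub>R F1 + (s12 * (w1 \<bullet> u) + s22 * (w2 \<bullet> u)) *\<^sub>R F2 +
   (s11 * (F1 \<bullet> u) + s12 * (F2 \<bullet> u)) *\<^sub>R w1 + (s12 * (F1 \<bullet> u) + s22 * (F2 \<bullet> u)) *\<^sub>R w2"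
  unfolding sym_matrix_def
  by (simp add: matrix_vector_mult_add_rdistrib scaleR_matrix_vector_assoc[symmetric] sym_prod_mult algebra_simps)

lemma sym_matrix_selfadjoint: "(sym_matrix s11 s12 s22 *v u) \<bullet> w = u \<bullet> (sym_matrix s11 s12 s22 *v w)"
  unfolding sym_matrix_mult
  unfolding inner_add_left inner_add_right inner_scaleR_left inner_scaleR_right
    inner_commute[of u F1] inner_commute[of u F2] inner_commute[of u w1] inner_commute[of u w2]
  by (simp add: algebra_simps)

lemma sym_matrix_projector:
  "sym_matrix s11 s12 s22 *v (P *v u) + P *v (sym_matrix s11 s12 s22 *v u) = sym_matrix s11 s12 s22 *v u"
  unfolding sym_matrix_mult
  by (simp add: matrix_vector_right_distrib matrix_vector_mult_scaleR PF Pw F_inner w_inner)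

lemma sym_matrix_v: "sym_matrix s11 s12 s22 *v v1 = s11 *\<^sub>R F1 + s12 *\<^sub>R F2"
  "sym_matrix s11 s12 s22 *v v2 = s12 *\<^sub>R F1 + s22 *\<^sub>R F2"
  unfolding sym_matrix_mult by (simp_all add: F_inner w_dual)

lemma P_span: obtains a b where "P *v u = a *\<^sub>R v1 + b *\<^sub>R v2"
  using P_mem[of u] unfolding plane1_span span2_iff by blast

lemma eq_on_range:
  assumes "B *v v1 = B' *v v1" "B *v v2 = B' *v v2"
  shows "B *v (P *v u) = B' *v (P *v (u :: real^'n))"
proof -
  obtain a b where e: "P *v u = a *\<^sub>R v1 + b *\<^sub>R v2" by (rule P_span)
  show ?thesis unfolding e matrix_vector_right_distrib matrix_vector_mult_scaleR assms ..
qed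

text \<open>The remainder of the expansion is normal and d\<theta>-orthogonal to the plane, hence 0
  because the plane is maximal isotropic.\<close>

lemma normal_expansion:
  assumes "c \<in> C x" "P *v c = 0"
  shows "c = d\<theta> x v1 c *\<^sub>R F1 + d\<theta> x v2 c *\<^sub>R F2"
proof -
  let ?c = "c - (d\<theta> x v1 c *\<^sub>R F1 + d\<theta> x v2 c *\<^sub>R F2)"
  have "?c = 0"
  proof (rule isotropic_normal_zero)
    show "?c \<in> C x" using assms F_C subspace_C[OF x_M x_X]
      by (intro subspace_diff subspace_add subspace_scale) auto
    show "P *v ?c = 0" by (simp add: matrix_vector_mult_diff_distrib matrix_vector_right_distrib
          matrix_vector_mult_scaleR assms PF)
  qed (simp_all add: dbil F_dual)
  then show ?thesis by simp
qed

text \<open>The images of the frame are normal contact vectors and expand in \<open>F1\<close>,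
  \<open>F2\<close>; linearised isotropy makes the coefficients symmetric, and a projector velocity
  is determined by its values on the plane.\<close>

lemma vertical_eq_sym_matrix:
  assumes "\<nu> \<in> T1" "fst \<nu> = 0"
  shows "\<exists>s11 s12 s22. \<nu> = (0, sym_matrix s11 s12 s22)"
proof -
  define B where "B = snd \<nu>"
  define s where "s i j = d\<theta> x j (B *v i)" for i j
  have e: "B *v (P *v u) = s (P *v u) v1 *\<^sub>R F1 + s (P *v u) v2 *\<^sub>R F2" for u
    unfolding s_def B_def by (rule normal_expansion[OF vertical_C[OF assms] T1_off_diagonal[OF assms(1)]])
  have sym: "s v2 v1 = s v1 v2"
    using vertical_symmetric[OF assms, of v1 v2] ext_deriv_swap[of \<theta> x "B *v v1" v2]
    by (simp add: s_def B_def P_idem)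
  have "B = sym_matrix (s v1 v1) (s v1 v2) (s v2 v2)"
  proof (rule projector_tangent_unique[OF P_selfadjoint _ _ sym_matrix_selfadjoint sym_matrix_projector])
    show "(B *v u) \<bullet> w = u \<bullet> (B *v w)" for u w unfolding B_def by (rule T1_selfadjoint[OF assms(1)])
    show "B *v (P *v u) + P *v (B *v u) = B *v u" for u unfolding B_def by (rule T1_projector[OF assms(1)])
    show "B *v (P *v u) = sym_matrix (s v1 v1) (s v1 v2) (s v2 v2) *v (P *v u)" for u
      by (rule eq_on_range) (use e[of a1] e[of a2] sym in \<open>simp_all add: sym_matrix_v\<close>)
  qed
  then show ?thesis using assms(2) by (metis B_def prod.collapse)
qed

text \<open>Conversely, the vertical vectors are velocities of the curves of planes spanned by
  \<open>v\<^sub>i + t (s\<^sub>i\<^sub>1 f + s\<^sub>i\<^sub>2 g)\<close>, where \<open>f\<close> and \<open>g\<close> span an isotropic complement.\<close>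

lemma sym_matrix_T1: "(0, sym_matrix s11 s12 s22) \<in> T1"
proof -
  note CM = x_M x_X
  obtain f g where fg: "f \<in> C x" "g \<in> C x" "d\<theta> x v1 f = 1" "d\<theta> x v2 f = 0" "d\<theta> x v1 g = 0" "d\<theta> x v2 g = 1" "d\<theta> x f g = 0"
    by (rule dual_vectors[OF CM P_C P_C indep_v P_isotropic])
  \<comment> \<open>The vectors \<open>f\<close>, \<open>g\<close> have the same pairings with the
    plane as \<open>F1\<close>, \<open>F2\<close>, so their normal parts are these vectors, although
    \<open>F1\<close>, \<open>F2\<close> need not be isotropic.\<close>
  have dec: "f - P *v f = F1" "g - P *v g = F2"
  proof -
    have "f - P *v f \<in> C x" "g - P *v g \<in> C x" using fg P_C subspace_C[OF CM] by (auto intro: subspace_diff)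
    from this[THEN normal_expansion] show "f - P *v f = F1" "g - P *v g = F2"
      using fg P_isotropic by (simp_all add: matrix_vector_mult_diff_distrib P_idem dbil)
  qed
  define g1 where "g1 = s11 *\<^sub>R f + s12 *\<^sub>R g"
  define g2 where "g2 = s12 *\<^sub>R f + s22 *\<^sub>R g"
  define b1 where "b1 = (\<lambda>t::real. v1 + t *\<^sub>R g1)"
  define b2 where "b2 = (\<lambda>t::real. v2 + t *\<^sub>R g2)"
  have sb: "smooth_on UNIV b1" "smooth_on UNIV b2" unfolding b1_def b2_def
    by (intro smooth_on_add smooth_on_scaleR smooth_on_const smooth_on_id open_UNIV)+
  define S where "S = {t\<in>UNIV. gram (b1 t) (b2 t) \<noteq> 0}"
  have "smooth_on UNIV (\<lambda>t. gram (b1 t) (b2 t))" unfolding gram_def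
    by (intro smooth_on_diff smooth_on_mult smooth_on_inner sb)
  then have S: "open S" unfolding S_def by (rule smooth_on_open_nonzero)
  have S0: "0 \<in> S" using indep_v by (simp add: S_def gram_nonzero_iff b1_def b2_def)
  define \<Gamma> where "\<Gamma> t = plane_matrix (b1 t) (b2 t)" for t
  have sG: "smooth_on S \<Gamma>" unfolding \<Gamma>_def
    by (intro smooth_on_plane_matrix smooth_on_subset[OF sb(1) S] smooth_on_subset[OF sb(2) S] subset_UNIV)
       (simp add: S_def)
  have sx: "smooth_on S (\<lambda>t. (x, \<Gamma> t))" by (intro smooth_on_Pair smooth_on_const S sG)
  have GP: "(x, \<Gamma> t) \<in> PM" if "t \<in> S" for t
    unfolding \<Gamma>_def
  proof (rule plane_matrix_prolong1[OF CM])
    show "b1 t \<in> C x" "b2 t \<in> C x" unfolding b1_def b2_def g1_def g2_def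
      using fg P_C subspace_C[OF CM] by (auto intro!: subspace_add subspace_scale)
    show "indep2 (b1 t) (b2 t)" using that by (simp add: S_def gram_nonzero_iff)
    \<comment> \<open>The linear terms in t cancel by symmetry of the coefficients, the quadratic
      ones because \<open>f\<close> and \<open>g\<close> pair to 0.\<close>
    show "d\<theta> x (b1 t) (b2 t) = 0"
      unfolding b1_def b2_def g1_def g2_def
      using fg P_isotropic ext_deriv_swap[of \<theta> x g f] ext_deriv_swap[of \<theta> x f v2] ext_deriv_swap[of \<theta> x g v2]
      by (simp add: dbil ext_deriv_self algebra_simps)
  qed
  have G0: "\<Gamma> 0 = P"
    using m_iff plane1_span plane_matrix_unique[OF indep_v, of P]
    by (simp add: \<Gamma>_def b1_def b2_def plane1_def)
  obtain B where B: "(\<Gamma> has_vector_derivative B) (at 0)"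
    using smooth_on_has_derivative[OF sG S0] vector_derivative_works differentiableI by blast
  obtain e where e: "e > 0" "ball 0 e \<subseteq> S" using S S0 openE by blast
  have "{- e<..<e} = ball 0 e" by (auto simp: dist_real_def)
  then have "curve_at PM m (\<lambda>t. (x, \<Gamma> t))"
    unfolding curve_at_def using e GP G0 smooth_on_subset[OF sx, of "{- e<..<e}"] by (auto intro!: exI[of _ e])
  moreover have "((\<lambda>t. (x, \<Gamma> t)) has_vector_derivative (0, B)) (at 0)"
    using B by (intro has_vector_derivative_Pair has_vector_derivative_const)
  ultimately have B_T1: "(0, B) \<in> T1" unfolding tangent_space_def by blast
  have Bv: "B *v v1 = g1 - P *v g1" "B *v v2 = g2 - P *v g2"
  proof -
    \<comment> \<open>Differentiating the identity that the projector fixes a curve lying in the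
      moving plane.\<close>
    have "B *v c 0 + P *v c' = c'" if c: "(c has_vector_derivative c') (at 0)" "\<And>t. t \<in> S \<Longrightarrow> \<Gamma> t *v c t = c t" for c c'
    proof -
      have "((\<lambda>t. \<Gamma> t *v c t) has_vector_derivative \<Gamma> 0 *v c' + B *v c 0) (at 0)"
        by (rule bounded_bilinear.has_vector_derivative[OF bounded_bilinear_matrix_vector_mult B c(1)])
      then have "(c has_vector_derivative \<Gamma> 0 *v c' + B *v c 0) (at 0)"
        by (rule has_vector_derivative_transform_within_open[OF _ S S0]) (use c(2) in auto)
      with c(1) have "\<Gamma> 0 *v c' + B *v c 0 = c'" using vector_derivative_unique_at by metis
      then show ?thesis by (simp add: G0 add.commute)
    qed
    note D = this
    have d: "(b1 has_vector_derivative g1) (at 0)" "(b2 has_vector_derivative g2) (at 0)"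
      unfolding b1_def b2_def by (auto intro!: derivative_eq_intros)
    have "B *v b1 0 + P *v g1 = g1"
      by (rule D[OF d(1)]) (simp add: \<Gamma>_def plane_matrix_mult plane_proj_basis S_def gram_nonzero_iff)
    moreover have "B *v b2 0 + P *v g2 = g2"
      by (rule D[OF d(2)]) (simp add: \<Gamma>_def plane_matrix_mult plane_proj_basis S_def gram_nonzero_iff)
    ultimately show "B *v v1 = g1 - P *v g1" "B *v v2 = g2 - P *v g2"
      by (simp_all add: b1_def b2_def eq_diff_eq)
  qed
  have "g1 - P *v g1 = s11 *\<^sub>R F1 + s12 *\<^sub>R F2" "g2 - P *v g2 = s12 *\<^sub>R F1 + s22 *\<^sub>R F2"
    unfolding dec[symmetric] g1_def g2_def matrix_vector_right_distrib matrix_vector_mult_scaleR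
    by (simp_all add: scaleR_diff_right)
  with Bv have Bv': "B *v v1 = sym_matrix s11 s12 s22 *v v1" "B *v v2 = sym_matrix s11 s12 s22 *v v2"
    by (simp_all add: sym_matrix_v)
  have "B = sym_matrix s11 s12 s22"
  proof (rule projector_tangent_unique[OF P_selfadjoint _ _ sym_matrix_selfadjoint sym_matrix_projector])
    show "(B *v u) \<bullet> w = u \<bullet> (B *v w)" for u w using T1_selfadjoint[OF B_T1] by simp
    show "B *v (P *v u) + P *v (B *v u) = B *v u" for u using T1_projector[OF B_T1] by simp
  qed (rule eq_on_range[OF Bv'])
  then show ?thesis using B_T1 by simp
qed

lemma kappa_C1: "\<kappa>11 \<in> C1" "\<kappa>12 \<in> C1" "\<kappa>22 \<in> C1"
  using sym_matrix_T1[of 1 0 0] sym_matrix_T1[of 0 1 0] sym_matrix_T1[of 0 0 1]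
  by (simp_all add: C1_iff sym_matrix_def)

lemma fst_nu: "fst \<nu>1 = v1" "fst \<nu>2 = v2"
  using fst_derivative_R[OF m(2)] P_C[of a1] P_C[of a2] C_iff[OF x_M x_X] T_iff[OF x_M x_X] by auto

lemma nu_C1: "\<nu>1 \<in> C1" "\<nu>2 \<in> C1"
  by (simp_all add: C1_iff fst_nu derivative_R_T1 P_idem)

lemma sym_matrix_kappa: "(0, sym_matrix s11 s12 s22) = s11 *\<^sub>R \<kappa>11 + s12 *\<^sub>R \<kappa>12 + s22 *\<^sub>R \<kappa>22"
  by (simp add: sym_matrix_def)

lemma C1_expansion:
  assumes "\<nu> \<in> C1"
  obtains p q s11 s12 s22 where "\<nu> = p *\<^sub>R \<nu>1 + q *\<^sub>R \<nu>2 + (s11 *\<^sub>R \<kappa>11 + s12 *\<^sub>R \<kappa>12 + s22 *\<^sub>R \<kappa>22)"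
proof -
  obtain p q where "P *v fst \<nu> = p *\<^sub>R v1 + q *\<^sub>R v2" by (rule P_span)
  then have pq: "fst \<nu> = p *\<^sub>R v1 + q *\<^sub>R v2" using assms C1_iff by simp
  let ?\<mu> = "\<nu> - (p *\<^sub>R \<nu>1 + q *\<^sub>R \<nu>2)"
  have "?\<mu> \<in> C1" using assms nu_C1 subspace_C1 by (intro subspace_diff subspace_add subspace_scale)
  then have "?\<mu> \<in> T1" "fst ?\<mu> = 0" using C1_iff by (auto simp: pq fst_nu)
  from vertical_eq_sym_matrix[OF this] obtain s11 s12 s22 where "?\<mu> = (0, sym_matrix s11 s12 s22)" by blast
  then have "\<nu> = p *\<^sub>R \<nu>1 + q *\<^sub>R \<nu>2 + (0, sym_matrix s11 s12 s22)" by (simp add: algebra_simps)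
  then show ?thesis using that sym_matrix_kappa by metis
qed

lemma C1_span: "C1 = span {\<nu>1, \<nu>2, \<kappa>11, \<kappa>12, \<kappa>22}"
proof
  show "C1 \<subseteq> span {\<nu>1, \<nu>2, \<kappa>11, \<kappa>12, \<kappa>22}"
  proof
    fix \<nu> assume "\<nu> \<in> C1"
    then obtain p q s11 s12 s22 where e: "\<nu> = p *\<^sub>R \<nu>1 + q *\<^sub>R \<nu>2 + (s11 *\<^sub>R \<kappa>11 + s12 *\<^sub>R \<kappa>12 + s22 *\<^sub>R \<kappa>22)"
      by (rule C1_expansion)
    show "\<nu> \<in> span {\<nu>1, \<nu>2, \<kappa>11, \<kappa>12, \<kappa>22}" unfolding e
      by (intro span_add span_scale; rule span_base; blast)
  qed
  show "span {\<nu>1, \<nu>2, \<kappa>11, \<kappa>12, \<kappa>22} \<subseteq> C1"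
    by (intro span_minimal subspace_C1) (use kappa_C1 nu_C1 in simp)
qed

lemma frame_independent:
  assumes "p *\<^sub>R \<nu>1 + q *\<^sub>R \<nu>2 + (s11 *\<^sub>R \<kappa>11 + s12 *\<^sub>R \<kappa>12 + s22 *\<^sub>R \<kappa>22) = 0"
  shows "p = 0 \<and> q = 0 \<and> s11 = 0 \<and> s12 = 0 \<and> s22 = 0"
proof -
  have "fst (p *\<^sub>R \<nu>1 + q *\<^sub>R \<nu>2 + (s11 *\<^sub>R \<kappa>11 + s12 *\<^sub>R \<kappa>12 + s22 *\<^sub>R \<kappa>22)) = 0" using assms by simp
  then have "p *\<^sub>R v1 + q *\<^sub>R v2 = 0" by (simp add: fst_nu)
  then have pq: "p = 0" "q = 0" using indep2D[OF indep_v] by blast+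
  then have "(0, sym_matrix s11 s12 s22) = (0 :: 'n space1)" using assms sym_matrix_kappa[of s11 s12 s22] by simp
  then have z: "sym_matrix s11 s12 s22 = 0" by (simp add: zero_prod_def)
  have "s11 *\<^sub>R F1 + s12 *\<^sub>R F2 = 0" "s12 *\<^sub>R F1 + s22 *\<^sub>R F2 = 0"
    using sym_matrix_v[of s11 s12 s22] z by simp_all
  then have "d\<theta> x v1 (s11 *\<^sub>R F1 + s12 *\<^sub>R F2) = 0" "d\<theta> x v2 (s11 *\<^sub>R F1 + s12 *\<^sub>R F2) = 0"
    "d\<theta> x v2 (s12 *\<^sub>R F1 + s22 *\<^sub>R F2) = 0" by (simp_all only: dbil)
  then show ?thesis using pq by (simp add: dbil F_dual)
qed

lemma dim_C1: "dim C1 = 5"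
proof -
  have "\<kappa>22 \<noteq> 0"
  proof
    assume "\<kappa>22 = 0"
    then have "0 *\<^sub>R \<nu>1 + 0 *\<^sub>R \<nu>2 + (0 *\<^sub>R \<kappa>11 + 0 *\<^sub>R \<kappa>12 + 1 *\<^sub>R \<kappa>22) = 0"
      by (simp del: scaleR_Pair)
    from frame_independent[OF this] show False by simp
  qed
  then have k: "independent {\<kappa>22}" by simp
  have k1: "\<kappa>12 \<notin> span {\<kappa>22}"
  proof
    assume "\<kappa>12 \<in> span {\<kappa>22}"
    then obtain a where "\<kappa>12 = a *\<^sub>R \<kappa>22" by (auto simp: span_singleton)
    then have "0 *\<^sub>R \<nu>1 + 0 *\<^sub>R \<nu>2 + (0 *\<^sub>R \<kappa>11 + 1 *\<^sub>R \<kappa>12 + (- a) *\<^sub>R \<kappa>22) = 0" by (simp del: scaleR_Pair)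
    from frame_independent[OF this] show False by simp
  qed
  have k2: "\<kappa>11 \<notin> span {\<kappa>12, \<kappa>22}"
  proof
    assume "\<kappa>11 \<in> span {\<kappa>12, \<kappa>22}"
    then obtain a b where "\<kappa>11 = a *\<^sub>R \<kappa>12 + b *\<^sub>R \<kappa>22" unfolding span2_iff by blast
    then have "0 *\<^sub>R \<nu>1 + 0 *\<^sub>R \<nu>2 + (1 *\<^sub>R \<kappa>11 + (- a) *\<^sub>R \<kappa>12 + (- b) *\<^sub>R \<kappa>22) = 0" by (simp del: scaleR_Pair)
    from frame_independent[OF this] show False by simp
  qed
  have k3: "\<nu>2 \<notin> span {\<kappa>11, \<kappa>12, \<kappa>22}"
  proof
    assume "\<nu>2 \<in> span {\<kappa>11, \<kappa>12, \<kappa>22}"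
    then obtain c where "\<nu>2 - c *\<^sub>R \<kappa>11 \<in> span {\<kappa>12, \<kappa>22}" unfolding span_breakdown_eq[of _ \<kappa>11] by blast
    then obtain a b where "\<nu>2 - c *\<^sub>R \<kappa>11 = a *\<^sub>R \<kappa>12 + b *\<^sub>R \<kappa>22" unfolding span2_iff by blast
    then have "0 *\<^sub>R \<nu>1 + 1 *\<^sub>R \<nu>2 + ((- c) *\<^sub>R \<kappa>11 + (- a) *\<^sub>R \<kappa>12 + (- b) *\<^sub>R \<kappa>22) = 0"
      by (simp del: scaleR_Pair add: algebra_simps)
    from frame_independent[OF this] show False by simp
  qed
  have k4: "\<nu>1 \<notin> span {\<nu>2, \<kappa>11, \<kappa>12, \<kappa>22}"
  proof
    assume "\<nu>1 \<in> span {\<nu>2, \<kappa>11, \<kappa>12, \<kappa>22}"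
    then obtain d where "\<nu>1 - d *\<^sub>R \<nu>2 \<in> span {\<kappa>11, \<kappa>12, \<kappa>22}" unfolding span_breakdown_eq[of _ \<nu>2] by blast
    then obtain c where "\<nu>1 - d *\<^sub>R \<nu>2 - c *\<^sub>R \<kappa>11 \<in> span {\<kappa>12, \<kappa>22}" unfolding span_breakdown_eq[of _ \<kappa>11] by blast
    then obtain a b where "\<nu>1 - d *\<^sub>R \<nu>2 - c *\<^sub>R \<kappa>11 = a *\<^sub>R \<kappa>12 + b *\<^sub>R \<kappa>22" unfolding span2_iff by blast
    then have "1 *\<^sub>R \<nu>1 + (- d) *\<^sub>R \<nu>2 + ((- c) *\<^sub>R \<kappa>11 + (- a) *\<^sub>R \<kappa>12 + (- b) *\<^sub>R \<kappa>22) = 0"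
      by (simp del: scaleR_Pair add: algebra_simps)
    from frame_independent[OF this] show False by simp
  qed
  have n4: "\<nu>1 \<notin> {\<nu>2, \<kappa>11, \<kappa>12, \<kappa>22}" using k4 by (rule contrapos_nn) (rule span_base)
  have n3: "\<nu>2 \<notin> {\<kappa>11, \<kappa>12, \<kappa>22}" using k3 by (rule contrapos_nn) (rule span_base)
  have n2: "\<kappa>11 \<notin> {\<kappa>12, \<kappa>22}" using k2 by (rule contrapos_nn) (rule span_base)
  have n1: "\<kappa>12 \<notin> {\<kappa>22}" using k1 by (rule contrapos_nn) (rule span_base)
  have i: "independent {\<nu>1, \<nu>2, \<kappa>11, \<kappa>12, \<kappa>22}"
    using independent_insertI[OF k4 independent_insertI[OF k3 independent_insertI[OF k2 independent_insertI[OF k1 k]]]] .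
  have c: "card {\<nu>1, \<nu>2, \<kappa>11, \<kappa>12, \<kappa>22} = 5"
    using n4 n3 n2 n1 by (simp only: card_insert_disjoint finite_insert finite.emptyI card.empty not_False_eq_True) simp
  show "dim C1 = 5" unfolding C1_span dim_span using dim_eq_card_independent[OF i] c by simp
qed

text \<open>The curvature of a vertical vector with a lift is its matrix applied to the base vector,
  so the table lists the values of \<open>sym_matrix\<close> on the plane; two vertical vectors have
  curvature 0.\<close>

lemma curvature_values:
  "curvature \<kappa>11 \<nu>1 = F1" "curvature \<kappa>11 \<nu>2 = 0" "curvature \<kappa>12 \<nu>1 = F2" "curvature \<kappa>12 \<nu>2 = F1"
  "curvature \<kappa>22 \<nu>1 = 0" "curvature \<kappa>22 \<nu>2 = F2"
  "curvature \<kappa>11 \<kappa>12 = 0" "curvature \<kappa>11 \<kappa>22 = 0" "curvature \<kappa>12 \<kappa>22 = 0"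
  using sym_matrix_v[of 1 0 0] sym_matrix_v[of 0 1 0] sym_matrix_v[of 0 0 1]
  by (simp_all add: curvature_def fst_nu sym_matrix_def)

end

section \<open>Lagrangian planes of the first prolongation\<close>

definition normal_form_blinfun :: "real^'n::finite \<Rightarrow> real^'n^'n \<Rightarrow> 'n space1 \<Rightarrow>\<^sub>L real" where
  "normal_form_blinfun a P = Blinfun (\<lambda>\<nu>. a \<bullet> (P *v fst \<nu>))"

text \<open>The 1-form that pairs \<open>a\<close> with the part of the base velocity orthogonal to
  the plane. These forms are globally defined on the ambient space and cut the Cartan distribution
  out of the tangent space.\<close>

definition normal_form :: "real^'n::finite \<Rightarrow> 'n space1 \<Rightarrow> 'n space1 \<Rightarrow>\<^sub>L real" where
  "normal_form a m = normal_form_blinfun a (mat 1) - normal_form_blinfun a (snd m)"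

lemma normal_form_blinfun_apply:
  fixes P :: "real^'a::finite^'a"
  shows "blinfun_apply (normal_form_blinfun a P) \<nu> = a \<bullet> (P *v fst \<nu>)"
  unfolding normal_form_blinfun_def
proof (subst bounded_linear_Blinfun_apply)
  have "linear (\<lambda>\<nu> :: 'a space1. a \<bullet> (P *v fst \<nu>))"
    by (rule linearI) (simp_all add: matrix_vector_right_distrib inner_add_right matrix_vector_mult_scaleR)
  then show "bounded_linear (\<lambda>\<nu> :: 'a space1. a \<bullet> (P *v fst \<nu>))" by (simp add: linear_conv_bounded_linear)
qed simp

lemma normal_form_apply: "blinfun_apply (normal_form a m) \<nu> = a \<bullet> (fst \<nu> - snd m *v fst \<nu>)"
  by (simp add: normal_form_def normal_form_blinfun_apply blinfun.diff_left inner_diff_right)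

lemma bounded_linear_normal_form_blinfun: "bounded_linear (\<lambda>m :: ('n::finite) space1. normal_form_blinfun a (snd m))"
proof -
  have "linear (\<lambda>m :: 'n space1. normal_form_blinfun a (snd m))"
    by (rule linearI; rule blinfun_eqI)
       (simp_all add: normal_form_blinfun_apply blinfun.add_left blinfun.scaleR_left
         matrix_vector_mult_add_rdistrib inner_add_right scaleR_matrix_vector_assoc[symmetric])
  then show ?thesis by (simp add: linear_conv_bounded_linear)
qed

lemma smooth_on_normal_form: "open S \<Longrightarrow> smooth_on S (normal_form a)"
  unfolding normal_form_def[abs_def]
  by (intro smooth_on_diff smooth_on_const smooth_on_bounded_linear bounded_linear_normal_form_blinfun)

text \<open>The form is affine in the point, so its derivative is constant and explicit. This is
  where \<open>curvature\<close> comes from.\<close>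

lemma ext_deriv_normal_form: "ext_deriv (normal_form a) m \<nu> \<mu> = - (a \<bullet> curvature \<nu> \<mu>)"
proof -
  have "(normal_form a has_derivative (\<lambda>\<nu>. 0 - normal_form_blinfun a (snd \<nu>))) (at m)"
    unfolding normal_form_def[abs_def]
    by (intro has_derivative_diff has_derivative_const bounded_linear_imp_has_derivative
        bounded_linear_normal_form_blinfun)
  from frechet_derivative_at[OF this, symmetric] show ?thesis
    by (simp add: ext_deriv_def normal_form_blinfun_apply blinfun.minus_left curvature_def inner_diff_right)
qed

lemma normal_form_zero_imp: "(\<And>a. blinfun_apply (normal_form a m) \<nu> = 0) \<Longrightarrow> snd m *v fst \<nu> = fst \<nu>"
  by (metis eq_iff_diff_eq_0 inner_eq_zero_iff normal_form_apply)

text \<open>The pullback of \<theta> under the bundle projection.\<close>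

definition form_fst :: "((real^'n::finite) \<Rightarrow> ((real^'n) \<Rightarrow>\<^sub>L real)) \<Rightarrow> 'n space1 \<Rightarrow> 'n space1 \<Rightarrow>\<^sub>L real" where
  "form_fst \<theta> m = \<theta> (fst m) o\<^sub>L Blinfun fst"

lemma form_fst_apply: "blinfun_apply (form_fst \<theta> m) \<nu> = blinfun_apply (\<theta> (fst m)) (fst \<nu>)"
  by (simp add: form_fst_def bounded_linear_Blinfun_apply bounded_linear_fst)

lemma smooth_on_form_fst:
  assumes "smooth_on S \<theta>" "open U" "fst ` U \<subseteq> S"
  shows "smooth_on U (form_fst \<theta>)"
  unfolding form_fst_def[abs_def]
  by (intro smooth_on_bilinear[OF bounded_bilinear_blinfun_compose] smooth_on_const assms
      smooth_on_compose[OF assms(1)] smooth_on_bounded_linear bounded_linear_fst)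

lemma ext_deriv_form_fst:
  assumes "smooth_on S \<theta>" "fst m \<in> S"
  shows "ext_deriv (form_fst \<theta>) m \<nu> \<mu> = ext_deriv \<theta> (fst m) (fst \<nu>) (fst \<mu>)"
proof -
  have "((\<lambda>m. \<theta> (fst m)) has_derivative (\<lambda>v. frechet_derivative \<theta> (at (fst m)) (fst v))) (at m)"
    using diff_chain_at[OF bounded_linear_imp_has_derivative[OF bounded_linear_fst] smooth_on_has_derivative[OF assms]]
    by (simp add: o_def)
  then have "(form_fst \<theta> has_derivative (\<lambda>v. frechet_derivative \<theta> (at (fst m)) (fst v) o\<^sub>L Blinfun fst)) (at m)"
    unfolding form_fst_def[abs_def]
    using bounded_bilinear.FDERIV[OF bounded_bilinear_blinfun_compose _ has_derivative_const] by fastforce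
  from frechet_derivative_at[OF this, symmetric] show ?thesis
    by (simp add: ext_deriv_def bounded_linear_Blinfun_apply bounded_linear_fst)
qed

lemma annihilator_form_normal_form: "annihilator_form M C UNIV (normal_form a)"
  unfolding annihilator_form_def
proof (intro conjI ballI smooth_on_normal_form open_UNIV)
  fix y \<nu> assume "y \<in> prolong1 M C \<inter> UNIV" and nu: "\<nu> \<in> cartan1 M C y"
  then have "snd y ** snd y = snd y" by (auto simp: prolong1_def)
  moreover obtain u where "fst \<nu> = snd y *v u" using nu by (auto simp: cartan1_def plane1_def)
  ultimately have "snd y *v fst \<nu> = fst \<nu>" by (simp add: matrix_vector_mul_assoc)
  then show "blinfun_apply (normal_form a y) \<nu> = 0" by (simp add: normal_form_apply)
qed

section \<open>Integral planes of the Cartan distribution in terms of the curvature\<close>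

context prolong_at
begin

text \<open>Every form annihilating \<open>cartan1\<close> is, on \<open>prolong1\<close>, a combination of the normal forms.\<close>

lemma annihilator_form_curvature:
  assumes U: "m \<in> U" "annihilator_form M C U \<eta>" and \<nu>: "\<nu> \<in> C1" and \<mu>: "\<mu> \<in> C1" and c: "curvature \<nu> \<mu> = 0"
  shows "ext_deriv \<eta> m \<nu> \<mu> = 0"
proof -
  have s: "smooth_on U \<eta>" using U(2) by (simp add: annihilator_form_def)
  have o: "open (W \<inter> U)" using open_W smooth_on_open[OF s] by blast
  \<comment> \<open>The coefficients are the values of \<eta> on lifts of the basis vectors: the
    value on a tangent vector depends only on the normal part of its base velocity.\<close>
  define z where "z = (\<lambda>b p. blinfun_apply (\<eta> p) (frechet_derivative R (at p) (b, 0)))"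
  have "ext_deriv \<eta> m \<nu> \<mu> = (\<Sum>b\<in>Basis. z b m * ext_deriv (normal_form b) m \<nu> \<mu>)"
  proof (rule ext_deriv_ideal[OF retraction1 m _ _ smooth_on_subset[OF s o Int_lower2]])
    show "\<nu> \<in> T1" "\<mu> \<in> T1" using \<nu> \<mu> C1_iff by auto
    show "m \<in> W \<inter> U" using m U by simp
    show "smooth_on (W \<inter> U) (normal_form b)" for b :: "real^'n" by (rule smooth_on_normal_form[OF o])
    show "smooth_on (W \<inter> U) (z b)" for b unfolding z_def
      by (intro smooth_on_blinfun_apply smooth_on_subset[OF s o]
          smooth_on_subset[OF smooth_on_derivative[OF smooth_R] o]) auto
    show "blinfun_apply (normal_form b m) \<nu> = 0" "blinfun_apply (normal_form b m) \<mu> = 0" for b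
      using \<nu> \<mu> C1_iff by (simp_all add: normal_form_apply)
    fix p u assume p: "p \<in> PM" "p \<in> W \<inter> U" and u: "u \<in> tangent_space PM p"
    interpret p: prolong_at M C X \<rho> \<theta> r0 W R a1 a2 p using p by unfold_locales auto
    let ?q = "fst u - snd p *v fst u"
    let ?D = "frechet_derivative R (at p)"
    have linD: "linear (\<lambda>q. ?D (q, 0))"
    proof -
      have "linear ((?D) \<circ> (\<lambda>q. (q, 0)))"
        using smooth_on_linear_derivative[OF smooth_R p.m(2)]
        by (intro linear_compose) (auto simp: linear_iff)
      then show ?thesis by (simp add: o_def)
    qed
    have q: "?q \<in> tangent_space M (fst p)"
      using p.fst_T1[OF u] p.P_C[of "fst u"] C_iff[OF p.x_M p.x_X] subspace_T[OF p.x_M p.x_X]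
      by (intro subspace_diff) auto
    \<comment> \<open>Removing the lift of the normal part leaves a vector of the Cartan
      distribution, which \<eta> annihilates.\<close>
    have "u - ?D (?q, 0) \<in> cartan1 M C p"
      unfolding p.C1_iff
    proof
      show "u - ?D (?q, 0) \<in> tangent_space PM p"
        using u p.derivative_R_T1 p.subspace_T1 by (intro subspace_diff)
      have "fst (?D (?q, 0)) = ?q" using fst_derivative_R[OF p.m(2)] q T_iff[OF p.x_M p.x_X] by simp
      then show "snd p *v fst (u - ?D (?q, 0)) = fst (u - ?D (?q, 0))" by (simp add: p.P_idem)
    qed
    then have "blinfun_apply (\<eta> p) (u - ?D (?q, 0)) = 0"
      using U(2) p unfolding annihilator_form_def by blast
    then have "blinfun_apply (\<eta> p) u = blinfun_apply (\<eta> p) (?D (?q, 0))" by (simp add: blinfun.diff_right)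
    also have "\<dots> = (\<Sum>b\<in>Basis. (?q \<bullet> b) *\<^sub>R blinfun_apply (\<eta> p) (?D (b, 0)))"
    proof (rule linear_euclidean_expansion)
      show "linear (\<lambda>q. blinfun_apply (\<eta> p) (?D (q, 0)))"
        using linear_compose[OF linD bounded_linear.linear[OF blinfun.bounded_linear_right]] by (simp add: o_def)
    qed
    finally show "blinfun_apply (\<eta> p) u = (\<Sum>b\<in>Basis. z b p * blinfun_apply (normal_form b p) u)"
      by (simp add: z_def normal_form_apply inner_commute mult.commute)
  qed
  then show ?thesis by (simp add: ext_deriv_normal_form c)
qed

text \<open>For necessity the normal forms are sufficient test forms, with \<open>a\<close> taken as
  the curvature value itself. For sufficiency, arbitrary annihilator forms are reduced to them by
  \<open>annihilator_form_curvature\<close>.\<close>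

lemma lagrangian_plane2_iff:
  "lagrangian_plane2 M C m L \<longleftrightarrow> subspace L \<and> dim L = 2 \<and> L \<subseteq> C1 \<and> (\<forall>\<nu>\<in>L. fst \<nu> = 0 \<longrightarrow> \<nu> = 0) \<and>
    (\<forall>\<nu>\<in>L. \<forall>\<mu>\<in>L. curvature \<nu> \<mu> = 0)"
proof
  assume L: "lagrangian_plane2 M C m L"
  have nf: "blinfun_apply (normal_form a m) \<nu> = 0" "ext_deriv (normal_form a) m \<nu> \<mu> = 0"
    if "\<nu> \<in> L" "\<mu> \<in> L" for a \<nu> \<mu>
  proof -
    have "\<forall>U \<eta>. m \<in> U \<and> annihilator_form M C U \<eta> \<longrightarrow>
        (\<forall>v\<in>L. blinfun_apply (\<eta> m) v = 0) \<and> (\<forall>v\<in>L. \<forall>w\<in>L. ext_deriv \<eta> m v w = 0)"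
      using L unfolding lagrangian_plane2_def by blast
    from spec[OF spec[OF this, of UNIV], of "normal_form a"]
    have "(\<forall>v\<in>L. blinfun_apply (normal_form a m) v = 0) \<and> (\<forall>v\<in>L. \<forall>w\<in>L. ext_deriv (normal_form a) m v w = 0)"
      using annihilator_form_normal_form by blast
    then show "blinfun_apply (normal_form a m) \<nu> = 0" "ext_deriv (normal_form a) m \<nu> \<mu> = 0"
      using that by blast+
  qed
  note L1 = L[unfolded lagrangian_plane2_def, THEN conjunct1] L[unfolded lagrangian_plane2_def, THEN conjunct2, THEN conjunct1]
    and T = L[unfolded lagrangian_plane2_def, THEN conjunct2, THEN conjunct2, THEN conjunct1]
    and L0 = L[unfolded lagrangian_plane2_def, THEN conjunct2, THEN conjunct2, THEN conjunct2, THEN conjunct1]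
  have "\<nu> \<in> C1" if "\<nu> \<in> L" for \<nu>
    using T normal_form_zero_imp[OF nf(1)[OF that that]] that unfolding C1_iff by blast
  moreover have "curvature \<nu> \<mu> = 0" if "\<nu> \<in> L" "\<mu> \<in> L" for \<nu> \<mu>
    using nf(2)[OF that, of "curvature \<nu> \<mu>"] by (simp add: ext_deriv_normal_form)
  ultimately show "subspace L \<and> dim L = 2 \<and> L \<subseteq> C1 \<and> (\<forall>\<nu>\<in>L. fst \<nu> = 0 \<longrightarrow> \<nu> = 0) \<and>
    (\<forall>\<nu>\<in>L. \<forall>\<mu>\<in>L. curvature \<nu> \<mu> = 0)"
    using L1 L0 by (intro conjI) auto
next
  assume L: "subspace L \<and> dim L = 2 \<and> L \<subseteq> C1 \<and> (\<forall>\<nu>\<in>L. fst \<nu> = 0 \<longrightarrow> \<nu> = 0) \<and>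
    (\<forall>\<nu>\<in>L. \<forall>\<mu>\<in>L. curvature \<nu> \<mu> = 0)"
  have 0: "L \<inter> {\<nu>. fst \<nu> = 0} = {0}" using L subspace_0[of L] by auto
  have T: "L \<subseteq> T1" using L C1_iff by blast
  have 1: "blinfun_apply (\<eta> m) \<nu> = 0" if "m \<in> U" "annihilator_form M C U \<eta>" "\<nu> \<in> L" for U \<eta> \<nu>
    using that m L unfolding annihilator_form_def by blast
  have 2: "ext_deriv \<eta> m \<nu> \<mu> = 0" if "m \<in> U" "annihilator_form M C U \<eta>" "\<nu> \<in> L" "\<mu> \<in> L" for U \<eta> \<nu> \<mu>
    using annihilator_form_curvature[OF that(1,2)] that(3,4) L by blast
  show "lagrangian_plane2 M C m L" unfolding lagrangian_plane2_def
    by (intro conjI allI impI ballI) (use L 0 T in simp_all, auto intro: 1 2)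
qed

text \<open>Values of the curvature are tangent to \<open>M\<close> because the forms \<open>a \<bullet> (\<xi> - T \<xi>)\<close> vanish on \<open>M\<close>, and
  lie in the contact plane because \<open>d\<theta>\<close> vanishes on \<open>plane1 m\<close>.\<close>

lemma curvature_mem:
  assumes \<nu>: "\<nu> \<in> C1" and \<mu>: "\<mu> \<in> C1"
  shows "curvature \<nu> \<mu> \<in> C x" "P *v curvature \<nu> \<mu> = 0"
proof -
  have T1: "\<nu> \<in> T1" "\<mu> \<in> T1" and fixed: "P *v fst \<nu> = fst \<nu>" "P *v fst \<mu> = fst \<mu>"
    using \<nu> \<mu> C1_iff by auto
  show "P *v curvature \<nu> \<mu> = 0"
    using T1_off_diagonal[OF T1(1), of "fst \<mu>"] T1_off_diagonal[OF T1(2), of "fst \<nu>"]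
    by (simp add: curvature_def matrix_vector_mult_diff_distrib fixed)
  have zero: "blinfun_apply (normal_form b m) \<nu> = 0" "blinfun_apply (normal_form b m) \<mu> = 0" for b
    using fixed by (simp_all add: normal_form_apply)
  have expand: "h y = (\<Sum>b\<in>Basis. h b * (b \<bullet> y))" if "linear h" for h :: "real^'n \<Rightarrow> real" and y
    using linear_euclidean_expansion[OF that, of y] by (simp add: inner_commute mult.commute)
  have "T x (curvature \<nu> \<mu>) = curvature \<nu> \<mu>"
  proof (rule vector_eq_ldot[THEN iffD1], rule allI)
    fix a :: "real^'n"
    have linh: "linear (\<lambda>q. a \<bullet> (q - T y q))" if "y \<in> X" for y
      using linear_T[OF that] by (intro linearI) (simp_all add: linear_add linear_scale algebra_simps inner_diff_right inner_add_right)
    \<comment> \<open>The zero form is expressed through the normal forms, since the normal part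
      \<open>?q\<close> of a base velocity is tangent to \<open>M\<close>; differentiating this
      trivial identity constrains the curvature.\<close>
    have "ext_deriv (\<lambda>_. 0) m \<nu> \<mu> =
      (\<Sum>b\<in>Basis. (a \<bullet> (b - T (fst m) b)) * ext_deriv (normal_form b) m \<nu> \<mu>)"
    proof (rule ext_deriv_ideal[OF retraction1 m T1 smooth_on_const[OF open_W] m(2)])
      show "smooth_on W (normal_form b)" for b :: "real^'n" by (rule smooth_on_normal_form[OF open_W])
      show "smooth_on W (\<lambda>p. a \<bullet> (b - T (fst p) b))" for b
        using fst_W by (intro smooth_on_inner smooth_on_const open_W smooth_on_diff
          smooth_on_compose[OF smooth_on_derivative[OF smooth_rho] smooth_fst_W]) auto
      show "blinfun_apply (normal_form b m) \<nu> = 0" "blinfun_apply (normal_form b m) \<mu> = 0" for b by (fact zero)+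
      fix p u assume p: "p \<in> PM" "p \<in> W" and u: "u \<in> tangent_space PM p"
      interpret p: prolong_at M C X \<rho> \<theta> r0 W R a1 a2 p using p by unfold_locales auto
      let ?q = "fst u - snd p *v fst u"
      have q: "?q \<in> tangent_space M (fst p)"
        using p.fst_T1[OF u] p.P_C[of "fst u"] C_iff[OF p.x_M p.x_X] subspace_T[OF p.x_M p.x_X]
        by (intro subspace_diff) auto
      then have "a \<bullet> (?q - T (fst p) ?q) = 0" using T_iff[OF p.x_M p.x_X] by simp
      then show "blinfun_apply 0 u = (\<Sum>b\<in>Basis. (a \<bullet> (b - T (fst p) b)) * blinfun_apply (normal_form b p) u)"
        using expand[OF linh[OF p.x_X], of ?q] by (simp add: normal_form_apply)
    qed
    moreover have "ext_deriv (\<lambda>_. 0 :: 'n space1 \<Rightarrow>\<^sub>L real) m \<nu> \<mu> = 0" by (simp add: ext_deriv_def)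
    ultimately have "a \<bullet> (curvature \<nu> \<mu> - T x (curvature \<nu> \<mu>)) = 0"
      using expand[OF linh[OF x_X], of "curvature \<nu> \<mu>"] by (simp add: ext_deriv_normal_form sum_negf)
    then show "a \<bullet> T x (curvature \<nu> \<mu>) = a \<bullet> curvature \<nu> \<mu>" by (simp add: inner_diff_right)
  qed
  then have t: "curvature \<nu> \<mu> \<in> tangent_space M x" using T_iff[OF x_M x_X] by simp
  have sub: "fst ` W \<subseteq> X" using fst_W by auto
  \<comment> \<open>The pullback of \<theta> sees only the normal part of the base velocity, because
    the plane lies in the contact plane.\<close>
  have "ext_deriv (form_fst \<theta>) m \<nu> \<mu> = (\<Sum>b\<in>Basis. blinfun_apply (\<theta> (fst m)) b * ext_deriv (normal_form b) m \<nu> \<mu>)"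
  proof (rule ext_deriv_ideal[OF retraction1 m T1 smooth_on_form_fst[OF smooth_theta open_W sub] m(2)])
    show "smooth_on W (normal_form b)" for b :: "real^'n" by (rule smooth_on_normal_form[OF open_W])
    show "smooth_on W (\<lambda>p. blinfun_apply (\<theta> (fst p)) b)" for b
      by (intro smooth_on_blinfun_apply smooth_on_const open_W smooth_on_compose[OF smooth_theta smooth_fst_W sub])
    show "blinfun_apply (normal_form b m) \<nu> = 0" "blinfun_apply (normal_form b m) \<mu> = 0" for b by (fact zero)+
    fix p u assume p: "p \<in> PM" "p \<in> W" and u: "u \<in> tangent_space PM p"
    interpret p: prolong_at M C X \<rho> \<theta> r0 W R a1 a2 p using p by unfold_locales auto
    have "blinfun_apply (\<theta> (fst p)) (fst u) = blinfun_apply (\<theta> (fst p)) (fst u - snd p *v fst u)"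
      using p.P_C C_iff[OF p.x_M p.x_X] by (simp add: blinfun.diff_right)
    then show "blinfun_apply (form_fst \<theta> p) u = (\<Sum>b\<in>Basis. blinfun_apply (\<theta> (fst p)) b * blinfun_apply (normal_form b p) u)"
      unfolding form_fst_apply normal_form_apply
      using expand[OF linear_theta, of "fst p" "fst u - snd p *v fst u"] by (simp only:)
  qed
  moreover have "ext_deriv (form_fst \<theta>) m \<nu> \<mu> = 0"
    using ext_deriv_form_fst[OF smooth_theta x_X, of \<nu> \<mu>] P_isotropic[of "fst \<nu>" "fst \<mu>"] fixed by simp
  ultimately have "blinfun_apply (\<theta> x) (curvature \<nu> \<mu>) = 0"
    using expand[OF linear_theta, of x "curvature \<nu> \<mu>"] by (simp add: ext_deriv_normal_form sum_negf)
  then show "curvature \<nu> \<mu> \<in> C x" using t C_iff[OF x_M x_X] by simp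
qed

lemma prolong2_exists:
  assumes "lagrangian_plane2 M C m L"
  obtains z where "z \<in> prolong2 M C" "fst z = m" "plane2 z = L"
proof -
  obtain r s where L: "L = span {r, s}" "indep2 r s"
    using dim2_basis assms unfolding lagrangian_plane2_def by metis
  define q where "q = Blinfun (plane_proj r s)"
  have "bounded_linear (plane_proj r s)" using linear_plane_proj[of r s] by (simp add: linear_conv_bounded_linear)
  then have q: "blinfun_apply q = plane_proj r s" by (simp add: q_def bounded_linear_Blinfun_apply)
  have p: "plane2 (m, q) = L" using range_plane_proj[OF L(2)] L(1) by (simp add: plane2_def q)
  have "q o\<^sub>L q = q"
    by (rule blinfun_eqI) (simp add: q plane_proj_id[OF L(2) plane_proj_span])
  then have "(m, q) \<in> prolong2 M C"
    using m assms p by (simp add: prolong2_def q plane_proj_selfadjoint)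
  then show ?thesis using that p by auto
qed

end

section \<open>The distribution determined by a first integral\<close>

text \<open>A 2-form \<open>\<Phi>\<close> with radical \<open>D\<close> which vanishes on the isotropic planes in \<open>H\<close> is congruent to a
  multiple of \<open>\<phi>\<close> modulo the curvature, where \<open>H\<close> is the kernel of \<open>\<phi>\<close>: \<open>\<Phi> = \<alpha> \<circ> \<Omega> + \<phi> \<and> \<zeta>\<close>. The set
  below is the common kernel of \<open>\<phi>\<close> and \<open>\<zeta>\<close>, described without choosing \<open>\<Phi>\<close>, which is only unique
  up to a factor.\<close>

definition conjugate_distribution ::
    "('e::euclidean_space \<Rightarrow> 'e \<Rightarrow> 'f::euclidean_space) \<Rightarrow> 'e set \<Rightarrow> 'e set \<Rightarrow> 'e set \<Rightarrow> 'e set" where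
  "conjugate_distribution \<Omega> V H D = {v \<in> H. \<forall>\<Phi> \<alpha>. bilinear \<Phi> \<longrightarrow> (\<forall>u. \<Phi> u u = (0::real)) \<longrightarrow>
     (\<forall>u\<in>D. \<forall>w\<in>V. \<Phi> u w = 0) \<longrightarrow> linear \<alpha> \<longrightarrow> (\<forall>u\<in>H. \<forall>w\<in>H. \<Phi> u w = \<alpha> (\<Omega> u w)) \<longrightarrow>
     (\<forall>u\<in>V. \<Phi> u v = \<alpha> (\<Omega> u v))}"

text \<open>The linear algebra at one point, detached from the manifolds: \<open>V\<close> is the
  Cartan space, \<Omega> the curvature, \<phi> the differential of \<open>f\<close>, and \<alpha>1,
  \<alpha>2 read off coordinates with respect to \<open>F1\<close>, \<open>F2\<close>.\<close>

locale curvature_frame =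
  fixes V :: "'e::euclidean_space set" and \<Omega> :: "'e \<Rightarrow> 'e \<Rightarrow> 'f::euclidean_space"
    and \<nu>1 \<nu>2 \<kappa>11 \<kappa>12 \<kappa>22 :: 'e and F1 F2 :: 'f and \<alpha>1 \<alpha>2 :: "'f \<Rightarrow> real" and \<phi> :: "'e \<Rightarrow> real"
  assumes V: "V = span {\<nu>1, \<nu>2, \<kappa>11, \<kappa>12, \<kappa>22}" and dim_V: "dim V = 5"
    and bilinear: "bilinear \<Omega>" and alternating: "\<Omega> u u = 0"
    and frame_values: "\<Omega> \<kappa>11 \<nu>1 = F1" "\<Omega> \<kappa>11 \<nu>2 = 0" "\<Omega> \<kappa>12 \<nu>1 = F2" "\<Omega> \<kappa>12 \<nu>2 = F1"
      "\<Omega> \<kappa>22 \<nu>1 = 0" "\<Omega> \<kappa>22 \<nu>2 = F2" "\<Omega> \<kappa>11 \<kappa>12 = 0" "\<Omega> \<kappa>11 \<kappa>22 = 0" "\<Omega> \<kappa>12 \<kappa>22 = 0"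
    and linear_coord: "linear \<alpha>1" "linear \<alpha>2" and coord: "\<alpha>1 F1 = 1" "\<alpha>1 F2 = 0" "\<alpha>2 F1 = 0" "\<alpha>2 F2 = 1"
    and expansion: "u \<in> V \<Longrightarrow> w \<in> V \<Longrightarrow> \<Omega> u w = \<alpha>1 (\<Omega> u w) *\<^sub>R F1 + \<alpha>2 (\<Omega> u w) *\<^sub>R F2"
    and linear_phi: "linear \<phi>" and phi_nonzero: "\<phi> \<kappa>11 \<noteq> 0"
begin

text \<open>\<open>\<kappa>11\<close> serves as pivot: the other frame vectors are shifted along it
  into the kernel of \<phi>, and \<open>n\<close> is its multiple on which \<phi> is 1.\<close>

definition "n = (1 / \<phi> \<kappa>11) *\<^sub>R \<kappa>11"
abbreviation "a \<equiv> \<phi> \<kappa>12 / \<phi> \<kappa>11"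
abbreviation "b \<equiv> \<phi> \<kappa>22 / \<phi> \<kappa>11"
definition "k1 = \<kappa>12 - (\<phi> \<kappa>12 / \<phi> \<kappa>11) *\<^sub>R \<kappa>11"
definition "k2 = \<kappa>22 - (\<phi> \<kappa>22 / \<phi> \<kappa>11) *\<^sub>R \<kappa>11"
definition "l1 = \<nu>1 - (\<phi> \<nu>1 / \<phi> \<kappa>11) *\<^sub>R \<kappa>11"
definition "l2 = \<nu>2 - (\<phi> \<nu>2 / \<phi> \<kappa>11) *\<^sub>R \<kappa>11"
lemmas adapted_defs = n_def k1_def k2_def l1_def l2_def

abbreviation "H \<equiv> {v \<in> V. \<phi> v = 0}"

lemmas bil = bilinear_ladd[OF bilinear] bilinear_radd[OF bilinear] bilinear_lmul[OF bilinear]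
  bilinear_rmul[OF bilinear] bilinear_lsub[OF bilinear] bilinear_rsub[OF bilinear]

lemmas phi = linear_add[OF linear_phi] linear_scale[OF linear_phi] linear_diff[OF linear_phi]

lemma swap: "\<Omega> u w = - \<Omega> w u"
proof -
  have "\<Omega> (u + w) (u + w) = \<Omega> u u + \<Omega> u w + (\<Omega> w u + \<Omega> w w)" by (simp add: bil)
  then have "\<Omega> u w + \<Omega> w u = 0" by (simp add: alternating)
  then show ?thesis by (rule eq_neg_iff_add_eq_0[THEN iffD2])
qed

lemma subspace_V: "subspace V" and subspace_H: "subspace H"
proof -
  show s: "subspace V" unfolding V by simp
  show "subspace H" using s by (auto simp: subspace_def phi linear_0[OF linear_phi])
qed

lemma frame_V: "\<nu>1 \<in> V" "\<nu>2 \<in> V" "\<kappa>11 \<in> V" "\<kappa>12 \<in> V" "\<kappa>22 \<in> V"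
  unfolding V by (rule span_base; blast)+

lemma adapted_V: "n \<in> V" "k1 \<in> V" "k2 \<in> V" "l1 \<in> V" "l2 \<in> V"
  using frame_V subspace_V by (simp_all add: adapted_defs subspace_diff subspace_scale)

lemma adapted_H: "k1 \<in> H" "k2 \<in> H" "l1 \<in> H" "l2 \<in> H"
  using adapted_V phi_nonzero by (simp_all add: adapted_defs phi)

lemma phi_n: "\<phi> n = 1"
  using phi_nonzero by (simp add: n_def phi)

lemma H_span: "H = span {l1, l2, k1, k2}"
proof
  show "span {l1, l2, k1, k2} \<subseteq> H" using adapted_H subspace_H by (intro span_minimal) auto
  have key: "v - \<phi> v *\<^sub>R n \<in> span {l1, l2, k1, k2}" if "v \<in> {\<nu>1, \<nu>2, \<kappa>11, \<kappa>12, \<kappa>22}" for v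
  proof -
    have "v - \<phi> v *\<^sub>R n \<in> {l1, l2, k1, k2, 0}" using that phi_nonzero by (auto simp: adapted_defs)
    then show ?thesis by (auto intro: span_base span_0)
  qed
  show "H \<subseteq> span {l1, l2, k1, k2}"
  proof
    fix v assume v: "v \<in> H"
    have "v - \<phi> v *\<^sub>R n \<in> span {l1, l2, k1, k2}" if "v \<in> V" for v
      using that unfolding V
    proof (induction rule: span_induct_alt)
      case base
      then show ?case by (simp add: linear_0[OF linear_phi] span_0)
    next
      case (step c u w)
      have "c *\<^sub>R u + w - \<phi> (c *\<^sub>R u + w) *\<^sub>R n = c *\<^sub>R (u - \<phi> u *\<^sub>R n) + (w - \<phi> w *\<^sub>R n)"
        by (simp add: phi scaleR_diff_right algebra_simps)
      then show ?case using span_add[OF span_scale[OF key[OF step(1)], of c] step(2)] by (simp only:)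
    qed
    then show "v \<in> span {l1, l2, k1, k2}" using v by fastforce
  qed
qed

lemma V_decomposition:
  assumes "v \<in> V"
  obtains h where "h \<in> H" "v = h + \<phi> v *\<^sub>R n"
proof
  have "v - \<phi> v *\<^sub>R n \<in> V" by (intro subspace_diff subspace_scale subspace_V adapted_V assms)
  moreover have "\<phi> (v - \<phi> v *\<^sub>R n) = 0"
    by (simp only: linear_diff[OF linear_phi] linear_scale[OF linear_phi, of "\<phi> v"] phi_n) simp
  ultimately show "v - \<phi> v *\<^sub>R n \<in> H" by blast
qed simp

lemma dim_H: "dim H = 4"
proof -
  have "V = span (insert n H)"
  proof
    show "V \<subseteq> span (insert n H)"
    proof
      fix v assume "v \<in> V"
      then obtain h where h: "h \<in> H" "v = h + \<phi> v *\<^sub>R n" by (rule V_decomposition)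
      have "h + \<phi> v *\<^sub>R n \<in> span (insert n H)"
        by (intro span_add span_scale[of n]) (use h(1) in \<open>auto intro: span_base\<close>)
      then show "v \<in> span (insert n H)" using h(2) by simp
    qed
    show "span (insert n H) \<subseteq> V" using adapted_V subspace_V by (intro span_minimal) auto
  qed
  then have "dim (insert n H) = 5" using dim_V dim_span by metis
  moreover have "n \<notin> span H" unfolding span_eq_iff[THEN iffD2, OF subspace_H] using phi_n by simp
  ultimately show ?thesis by (simp add: dim_insert)
qed

lemma curvature_adapted:
  "\<Omega> k1 k2 = 0" "\<Omega> k1 l1 = F2 - a *\<^sub>R F1" "\<Omega> k1 l2 = F1" "\<Omega> k2 l1 = (- b) *\<^sub>R F1" "\<Omega> k2 l2 = F2"
  "\<Omega> n k1 = 0" "\<Omega> n k2 = 0" "\<Omega> n l1 = (1 / \<phi> \<kappa>11) *\<^sub>R F1" "\<Omega> n l2 = 0"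
  using swap[of \<kappa>12 \<kappa>11] swap[of \<kappa>22 \<kappa>11] by (simp_all add: adapted_defs bil frame_values alternating)

end

text \<open>\<open>D\<close> is cut out by \<psi>1, \<psi>2, and \<open>c1\<close>,
  \<open>c2\<close> span a dual complement. The condition \<open>meets\<close> is restricted to
  planes in \<open>H\<close> with a basis lifting \<nu>1, \<nu>2 modulo vertical vectors; these
  already give enough coefficients to compare.\<close>

locale radical_frame = curvature_frame V \<Omega> \<nu>1 \<nu>2 \<kappa>11 \<kappa>12 \<kappa>22 F1 F2 \<alpha>1 \<alpha>2 \<phi>
  for V :: "'e::euclidean_space set" and \<Omega> :: "'e \<Rightarrow> 'e \<Rightarrow> 'f::euclidean_space"
    and \<nu>1 \<nu>2 \<kappa>11 \<kappa>12 \<kappa>22 :: 'e and F1 F2 :: 'f and \<alpha>1 \<alpha>2 :: "'f \<Rightarrow> real" and \<phi> :: "'e \<Rightarrow> real" +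
  fixes D :: "'e set" and \<psi>1 \<psi>2 :: "'e \<Rightarrow> real" and c1 c2 :: 'e
  assumes linear_psi: "linear \<psi>1" "linear \<psi>2" and c_V: "c1 \<in> V" "c2 \<in> V"
    and psi_c: "\<psi>1 c1 = 1" "\<psi>1 c2 = 0" "\<psi>2 c1 = 0" "\<psi>2 c2 = 1"
    and D: "D = {v \<in> V. \<psi>1 v = 0 \<and> \<psi>2 v = 0}"
    and meets: "L1 \<in> H \<Longrightarrow> L2 \<in> H \<Longrightarrow> \<Omega> L1 L2 = 0 \<Longrightarrow> L1 - \<nu>1 \<in> span {\<kappa>11, \<kappa>12, \<kappa>22} \<Longrightarrow>
      L2 - \<nu>2 \<in> span {\<kappa>11, \<kappa>12, \<kappa>22} \<Longrightarrow> \<exists>r\<in>span {L1, L2}. r \<noteq> 0 \<and> r \<in> D"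
begin

text \<open>\<Phi> is \<psi>1 \<and> \<psi>2. The coefficients of \<alpha> are forced by \<Phi> =
  \<alpha> o \<Omega> on \<open>H\<close>, since \<Omega> takes the values \<open>F1\<close> and
  \<open>F2\<close> on (\<open>k1\<close>, \<open>l2\<close>) and (\<open>k2\<close>,
  \<open>l2\<close>). \<zeta> is the contraction of \<Phi> - \<alpha> o \<Omega> with
  \<open>n\<close>.\<close>

definition "\<Phi> u v = \<psi>1 u * \<psi>2 v - \<psi>1 v * \<psi>2 u"
definition "\<alpha> y = \<Phi> k1 l2 * \<alpha>1 y + \<Phi> k2 l2 * \<alpha>2 y"
definition "\<zeta> v = \<Phi> n v - \<alpha> (\<Omega> n v)"

lemmas psi = linear_add[OF linear_psi(1)] linear_scale[OF linear_psi(1)] linear_diff[OF linear_psi(1)]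
  linear_add[OF linear_psi(2)] linear_scale[OF linear_psi(2)] linear_diff[OF linear_psi(2)]

lemmas coords = linear_add[OF linear_coord(1)] linear_scale[OF linear_coord(1)] linear_diff[OF linear_coord(1)]
  linear_add[OF linear_coord(2)] linear_scale[OF linear_coord(2)] linear_diff[OF linear_coord(2)]
  linear_neg[OF linear_coord(1)] linear_neg[OF linear_coord(2)]

section \<open>Comparison of \<Phi> with the curvature\<close>

lemma bilinear_Phi: "bilinear \<Phi>"
  unfolding bilinear_def \<Phi>_def by (intro conjI allI linearI) (simp_all add: psi algebra_simps)

lemma Phi_self: "\<Phi> u u = 0"
  by (simp add: \<Phi>_def)

lemma linear_alpha: "linear \<alpha>"
  unfolding \<alpha>_def by (rule linearI) (simp_all add: coords algebra_simps)

lemma linear_zeta: "linear \<zeta>"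
  unfolding \<zeta>_def
  by (rule linearI) (simp_all add: bilinear_radd[OF bilinear_Phi] bilinear_rmul[OF bilinear_Phi] bil
      linear_add[OF linear_alpha] linear_scale[OF linear_alpha] algebra_simps)

lemma Phi_H:
  assumes "u \<in> H" "w \<in> H"
  shows "\<Phi> u w = \<alpha> (\<Omega> u w)"
proof (rule form_vanishing_on_isotropic_planes[where \<Phi> = \<Phi> and \<Omega> = \<Omega> and \<alpha> = \<alpha> and u = u and w = w])
  show "u \<in> span {l1, l2, k1, k2}" "w \<in> span {l1, l2, k1, k2}" using assms H_span by auto
  show "\<Omega> l1 l2 = \<alpha>1 (\<Omega> l1 l2) *\<^sub>R F1 + \<alpha>2 (\<Omega> l1 l2) *\<^sub>R F2"
    by (rule expansion) (use adapted_V in auto)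
  fix q r
  \<comment> \<open>For \<open>?L2\<close> with free coefficients \<open>q\<close>,
    \<open>r\<close>, the \<open>F1\<close>- and \<open>F2\<close>-components of the isotropy
    equation are linear in the coefficients of \<open>?L1\<close>, and these are their
    solutions.\<close>
  let ?c1 = "\<alpha>1 (\<Omega> l1 l2)" and ?c2 = "\<alpha>2 (\<Omega> l1 l2)"
  let ?L1 = "l1 + (- ?c1 - a * q - b * r) *\<^sub>R k1 + (q - ?c2) *\<^sub>R k2"
  let ?L2 = "l2 + q *\<^sub>R k1 + r *\<^sub>R k2"
  have span_kappa: "k1 \<in> span {\<kappa>11, \<kappa>12, \<kappa>22}" "k2 \<in> span {\<kappa>11, \<kappa>12, \<kappa>22}"
    "l1 - \<nu>1 \<in> span {\<kappa>11, \<kappa>12, \<kappa>22}" "l2 - \<nu>2 \<in> span {\<kappa>11, \<kappa>12, \<kappa>22}"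
    by (simp_all add: adapted_defs span_diff span_scale span_neg span_base)
  have "\<exists>r\<in>span {?L1, ?L2}. r \<noteq> 0 \<and> r \<in> D"
  proof (rule meets)
    show "?L1 \<in> H" "?L2 \<in> H"
      by (intro subspace_add subspace_scale subspace_H adapted_H)+
    have "?L1 - \<nu>1 = (l1 - \<nu>1) + (- ?c1 - a * q - b * r) *\<^sub>R k1 + (q - ?c2) *\<^sub>R k2"
      "?L2 - \<nu>2 = (l2 - \<nu>2) + q *\<^sub>R k1 + r *\<^sub>R k2"
      by (simp_all only: add_diff_eq add.assoc diff_add_eq)
    then show "?L1 - \<nu>1 \<in> span {\<kappa>11, \<kappa>12, \<kappa>22}" "?L2 - \<nu>2 \<in> span {\<kappa>11, \<kappa>12, \<kappa>22}"
      by (simp_all only: span_add span_scale span_kappa)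
    have "\<Omega> ?L1 ?L2 = \<Omega> l1 l2 + q *\<^sub>R \<Omega> l1 k1 + r *\<^sub>R \<Omega> l1 k2 + (- ?c1 - a * q - b * r) *\<^sub>R \<Omega> k1 l2 +
       (q - ?c2) *\<^sub>R \<Omega> k2 l2 + ((- ?c1 - a * q - b * r) * r) *\<^sub>R \<Omega> k1 k2 + ((q - ?c2) * q) *\<^sub>R \<Omega> k2 k1"
      unfolding bilinear_ladd[OF bilinear] bilinear_radd[OF bilinear] bilinear_lmul[OF bilinear]
        bilinear_rmul[OF bilinear] alternating by (simp add: algebra_simps)
    also have "\<dots> = 0"
    proof -
      have e: "\<Omega> l1 l2 = ?c1 *\<^sub>R F1 + ?c2 *\<^sub>R F2" by (rule expansion) (use adapted_V in auto)
      have z: "c = p *\<^sub>R F1 + s *\<^sub>R F2 \<Longrightarrow> c + q *\<^sub>R (- (F2 - a *\<^sub>R F1)) + r *\<^sub>R (- ((- b) *\<^sub>R F1)) + (- p - a * q - b * r) *\<^sub>R F1 +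
        (q - s) *\<^sub>R F2 + ((- p - a * q - b * r) * r) *\<^sub>R 0 + ((q - s) * q) *\<^sub>R (- 0) = 0" for c p s
        by (simp add: algebra_simps)
      show ?thesis unfolding curvature_adapted swap[of l1 k1] swap[of l1 k2] swap[of k2 k1] by (rule z[OF e])
    qed
    finally show "\<Omega> ?L1 ?L2 = 0" .
  qed
  then obtain s where "s \<in> span {?L1, ?L2}" "s \<noteq> 0" "\<psi>1 s = 0" "\<psi>2 s = 0" unfolding D by blast
  from common_zero_imp[OF linear_psi this] show "\<Phi> ?L1 ?L2 = 0" unfolding \<Phi>_def .
qed (simp_all add: bilinear_Phi Phi_self \<alpha>_def bilinear alternating linear_alpha coord curvature_adapted)

text \<open>The difference of the two forms vanishes on the hyperplane \<open>H\<close>, and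
  \<open>V\<close> is spanned by \<open>H\<close> and \<open>n\<close> with \<phi> n = 1; hence it
  is the wedge of \<phi> with its contraction by \<open>n\<close>.\<close>

lemma Phi_V:
  assumes "u \<in> V" "w \<in> V"
  shows "\<Phi> u w - \<alpha> (\<Omega> u w) = \<phi> u * \<zeta> w - \<phi> w * \<zeta> u"
proof -
  define \<Psi> where "\<Psi> u w = \<Phi> u w - \<alpha> (\<Omega> u w)" for u w
  have \<Psi>: "bilinear \<Psi>"
    unfolding \<Psi>_def bilinear_def
    by (intro conjI allI linearI) (simp_all add: bilinear_radd[OF bilinear_Phi] bilinear_rmul[OF bilinear_Phi]
        bilinear_ladd[OF bilinear_Phi] bilinear_lmul[OF bilinear_Phi] bil
        linear_add[OF linear_alpha] linear_scale[OF linear_alpha] algebra_simps)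
  have sw: "\<Psi> u w = - \<Psi> w u" for u w
    unfolding \<Psi>_def using swap[of u w] linear_neg[OF linear_alpha] by (simp add: \<Phi>_def algebra_simps)
  obtain h where h: "h \<in> H" "u = h + \<phi> u *\<^sub>R n" using V_decomposition[OF assms(1)] .
  obtain h' where h': "h' \<in> H" "w = h' + \<phi> w *\<^sub>R n" using V_decomposition[OF assms(2)] .
  have nn: "\<Psi> n n = 0" using sw[of n n] by simp
  have hh: "\<Psi> h h' = 0" using Phi_H[OF h(1) h'(1)] by (simp add: \<Psi>_def)
  have zeta: "\<zeta> v = \<Psi> n v" for v by (simp add: \<Psi>_def \<zeta>_def)
  have "\<Psi> u w = \<Psi> (h + \<phi> u *\<^sub>R n) (h' + \<phi> w *\<^sub>R n)" using h(2) h'(2) by simp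
  also have "\<dots> = \<phi> u * \<Psi> n h' - \<phi> w * \<Psi> n h"
    by (simp add: bilinear_ladd[OF \<Psi>] bilinear_radd[OF \<Psi>] bilinear_lmul[OF \<Psi>] bilinear_rmul[OF \<Psi>] nn hh sw[of h n])
  also have "\<Psi> n h' = \<Psi> n w"
    using arg_cong[OF h'(2), of "\<Psi> n"] by (simp add: bilinear_radd[OF \<Psi>] bilinear_rmul[OF \<Psi>] nn)
  also have "\<Psi> n h = \<Psi> n u"
    using arg_cong[OF h(2), of "\<Psi> n"] by (simp add: bilinear_radd[OF \<Psi>] bilinear_rmul[OF \<Psi>] nn)
  finally show ?thesis unfolding zeta unfolding \<Psi>_def .
qed

text \<open>One inclusion tests with the pair \<Phi>, \<alpha> and the vector \<open>n\<close>. For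
  the other, \<open>V\<close> modulo \<open>D\<close> is 2-dimensional, so each admissible 2-form is
  a multiple of \<Phi>, and its functional is the same multiple of \<alpha> on \<open>F1\<close>,
  \<open>F2\<close>.\<close>

lemma conjugate_distribution_eq: "conjugate_distribution \<Omega> V H D = {v \<in> H. \<zeta> v = 0}"
proof (intro subset_antisym subsetI)
  fix v assume v: "v \<in> conjugate_distribution \<Omega> V H D"
  have "\<forall>u\<in>V. \<Phi> u v = \<alpha> (\<Omega> u v)"
  proof -
    have "\<forall>u. \<Phi> u u = 0" "\<forall>u\<in>D. \<forall>w\<in>V. \<Phi> u w = 0" "\<forall>u\<in>H. \<forall>w\<in>H. \<Phi> u w = \<alpha> (\<Omega> u w)"
      using Phi_H by (auto simp: Phi_self) (simp add: \<Phi>_def D)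
    then show ?thesis using v bilinear_Phi linear_alpha unfolding conjugate_distribution_def by blast
  qed
  then have "\<zeta> v = 0" using adapted_V(1) by (simp add: \<zeta>_def)
  then show "v \<in> {v \<in> H. \<zeta> v = 0}" using v by (simp add: conjugate_distribution_def)
next
  fix v assume v: "v \<in> {v \<in> H. \<zeta> v = 0}"
  have "\<Phi>' u v = \<alpha>' (\<Omega> u v)"
    if P: "bilinear \<Phi>'" "\<forall>u. \<Phi>' u u = (0::real)" "\<forall>u\<in>D. \<forall>w\<in>V. \<Phi>' u w = 0" "linear \<alpha>'"
      "\<forall>u\<in>H. \<forall>w\<in>H. \<Phi>' u w = \<alpha>' (\<Omega> u w)" and u: "u \<in> V" for \<Phi>' \<alpha>' u
  proof -
    note bP = bilinear_ladd[OF P(1)] bilinear_radd[OF P(1)] bilinear_lmul[OF P(1)] bilinear_rmul[OF P(1)]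
      bilinear_lsub[OF P(1)] bilinear_rsub[OF P(1)]
    have sw: "\<Phi>' u w = - \<Phi>' w u" for u w
    proof -
      have "\<Phi>' (u + w) (u + w) = \<Phi>' u u + \<Phi>' u w + \<Phi>' w u + \<Phi>' w w" by (simp add: bP)
      then show ?thesis using P(2) by simp
    qed
    \<comment> \<open>The factor of proportionality, as \<Phi> is 1 on the pair \<open>c1\<close>,
      \<open>c2\<close>.\<close>
    let ?c = "\<Phi>' c1 c2"
    have inD: "w - (\<psi>1 w *\<^sub>R c1 + \<psi>2 w *\<^sub>R c2) \<in> D" if "w \<in> V" for w
      unfolding D using that c_V subspace_V psi_c by (simp add: subspace_diff subspace_add subspace_scale psi)
    have half: "\<Phi>' u w = \<psi>1 u * \<Phi>' c1 w + \<psi>2 u * \<Phi>' c2 w" if "u \<in> V" "w \<in> V" for u w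
    proof -
      have "\<Phi>' (u - (\<psi>1 u *\<^sub>R c1 + \<psi>2 u *\<^sub>R c2)) w = 0" using P(3) inD that by blast
      then show ?thesis by (simp add: bP)
    qed
    have proportional: "\<Phi>' u w = ?c * \<Phi> u w" if "u \<in> V" "w \<in> V" for u w
    proof -
      have "\<Phi>' c1 w = \<psi>2 w * ?c" using half[OF that(2) c_V(1)] P(2) sw[of c1 w] sw[of c2 c1] by simp
      moreover have "\<Phi>' c2 w = - \<psi>1 w * ?c" using half[OF that(2) c_V(2)] P(2) sw[of c2 w] by simp
      ultimately show ?thesis using half[OF that] by (simp add: \<Phi>_def algebra_simps)
    qed
    have "\<Phi>' k1 l2 = \<alpha>' F1" "\<Phi>' k2 l2 = \<alpha>' F2"
      using bspec[OF bspec[OF P(5) adapted_H(1)] adapted_H(4)] bspec[OF bspec[OF P(5) adapted_H(2)] adapted_H(4)]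
      by (simp_all only: curvature_adapted)
    then have F: "\<alpha>' F1 = ?c * \<Phi> k1 l2" "\<alpha>' F2 = ?c * \<Phi> k2 l2"
      using proportional adapted_V by auto
    have vV: "v \<in> V" using v by simp
    have "\<alpha>' (\<Omega> u v) = ?c * \<alpha> (\<Omega> u v)"
    proof -
      have "\<alpha>' (\<Omega> u v) = \<alpha>1 (\<Omega> u v) * \<alpha>' F1 + \<alpha>2 (\<Omega> u v) * \<alpha>' F2"
        by (subst expansion[OF u vV]) (simp add: linear_add[OF P(4)] linear_scale[OF P(4)])
      then show ?thesis unfolding F \<alpha>_def by (simp add: algebra_simps)
    qed
    moreover have "\<Phi> u v - \<alpha> (\<Omega> u v) = 0" using Phi_V[OF u vV] v by simp
    ultimately show ?thesis using proportional[OF u vV] by simp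
  qed
  then show "v \<in> conjugate_distribution \<Omega> V H D"
    using v unfolding conjugate_distribution_def by blast
qed

text \<open>Otherwise \<open>\<Phi> = \<alpha> \<circ> \<Omega>\<close>, which is not decomposable.\<close>

lemma zeta_nonzero: "\<zeta> l1 \<noteq> 0 \<or> \<zeta> l2 \<noteq> 0 \<or> \<zeta> k1 \<noteq> 0 \<or> \<zeta> k2 \<noteq> 0"
proof (rule ccontr)
  assume "\<not> ?thesis"
  then have z: "\<zeta> l1 = 0" "\<zeta> l2 = 0" "\<zeta> k1 = 0" "\<zeta> k2 = 0" by auto
  let ?A = "\<Phi> k1 l2" and ?B = "\<Phi> k2 l2" and ?s = "1 / \<phi> \<kappa>11"
  have s: "?s \<noteq> 0" using phi_nonzero by simp
  have n: "\<Phi> n l1 = ?s * ?A" "\<Phi> n l2 = 0" "\<Phi> n k1 = 0" "\<Phi> n k2 = 0"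
    using z unfolding \<zeta>_def curvature_adapted by (simp_all add: \<alpha>_def coords coord linear_0[OF linear_coord(1)] linear_0[OF linear_coord(2)])
  have k: "\<Phi> k1 l1 = ?B - a * ?A" "\<Phi> k2 l1 = - b * ?A" "\<Phi> k1 k2 = 0"
    using Phi_H[OF adapted_H(1,3)] Phi_H[OF adapted_H(2,3)] Phi_H[OF adapted_H(1,2)]
    unfolding curvature_adapted by (simp_all add: \<alpha>_def coords coord linear_0[OF linear_coord(1)] linear_0[OF linear_coord(2)])
  \<comment> \<open>The Pluecker relation satisfied by decomposable 2-forms. The quadruple
    \<open>n\<close>, \<open>k1\<close>, \<open>l1\<close>, \<open>l2\<close> gives
    \<open>?A = 0\<close>, and then \<open>k1\<close>, \<open>k2\<close>, \<open>l1\<close>,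
    \<open>l2\<close> gives \<open>?B = 0\<close>.\<close>
  have pl: "\<Phi> u v * \<Phi> w y - \<Phi> u w * \<Phi> v y + \<Phi> u y * \<Phi> v w = 0" for u v w y
    by (simp add: \<Phi>_def algebra_simps)
  have "?s * ?A * ?A = 0"
    using pl[of n k1 l1 l2] unfolding n k by simp
  then have A: "?A = 0" using s by simp
  have "?B * ?B = 0" using pl[of k1 k2 l1 l2] unfolding k A by simp
  then have B: "?B = 0" by simp
  have "\<Phi> u w = 0" if "u \<in> V" "w \<in> V" for u w
  proof -
    have H0: "\<zeta> h = 0" if "h \<in> H" for h
    proof -
      have sub: "subspace {h. \<zeta> h = 0}" by (rule linear_subspace_kernel[OF linear_zeta])
      have "span {l1, l2, k1, k2} \<subseteq> {h. \<zeta> h = 0}" using z sub by (intro span_minimal) auto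
      then show ?thesis using that H_span by blast
    qed
    have zeta0: "\<zeta> v = 0" if v: "v \<in> V" for v
    proof -
      obtain h where h: "h \<in> H" "v = h + \<phi> v *\<^sub>R n" using V_decomposition[OF v] .
      have "\<zeta> n = 0" by (simp add: \<zeta>_def Phi_self alternating linear_0[OF linear_alpha])
      then have "\<zeta> (h + \<phi> v *\<^sub>R n) = 0"
        using H0[OF h(1)] linear_add[OF linear_zeta] linear_scale[OF linear_zeta] by simp
      then show ?thesis using h(2) by simp
    qed
    show ?thesis using Phi_V[OF that] zeta0[OF that(1)] zeta0[OF that(2)] by (simp add: \<alpha>_def A B)
  qed
  from this[OF c_V] show False using psi_c by (simp add: \<Phi>_def)
qed

text \<open>On \<open>R\<close> the curvature vanishes, so \<Phi> and \<phi> \<and> \<zeta> take the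
  same value on a basis; by \<open>common_zero_plane\<close> this value is 0 exactly when
  \<open>R\<close> meets the respective common kernel. The plane is not assumed to lie in
  \<open>H\<close>.\<close>

lemma conjugate_distribution_meets:
  assumes R: "subspace R" "dim R = 2" "R \<subseteq> V" "\<And>u w. u \<in> R \<Longrightarrow> w \<in> R \<Longrightarrow> \<Omega> u w = 0"
  shows "R \<inter> conjugate_distribution \<Omega> V H D \<noteq> {0} \<longleftrightarrow> R \<inter> D \<noteq> {0}"
proof -
  obtain r s where rs: "R = span {r, s}" "indep2 r s" "r \<in> R" "s \<in> R" using dim2_basis[OF R(1,2)] .
  have V: "r \<in> V" "s \<in> V" using rs R(3) by auto
  have sub: "subspace D" unfolding D using subspace_V
    by (auto simp: subspace_def psi linear_0[OF linear_psi(1)] linear_0[OF linear_psi(2)])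
  have subc: "0 \<in> {v \<in> H. \<zeta> v = 0}" using subspace_0[OF subspace_H] linear_0[OF linear_zeta] by simp
  have "R \<inter> conjugate_distribution \<Omega> V H D \<noteq> {0} \<longleftrightarrow> (\<exists>t\<in>span {r, s}. t \<noteq> 0 \<and> \<phi> t = 0 \<and> \<zeta> t = 0)"
    unfolding conjugate_distribution_eq using subc subspace_0[OF R(1)] R(3) unfolding rs(1)[symmetric] by blast
  also have "\<dots> \<longleftrightarrow> \<phi> r * \<zeta> s - \<phi> s * \<zeta> r = 0"
    by (rule common_zero_plane[OF linear_phi linear_zeta rs(2), symmetric])
  also have "\<dots> \<longleftrightarrow> \<Phi> r s = 0"
    unfolding Phi_V[OF V, symmetric] R(4)[OF rs(3,4)] linear_0[OF linear_alpha] by simp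
  also have "\<dots> \<longleftrightarrow> (\<exists>t\<in>span {r, s}. t \<noteq> 0 \<and> \<psi>1 t = 0 \<and> \<psi>2 t = 0)"
    unfolding \<Phi>_def by (rule common_zero_plane[OF linear_psi rs(2)])
  also have "\<dots> \<longleftrightarrow> R \<inter> D \<noteq> {0}"
    unfolding D using subspace_0[OF sub] subspace_0[OF R(1)] R(3) unfolding rs(1)[symmetric] D by blast
  finally show ?thesis .
qed

text \<open>Elimination with pivot \<open>g0\<close>: the map \<open>f\<close> projects
  \<open>H\<close> onto the kernel of \<zeta> along \<open>g0\<close>. The order is left open
  because any of the four adapted vectors may have to be the pivot.\<close>

lemma kernel_frame:
  assumes g: "{g0, g1, g2, g3} = {l1, l2, k1, k2}" and nz: "\<zeta> g0 \<noteq> 0"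
  shows "conjugate_distribution \<Omega> V H D =
      span {g1 - (\<zeta> g1 / \<zeta> g0) *\<^sub>R g0, g2 - (\<zeta> g2 / \<zeta> g0) *\<^sub>R g0, g3 - (\<zeta> g3 / \<zeta> g0) *\<^sub>R g0}"
    and "dim (conjugate_distribution \<Omega> V H D) = 3"
proof -
  define K where "K = {v \<in> H. \<zeta> v = 0}"
  define f where "f v = v - (\<zeta> v / \<zeta> g0) *\<^sub>R g0" for v
  have "{g0, g1, g2, g3} \<subseteq> H" unfolding g using adapted_H by simp
  then have g0: "g0 \<in> H" and g123: "g1 \<in> H" "g2 \<in> H" "g3 \<in> H" by simp_all
  have subK: "subspace K" unfolding K_def using subspace_H linear_zeta
    by (auto simp: subspace_def linear_0 linear_add linear_scale)
  have fK: "f v \<in> K" if "v \<in> H" for v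
  proof -
    have "f v \<in> H" unfolding f_def using that g0 by (intro subspace_diff subspace_scale subspace_H)
    moreover have "\<zeta> (f v) = 0" unfolding f_def linear_diff[OF linear_zeta] linear_scale[OF linear_zeta] using nz by simp
    ultimately show ?thesis by (simp add: K_def)
  qed
  have lf: "linear f"
    unfolding f_def by (rule linearI) (simp_all add: linear_add[OF linear_zeta] linear_scale[OF linear_zeta]
        add_divide_distrib scaleR_diff_right algebra_simps)
  have "K = span {f g1, f g2, f g3}"
  proof
    show "span {f g1, f g2, f g3} \<subseteq> K" using fK g123 subK by (intro span_minimal) auto
    show "K \<subseteq> span {f g1, f g2, f g3}"
    proof
      fix v assume v: "v \<in> K"
      then have "f v = v" "v \<in> span {g0, g1, g2, g3}" using H_span g by (auto simp: K_def f_def)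
      then have "v \<in> f ` span {g0, g1, g2, g3}" by (metis image_eqI)
      then have "v \<in> span {f g0, f g1, f g2, f g3}" using linear_span_image[OF lf, of "{g0, g1, g2, g3}"] by simp
      moreover have "f g0 = 0" using nz by (simp add: f_def)
      ultimately show "v \<in> span {f g1, f g2, f g3}" by (simp add: span_insert_0)
    qed
  qed
  then show "conjugate_distribution \<Omega> V H D =
      span {g1 - (\<zeta> g1 / \<zeta> g0) *\<^sub>R g0, g2 - (\<zeta> g2 / \<zeta> g0) *\<^sub>R g0, g3 - (\<zeta> g3 / \<zeta> g0) *\<^sub>R g0}"
    unfolding conjugate_distribution_eq K_def f_def .
  have "H \<subseteq> span (insert g0 K)"
  proof
    fix v assume "v \<in> H"
    then have "f v \<in> K" by (rule fK)
    then have "f v + (\<zeta> v / \<zeta> g0) *\<^sub>R g0 \<in> span (insert g0 K)"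
      by (intro span_add span_scale) (auto intro: span_base)
    moreover have "v = f v + (\<zeta> v / \<zeta> g0) *\<^sub>R g0" by (simp add: f_def)
    ultimately show "v \<in> span (insert g0 K)" by simp
  qed
  moreover have "span (insert g0 K) \<subseteq> H" using g0 subspace_H by (intro span_minimal) (auto simp: K_def)
  ultimately have "dim (insert g0 K) = 4" using dim_H by (metis dim_span subset_antisym)
  moreover have "g0 \<notin> span K" unfolding span_eq_iff[THEN iffD2, OF subK] using nz by (simp add: K_def)
  ultimately show "dim (conjugate_distribution \<Omega> V H D) = 3"
    unfolding conjugate_distribution_eq K_def[symmetric] by (simp add: dim_insert)
qed

end

section \<open>Smooth frames of the Cartan distribution\<close>

lemma bounded_bilinear_curvature: "bounded_bilinear (curvature :: ('n::finite) space1 \<Rightarrow> _)"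
  using bilinear_curvature by (simp add: bilinear_conv_bounded_bilinear)

text \<open>Dual vectors chosen at \<open>m0\<close> are projected to the contact plane and then
  made normal to the moving plane; inverting their 2 by 2 pairing matrix restores duality at nearby
  points.\<close>

lemma (in prolong_chart) frame_exists:
  assumes m0: "m0 \<in> PM" "m0 \<in> W"
  obtains U F1 F2 w1 w2 where "open U" "m0 \<in> U" "U \<subseteq> W" "smooth_on U F1" "smooth_on U F2" "smooth_on U w1" "smooth_on U w2"
    "\<And>m. m \<in> PM \<Longrightarrow> m \<in> U \<Longrightarrow> prolong_point M C X \<rho> \<theta> r0 W R a1 a2 m (F1 m) (F2 m) (w1 m) (w2 m)"
proof -
  interpret p0: prolong_at M C X \<rho> \<theta> r0 W R a1 a2 m0 using m0 by unfold_locales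
  define v :: "nat \<Rightarrow> 'n space1 \<Rightarrow> real^'n" where "v = (\<lambda>i m. snd m *v (if i = 0 then a1 else a2))"
  have sv: "smooth_on W (v i)" for i unfolding v_def
    by (intro smooth_on_matrix_vector_mult smooth_snd_W smooth_on_const open_W)
  have ind: "v j m0 \<notin> span ((\<lambda>i. v i m0) ` {..<j})" if "j < 2" for j
  proof -
    have i: "v 0 m0 \<noteq> v 1 m0" "independent {v 0 m0, v 1 m0}" using indep2_independent[OF p0.indep_v] by (auto simp: v_def)
    have "j = 0 \<or> j = 1" using that by auto
    then show ?thesis
    proof
      assume "j = 0" then show ?thesis using i(2) dependent_zero[of "{v 0 m0, v 1 m0}"] by auto
    next
      assume j: "j = 1"
      have "v 1 m0 \<notin> span {v 0 m0}"
      proof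
        assume "v 1 m0 \<in> span {v 0 m0}"
        then obtain k where "v 1 m0 = k *\<^sub>R v 0 m0" by (auto simp: span_singleton)
        then show False using indep2D[OF p0.indep_v, of k "-1"] by (simp add: v_def)
      qed
      then show ?thesis using j by (simp add: lessThan_Suc)
    qed
  qed
  obtain U0 \<beta> where U0: "open U0" "m0 \<in> U0" "U0 \<subseteq> W" and s\<beta>: "\<And>i. i < 2 \<Longrightarrow> smooth_on U0 (\<beta> i)"
    and dual: "\<And>p i j. p \<in> U0 \<Longrightarrow> i < 2 \<Longrightarrow> j < 2 \<Longrightarrow> \<beta> i p \<bullet> v j p = (if i = j then 1 else 0)"
    using smooth_dual_frame[where b = v and k = 2, OF open_W m0(2) sv ind] by metis
  \<comment> \<open>Applying the self-adjoint projector moves the dual vectors into the plane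
    without changing their pairings with it.\<close>
  define w1 where "w1 m = snd m *v \<beta> 0 m" for m
  define w2 where "w2 m = snd m *v \<beta> 1 m" for m
  have ssnd: "smooth_on U0 snd" by (rule smooth_on_subset[OF smooth_snd_W U0(1,3)])
  have sw: "smooth_on U0 w1" "smooth_on U0 w2" unfolding w1_def w2_def
    by (intro smooth_on_matrix_vector_mult ssnd s\<beta>; simp)+
  obtain f g where fg: "f \<in> C (fst m0)" "g \<in> C (fst m0)" "d\<theta> (fst m0) (snd m0 *v a1) f = 1" "d\<theta> (fst m0) (snd m0 *v a2) f = 0"
    "d\<theta> (fst m0) (snd m0 *v a1) g = 0" "d\<theta> (fst m0) (snd m0 *v a2) g = 1"
    by (rule dual_vectors[OF p0.x_M p0.x_X p0.P_C p0.P_C p0.indep_v p0.P_isotropic])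
  define G1 where "G1 m = Q (\<rho> (fst m)) f - snd m *v Q (\<rho> (fst m)) f" for m :: "'n space1"
  define G2 where "G2 m = Q (\<rho> (fst m)) g - snd m *v Q (\<rho> (fst m)) g" for m :: "'n space1"
  have sG: "smooth_on W G1" "smooth_on W G2" unfolding G1_def G2_def
    by (intro smooth_on_diff smooth_on_matrix_vector_mult smooth_snd_W smooth_on_Q smooth_rho_fst rho_fst_X
        smooth_on_const open_W)+
  define q where "q i h m = d\<theta> (\<rho> (fst m)) (v i m) (h m)" for i and h :: "'n space1 \<Rightarrow> real^'n" and m :: "'n space1"
  have sq: "smooth_on W (q i h)" if "smooth_on W h" for i h unfolding q_def
    by (intro smooth_on_ext_deriv[OF smooth_theta smooth_rho_fst rho_fst_X] sv that)
  \<comment> \<open>The determinant of the pairing matrix, inverted below by Cramer's rule. It is 1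
    at \<open>m0\<close>, where \<open>f\<close>, \<open>g\<close> are dual to the frame of the
    plane.\<close>
  define \<delta> where "\<delta> m = q 0 G1 m * q 1 G2 m - q 0 G2 m * q 1 G1 m" for m
  have s\<delta>: "smooth_on W \<delta>" unfolding \<delta>_def by (intro smooth_on_diff smooth_on_mult sq sG)
  have on: "\<rho> (fst m) = fst m" "G1 m \<in> C (fst m)" "G2 m \<in> C (fst m)" "snd m *v G1 m = 0" "snd m *v G2 m = 0"
    if m: "m \<in> PM" "m \<in> W" for m
  proof -
    interpret p: prolong_at M C X \<rho> \<theta> r0 W R a1 a2 m using m by unfold_locales
    show r: "\<rho> (fst m) = fst m" by (rule rho_id[OF p.x_M p.x_X])
    show "G1 m \<in> C (fst m)" "G2 m \<in> C (fst m)" unfolding G1_def G2_def r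
      by (intro subspace_diff subspace_C Q_mem p.P_C p.x_M p.x_X)+
    show "snd m *v G1 m = 0" "snd m *v G2 m = 0" unfolding G1_def G2_def
      by (simp_all add: matrix_vector_mult_diff_distrib p.P_idem)
  qed
  have "\<delta> m0 = 1"
  proof -
    note bil = bilinear_dtheta[OF p0.x_X]
    have Qfg: "Q (fst m0) f = f" "Q (fst m0) g = g" using fg Q_id[OF p0.x_M p0.x_X] by auto
    show ?thesis unfolding \<delta>_def q_def v_def G1_def G2_def on(1)[OF m0] Qfg
      using fg p0.P_isotropic by (simp add: bilinear_rsub[OF bil])
  qed
  define U where "U = {m \<in> W. \<delta> m \<noteq> 0} \<inter> U0"
  have U: "open U" "m0 \<in> U" "U \<subseteq> W" "U \<subseteq> U0"
    using smooth_on_open_nonzero[OF s\<delta>] U0 m0 \<open>\<delta> m0 = 1\<close> by (auto simp: U_def)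
  define F1 where "F1 m = (1 / \<delta> m) *\<^sub>R (q 1 G2 m *\<^sub>R G1 m - q 1 G1 m *\<^sub>R G2 m)" for m
  define F2 where "F2 m = (1 / \<delta> m) *\<^sub>R (q 0 G1 m *\<^sub>R G2 m - q 0 G2 m *\<^sub>R G1 m)" for m
  have sF: "smooth_on U F1" "smooth_on U F2" unfolding F1_def F2_def
    by (intro smooth_on_scaleR smooth_on_diff smooth_on_divide smooth_on_const U(1)
        smooth_on_subset[OF s\<delta> U(1,3)] smooth_on_subset[OF sq U(1,3)] sG
        smooth_on_subset[OF sG(1) U(1,3)] smooth_on_subset[OF sG(2) U(1,3)]; simp add: U_def)+
  show ?thesis
  proof (rule that[OF U(1-3) sF smooth_on_subset[OF sw(1) U(1,4)] smooth_on_subset[OF sw(2) U(1,4)]])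
    fix m assume m: "m \<in> PM" "m \<in> U"
    then have mW: "m \<in> W" and m0': "m \<in> U0" and d: "\<delta> m \<noteq> 0" using U by (auto simp: U_def)
    interpret p: prolong_at M C X \<rho> \<theta> r0 W R a1 a2 m using m mW by unfold_locales
    note o = on[OF m(1) mW]
    note bil = bilinear_dtheta[OF p.x_X]
    have q0: "q 0 h m = d\<theta> (fst m) (snd m *v a1) (h m)" "q 1 h m = d\<theta> (fst m) (snd m *v a2) (h m)" for h
      by (simp_all add: q_def v_def o(1))
    have P: "(snd m *v u) \<bullet> u' = u \<bullet> (snd m *v u')" for u u' by (rule p.P_selfadjoint)
    have de: "q 1 G2 m * q 0 G1 m - q 1 G1 m * q 0 G2 m = \<delta> m" "q 0 G1 m * q 1 G2 m - q 0 G2 m * q 1 G1 m = \<delta> m"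
      by (simp_all add: \<delta>_def)
    show "prolong_point M C X \<rho> \<theta> r0 W R a1 a2 m (F1 m) (F2 m) (w1 m) (w2 m)"
    proof
      show "F1 m \<in> C (fst m)" "F2 m \<in> C (fst m)" unfolding F1_def F2_def
        by (intro subspace_scale subspace_diff subspace_C[OF p.x_M p.x_X] o)+
      show "snd m *v F1 m = 0" "snd m *v F2 m = 0" unfolding F1_def F2_def
        by (simp_all add: matrix_vector_mult_scaleR matrix_vector_mult_diff_distrib o)
      show "d\<theta> (fst m) (snd m *v a1) (F1 m) = 1" "d\<theta> (fst m) (snd m *v a2) (F1 m) = 0"
        "d\<theta> (fst m) (snd m *v a1) (F2 m) = 0" "d\<theta> (fst m) (snd m *v a2) (F2 m) = 1"
        unfolding F1_def F2_def bilinear_rsub[OF bil] bilinear_rmul[OF bil] q0[symmetric] real_scaleR_def de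
        using d by simp_all
      show "snd m *v w1 m = w1 m" "snd m *v w2 m = w2 m" by (simp_all add: w1_def w2_def p.P_idem)
      show "w1 m \<bullet> (snd m *v a1) = 1" "w1 m \<bullet> (snd m *v a2) = 0" "w2 m \<bullet> (snd m *v a1) = 0" "w2 m \<bullet> (snd m *v a2) = 1"
        using dual[OF m0', of 0 0] dual[OF m0', of 0 1] dual[OF m0', of 1 0] dual[OF m0', of 1 1]
        by (simp_all add: w1_def w2_def P p.P_idem v_def)
    qed
  qed
qed

section \<open>From points of the first prolongation to abstract curvature frames\<close>

context prolong_point
begin

lemma w_unique:
  assumes "P *v w = w"
  shows "w = (w \<bullet> v1) *\<^sub>R w1 + (w \<bullet> v2) *\<^sub>R w2"
proof -
  let ?d = "w - ((w \<bullet> v1) *\<^sub>R w1 + (w \<bullet> v2) *\<^sub>R w2)"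
  have "P *v ?d = ?d"
    by (simp add: assms Pw matrix_vector_mult_diff_distrib matrix_vector_right_distrib matrix_vector_mult_scaleR)
  then obtain p q where pq: "?d = p *\<^sub>R v1 + q *\<^sub>R v2" using P_span by metis
  have "?d \<bullet> v1 = 0" "?d \<bullet> v2 = 0" by (simp_all add: inner_diff_left inner_add_left w_dual)
  then have "?d \<bullet> (p *\<^sub>R v1 + q *\<^sub>R v2) = 0" by (simp only: inner_add_right inner_scaleR_right)
  then have "?d \<bullet> ?d = 0" unfolding pq[symmetric] .
  then show ?thesis by simp
qed

lemma curvature_frame:
  assumes "linear \<phi>" "\<phi> \<kappa>11 \<noteq> 0"
  shows "curvature_frame C1 curvature \<nu>1 \<nu>2 \<kappa>11 \<kappa>12 \<kappa>22 F1 F2 (d\<theta> x v1) (d\<theta> x v2) \<phi>"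
proof (rule curvature_frame.intro)
  show "C1 = span {\<nu>1, \<nu>2, \<kappa>11, \<kappa>12, \<kappa>22}" "dim C1 = 5" by (fact C1_span dim_C1)+
  show "linear (d\<theta> x v1)" "linear (d\<theta> x v2)"
    using bilinear_dtheta[OF x_X] unfolding bilinear_def by blast+
  show "curvature u w = d\<theta> x v1 (curvature u w) *\<^sub>R F1 + d\<theta> x v2 (curvature u w) *\<^sub>R F2"
    if "u \<in> C1" "w \<in> C1" for u w
    by (rule normal_expansion[OF curvature_mem[OF that]])
qed (fact bilinear_curvature curvature_self curvature_values F_dual assms)+

text \<open>Supplies the planes by which \<open>meets\<close> of \<open>radical_frame\<close> is
  later verified. Horizontality and independence follow from the independence of the base
  vectors.\<close>

lemma lagrangian_span:
  assumes L: "L1 \<in> C1" "L2 \<in> C1" "fst L1 = v1" "fst L2 = v2" "curvature L1 L2 = 0"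
  shows "lagrangian_plane2 M C m (span {L1, L2})"
proof -
  have fst_lin: "fst (p *\<^sub>R L1 + q *\<^sub>R L2) = p *\<^sub>R v1 + q *\<^sub>R v2" for p q using L by simp
  have zero: "p = 0 \<and> q = 0" if "fst (p *\<^sub>R L1 + q *\<^sub>R L2) = 0" for p q
    using that indep2D[OF indep_v] unfolding fst_lin by blast
  have i: "indep2 L1 L2" unfolding indep2_def using zero by (metis fst_zero)
  have sw: "curvature L2 L1 = 0" using L(5) by (simp add: curvature_def)
  have c: "curvature u w = 0" if "u \<in> span {L1, L2}" "w \<in> span {L1, L2}" for u w
    using that L(5) sw unfolding span2_iff
    by (auto simp: bilinear_ladd[OF bilinear_curvature] bilinear_radd[OF bilinear_curvature]
        bilinear_lmul[OF bilinear_curvature] bilinear_rmul[OF bilinear_curvature] curvature_self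
        simp del: scaleR_Pair)
  have h: "u = 0" if u: "u \<in> span {L1, L2}" "fst u = 0" for u
  proof -
    obtain p q where "u = p *\<^sub>R L1 + q *\<^sub>R L2" using u(1) unfolding span2_iff by blast
    with zero[of p q] u(2) show ?thesis by simp
  qed
  have "span {L1, L2} \<subseteq> C1" using L subspace_C1 by (intro span_minimal) auto
  then show ?thesis unfolding lagrangian_plane2_iff using dim_span2[OF i] c h by blast
qed

end

text \<open>A quadratic form which vanishes on \<open>\<kappa>11\<close> for every choice of basis vanishes.\<close>

lemma (in contact_chart) good_basis:
  assumes m0: "m0 \<in> prolong1 M C" "fst m0 \<in> X" and \<phi>: "linear \<phi>"
    and \<nu>: "\<nu> \<in> tangent_space (prolong1 M C) m0" "fst \<nu> = 0" "\<phi> \<nu> \<noteq> (0::real)"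
  obtains a1 a2 where "a1 \<in> plane1 m0" "a2 \<in> plane1 m0" "indep2 a1 a2"
    "\<And>F w. F \<in> C (fst m0) \<Longrightarrow> snd m0 *v F = 0 \<Longrightarrow> d\<theta> (fst m0) a1 F = 1 \<Longrightarrow> d\<theta> (fst m0) a2 F = 0 \<Longrightarrow>
      snd m0 *v w = w \<Longrightarrow> w \<bullet> a1 = 1 \<Longrightarrow> w \<bullet> a2 = 0 \<Longrightarrow> \<phi> (0, sym_prod F w) \<noteq> 0"
proof -
  have sub: "subspace (plane1 m0)"
    unfolding plane1_def by (metis matrix_vector_mul_linear linear_subspace_image subspace_UNIV)
  have "dim (plane1 m0) = 2" using m0 prolong1_iff by blast
  then obtain b1 b2 where b: "plane1 m0 = span {b1, b2}" "indep2 b1 b2" "b1 \<in> plane1 m0" "b2 \<in> plane1 m0"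
    using dim2_basis[OF sub] by metis
  obtain W R where W: "prolong_chart M C X \<rho> \<theta> r0 W R b1 b2" "m0 \<in> W"
    using prolong_chart_exists[OF m0 b(3,4,2)] by blast
  interpret pc: prolong_chart M C X \<rho> \<theta> r0 W R b1 b2 by (rule W(1))
  obtain F1 F2 w1 w2 where pp: "prolong_point M C X \<rho> \<theta> r0 W R b1 b2 m0 F1 F2 w1 w2"
    using pc.frame_exists[OF m0(1) W(2)] m0(1) by metis
  interpret p: prolong_point M C X \<rho> \<theta> r0 W R b1 b2 m0 F1 F2 w1 w2 by (rule pp)
  have Pb: "snd m0 *v b1 = b1" "snd m0 *v b2 = b2" using b(3,4) p.plane1_iff by auto
  have Fu: "F = d\<theta> (fst m0) b1 F *\<^sub>R F1 + d\<theta> (fst m0) b2 F *\<^sub>R F2" if "F \<in> C (fst m0)" "snd m0 *v F = 0" for F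
    using p.normal_expansion[OF that] unfolding Pb .
  have wu: "w = (w \<bullet> b1) *\<^sub>R w1 + (w \<bullet> b2) *\<^sub>R w2" if "snd m0 *v w = w" for w
    using p.w_unique[OF that] unfolding Pb .
  obtain s11 s12 s22 where "\<nu> = (0, p.sym_matrix s11 s12 s22)"
    using p.vertical_eq_sym_matrix[OF \<nu>(1,2)] by blast
  then have "\<nu> = s11 *\<^sub>R p.\<kappa>11 + s12 *\<^sub>R p.\<kappa>12 + s22 *\<^sub>R p.\<kappa>22" using p.sym_matrix_kappa by metis
  then have e: "\<phi> \<nu> = s11 * \<phi> p.\<kappa>11 + s12 * \<phi> p.\<kappa>12 + s22 * \<phi> p.\<kappa>22"
    by (simp add: linear_add[OF \<phi>] linear_scale[OF \<phi>] del: scaleR_Pair add_Pair)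
  \<comment> \<open>The first vertical vector is nonzero under \<phi> for the basis b1, b2, for the
    swapped basis, or for b1, b2 - b1: there the dual vectors are F1 + F2 and w1 + w2, so it is the
    sum of all three vertical vectors.\<close>
  consider "\<phi> p.\<kappa>11 \<noteq> 0" | "\<phi> p.\<kappa>22 \<noteq> 0" | "\<phi> p.\<kappa>11 = 0" "\<phi> p.\<kappa>22 = 0" "\<phi> p.\<kappa>12 \<noteq> 0"
    using e \<nu>(3) by fastforce
  then show ?thesis
  proof cases
    case 1
    show ?thesis
    proof (rule that[OF b(3,4,2)])
      fix F w assume "F \<in> C (fst m0)" "snd m0 *v F = 0" "d\<theta> (fst m0) b1 F = 1" "d\<theta> (fst m0) b2 F = 0"
        "snd m0 *v w = w" "w \<bullet> b1 = 1" "w \<bullet> b2 = 0"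
      then have "F = F1" "w = w1" using Fu[of F] wu[of w] by simp_all
      then show "\<phi> (0, sym_prod F w) \<noteq> 0" using 1 by simp
    qed
  next
    case 2
    have i: "indep2 b2 b1" by (rule indep2_commute[OF b(2)])
    show ?thesis
    proof (rule that[OF b(4,3) i])
      fix F w assume "F \<in> C (fst m0)" "snd m0 *v F = 0" "d\<theta> (fst m0) b2 F = 1" "d\<theta> (fst m0) b1 F = 0"
        "snd m0 *v w = w" "w \<bullet> b2 = 1" "w \<bullet> b1 = 0"
      then have "F = F2" "w = w2" using Fu[of F] wu[of w] by simp_all
      then show "\<phi> (0, sym_prod F w) \<noteq> 0" using 2 by simp
    qed
  next
    case 3
    have i: "indep2 b1 (b2 - b1)" unfolding indep2_def
    proof (intro allI impI)
      fix p q assume "p *\<^sub>R b1 + q *\<^sub>R (b2 - b1) = 0"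
      then have "(p - q) *\<^sub>R b1 + q *\<^sub>R b2 = 0" by (simp add: algebra_simps)
      from indep2D[OF b(2) this] show "p = 0 \<and> q = 0" by simp
    qed
    show ?thesis
    proof (rule that[OF b(3) subspace_diff[OF sub b(4,3)] i])
      fix F w assume F: "F \<in> C (fst m0)" "snd m0 *v F = 0" "d\<theta> (fst m0) b1 F = 1" "d\<theta> (fst m0) (b2 - b1) F = 0"
        and w: "snd m0 *v w = w" "w \<bullet> b1 = 1" "w \<bullet> (b2 - b1) = 0"
      have "F = F1 + F2" "w = w1 + w2"
        using Fu[of F] wu[of w] F w by (simp_all add: inner_diff_right bilinear_lsub[OF bilinear_dtheta[OF p.x_X]])
      moreover have "sym_prod (F1 + F2) (w1 + w2) = sym_prod F1 w1 + (sym_prod F2 w1 + sym_prod F1 w2) + sym_prod F2 w2"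
        by (simp add: matrix_eq matrix_vector_mult_add_rdistrib sym_prod_mult inner_add_left algebra_simps)
      ultimately have "(0, sym_prod F w) = p.\<kappa>11 + p.\<kappa>12 + p.\<kappa>22" by simp
      then have "\<phi> (0, sym_prod F w) = \<phi> p.\<kappa>11 + \<phi> p.\<kappa>12 + \<phi> p.\<kappa>22"
        by (simp add: linear_add[OF \<phi>] del: add_Pair)
      then show "\<phi> (0, sym_prod F w) \<noteq> 0" using 3 by simp
    qed
  qed
qed

text \<open>The complement is taken from the spanning set \<open>B\<close> because its members will
  be values of smooth fields that remain in the Cartan distribution nearby. The successive
  non-membership claims have the form asked for by \<open>smooth_dual_frame\<close>.\<close>

lemma extend_frame:
  fixes X Y Z :: "'a::euclidean_space"
  assumes D: "dim (span {X, Y, Z}) = 3" and V: "V = span B" "dim V = 5"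
  obtains c1 c2 where "c1 \<in> B" "c2 \<in> B" "X \<noteq> 0" "Y \<notin> span {X}" "Z \<notin> span {X, Y}"
    "c1 \<notin> span {X, Y, Z}" "c2 \<notin> span {X, Y, Z, c1}"
proof -
  have d3: "dim {Z, Y, X} = 3" using D by (simp add: insert_commute)
  have Z: "Z \<notin> span {Y, X}"
  proof
    assume "Z \<in> span {Y, X}"
    then have "dim {Z, Y, X} = dim {Y, X}" by (simp add: dim_insert)
    also have "\<dots> \<le> 2" by (simp add: dim_insert dim_singleton)
    finally show False using d3 by simp
  qed
  then have d2: "dim {Y, X} = 2" using d3 by (simp add: dim_insert[of Z])
  have Y: "Y \<notin> span {X}"
  proof
    assume "Y \<in> span {X}"
    then have "dim {Y, X} = dim {X}" by (simp add: dim_insert)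
    also have "\<dots> \<le> 1" by (simp add: dim_singleton)
    finally show False using d2 by simp
  qed
  then have d1: "dim {X} = 1" using d2 by (simp add: dim_insert[of Y])
  then have X: "X \<noteq> 0" by (auto simp: dim_singleton)
  have "\<not> B \<subseteq> span {X, Y, Z}"
  proof
    assume "B \<subseteq> span {X, Y, Z}"
    then have "V \<subseteq> span {X, Y, Z}" unfolding V(1) by (rule span_minimal) simp
    then show False using dim_subset[of V "span {X, Y, Z}"] D V(2) by simp
  qed
  then obtain c1 where c1: "c1 \<in> B" "c1 \<notin> span {X, Y, Z}" by blast
  then have d4: "dim (insert c1 {X, Y, Z}) = 4" using D by (simp add: dim_insert)
  have "\<not> B \<subseteq> span {X, Y, Z, c1}"
  proof
    assume "B \<subseteq> span {X, Y, Z, c1}"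
    then have "V \<subseteq> span {X, Y, Z, c1}" unfolding V(1) by (rule span_minimal) simp
    moreover have "{X, Y, Z, c1} = insert c1 {X, Y, Z}" by auto
    ultimately have "dim V \<le> dim (span (insert c1 {X, Y, Z}))" using dim_subset by metis
    then show False using d4 V(2) by simp
  qed
  then obtain c2 where "c2 \<in> B" "c2 \<notin> span {X, Y, Z, c1}" by blast
  moreover have "{Y, X} = {X, Y}" by auto
  ultimately show ?thesis using that c1 X Y Z by metis
qed

text \<open>\<open>D\<close> lies in the common kernel, and \<open>c1\<close>, \<open>c2\<close>
  raise the dimension of that kernel by two inside a 5-dimensional space, so both have dimension
  3.\<close>

lemma kernel_of_dual_functionals:
  fixes V D :: "'a::euclidean_space set"
  assumes V: "subspace V" "dim V = 5" and D: "subspace D" "D \<subseteq> V" "dim D = 3"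
    and \<psi>: "linear \<psi>1" "linear \<psi>2" "\<And>u. u \<in> D \<Longrightarrow> \<psi>1 u = (0::real)" "\<And>u. u \<in> D \<Longrightarrow> \<psi>2 u = (0::real)"
    and c: "c1 \<in> V" "c2 \<in> V" "\<psi>1 c1 = 1" "\<psi>1 c2 = 0" "\<psi>2 c1 = 0" "\<psi>2 c2 = 1"
  shows "D = {v \<in> V. \<psi>1 v = 0 \<and> \<psi>2 v = 0}"
proof -
  let ?K = "{v \<in> V. \<psi>1 v = 0 \<and> \<psi>2 v = 0}"
  have K: "subspace ?K" using V(1) \<psi>(1,2) by (auto simp: subspace_def linear_0 linear_add linear_scale)
  have s2: "\<psi>1 v = 0" if "v \<in> span (insert c2 ?K)" for v
  proof -
    have "subspace {v. \<psi>1 v = 0}" by (rule linear_subspace_kernel[OF \<psi>(1)])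
    then have "span (insert c2 ?K) \<subseteq> {v. \<psi>1 v = 0}" using c by (intro span_minimal) auto
    then show ?thesis using that by blast
  qed
  have "c2 \<notin> span ?K" unfolding span_eq_iff[THEN iffD2, OF K] using c by simp
  then have "dim (insert c2 ?K) = dim ?K + 1" by (simp add: dim_insert)
  moreover have "c1 \<notin> span (insert c2 ?K)" using s2 c(3) by fastforce
  then have "dim (insert c1 (insert c2 ?K)) = dim (insert c2 ?K) + 1" by (simp add: dim_insert)
  moreover have "dim (insert c1 (insert c2 ?K)) \<le> dim V" using c by (intro dim_subset) auto
  ultimately have "dim ?K \<le> dim D" using V(2) D(3) by simp
  moreover have "D \<subseteq> ?K" using D(2) \<psi> by auto
  ultimately show ?thesis by (intro subspace_dim_equal[OF D(1) K])
qed

section \<open>Intermediate integrals\<close>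

lemma smooth_fun_extension:
  assumes "smooth_fun A f" "x \<in> A"
  obtains U g where "x \<in> U" "smooth_on U g" "\<forall>y\<in>A \<inter> U. g y = f y"
proof -
  have "\<exists>U g. x \<in> U \<and> smooth_on U g \<and> (\<forall>y\<in>A \<inter> U. g y = f y)"
    using assms(1)[unfolded smooth_fun_def] assms(2) by (rule bspec)
  then show ?thesis by (elim exE conjE) (rule that)
qed

lemma prolong2_lagrangian: "z \<in> prolong2 M C \<Longrightarrow> fst z \<in> prolong1 M C \<and> lagrangian_plane2 M C (fst z) (plane2 z)"
  by (auto simp: prolong2_def)

lemma prolong_point_exists:
  fixes M :: "(real^'n::finite) set"
  assumes M: "contact_manifold5 M C" and m: "m \<in> prolong1 M C"
  obtains X \<rho> \<theta> r0 W R a1 a2 F1 F2 w1 w2 where "prolong_point M C X \<rho> \<theta> r0 W R a1 a2 m F1 F2 w1 w2"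
proof -
  have "fst m \<in> M" using m by (auto simp: prolong1_def)
  then obtain X \<rho> \<theta> r0 where c: "contact_chart M C X \<rho> \<theta> r0" "fst m \<in> X"
    using contact_chart_exists[OF M] by metis
  interpret c: contact_chart M C X \<rho> \<theta> r0 by (rule c(1))
  have "subspace (plane1 m)"
    unfolding plane1_def by (metis matrix_vector_mul_linear linear_subspace_image subspace_UNIV)
  moreover have "dim (plane1 m) = 2" using m c.prolong1_iff[OF c(2)] by blast
  ultimately obtain b1 b2 where b: "b1 \<in> plane1 m" "b2 \<in> plane1 m" "indep2 b1 b2" using dim2_basis by metis
  obtain W R where W: "prolong_chart M C X \<rho> \<theta> r0 W R b1 b2" "m \<in> W"
    using c.prolong_chart_exists[OF m c(2) b] by blast
  then show ?thesis using prolong_chart.frame_exists[OF W(1) m W(2)] m that by metis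
qed

lemma level_prolongation_meets:
  fixes M :: "(real^'n::finite) set"
  assumes M: "contact_manifold5 M C" and N: "openin (top_of_set (prolong1 M C)) N"
    and f: "smooth_fun N f" and ns: "nonsingular_at M C N f (fst z)"
    and z: "z \<in> prolong2 M C" "fst z \<in> N" "\<And>\<nu>. \<nu> \<in> plane2 z \<Longrightarrow> differential N f (fst z) \<nu> = 0"
    and D: "subspace D" "dim D = 3" "D \<subseteq> cartan1 M C (fst z)" "\<And>\<nu>. \<nu> \<in> D \<Longrightarrow> differential N f (fst z) \<nu> = 0"
  shows "plane2 z \<inter> D \<noteq> {0}"
proof
  assume triv: "plane2 z \<inter> D = {0}"
  define m where "m = fst z"
  have m: "m \<in> prolong1 M C" "m \<in> N" and lag: "lagrangian_plane2 M C m (plane2 z)"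
    using prolong2_lagrangian[OF z(1)] z(2) by (auto simp: m_def)
  obtain U g where g0: "m \<in> U" "smooth_on U g" "\<forall>y\<in>N \<inter> U. g y = f y"
    by (rule smooth_fun_extension[OF f m(2)])
  note g = g0(1,2) bspec[OF g0(3)]
  let ?\<phi> = "frechet_derivative g (at m)"
  have df: "differential N f m \<nu> = ?\<phi> \<nu>" if "\<nu> \<in> tangent_space (prolong1 M C) m" for \<nu>
    by (rule differential_eq[OF N m(2) g(2,1,3) that])
  have lin: "linear ?\<phi>" by (rule smooth_on_linear_derivative[OF g(2,1)])
  obtain X \<rho> \<theta> r0 W R a1 a2 F1 F2 w1 w2 where pp: "prolong_point M C X \<rho> \<theta> r0 W R a1 a2 m F1 F2 w1 w2"
    using prolong_point_exists[OF M m(1)] by blast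
  interpret p: prolong_point M C X \<rho> \<theta> r0 W R a1 a2 m F1 F2 w1 w2 by (rule pp)
  have T: "\<nu> \<in> tangent_space (prolong1 M C) m" if "\<nu> \<in> cartan1 M C m" for \<nu> using that p.C1_iff by blast
  obtain \<nu> where "\<nu> \<in> tangent_space (prolong1 M C) m" "fst \<nu> = 0" "differential N f m \<nu> \<noteq> 0"
    using ns unfolding nonsingular_at_def m_def[symmetric] by blast
  then have \<nu>: "\<nu> \<in> tangent_space (prolong1 M C) m" "fst \<nu> = 0" "?\<phi> \<nu> \<noteq> 0" using df by simp_all
  let ?H = "{\<nu> \<in> cartan1 M C m. ?\<phi> \<nu> = 0}"
  have subH: "subspace ?H" using p.subspace_C1 lin
    by (auto simp: subspace_def linear_0 linear_add linear_scale)
  \<comment> \<open>Vertical vectors lie in the Cartan distribution, so nonsingularity makes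
    \<open>?H\<close> a proper subspace, of dimension at most 4.\<close>
  have "\<nu> \<in> cartan1 M C m" using \<nu> p.C1_iff by simp
  then have "?H \<subset> cartan1 M C m" using \<nu>(3) by blast
  then have "span ?H \<subset> span (cartan1 M C m)"
    unfolding span_eq_iff[THEN iffD2, OF subH] span_eq_iff[THEN iffD2, OF p.subspace_C1] .
  from dim_psubset[OF this] have dimH: "dim ?H \<le> 4" using p.dim_C1 by simp
  have L: "subspace (plane2 z)" "dim (plane2 z) = 2" "plane2 z \<subseteq> cartan1 M C m"
    using lag[unfolded p.lagrangian_plane2_iff] by simp_all
  have inH: "plane2 z \<subseteq> ?H" "D \<subseteq> ?H"
    using L(3) z(3) D(3,4) df T unfolding m_def[symmetric] by (auto simp: subset_iff)
  have "dim {x + y |x y. x \<in> plane2 z \<and> y \<in> D} + dim (plane2 z \<inter> D) = dim (plane2 z) + dim D"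
    by (rule dim_sums_Int[OF L(1) D(1)])
  then have "dim {x + y |x y. x \<in> plane2 z \<and> y \<in> D} = 5" using triv L(2) D(2) by simp
  moreover have "{x + y |x y. x \<in> plane2 z \<and> y \<in> D} \<subseteq> ?H"
    using inH subspace_add[OF subH] by blast
  then have "dim {x + y |x y. x \<in> plane2 z \<and> y \<in> D} \<le> dim ?H" by (rule dim_subset)
  ultimately show False using dimH by simp
qed

text \<open>All choices (basis, complement of \<open>D\<close>, pivots) are made at
  \<open>m0\<close> and extended smoothly; at each point of \<open>N\<close> nearby they form a
  \<open>radical_frame\<close>. The space \<open>E m\<close> itself depends on none of them, so the
  local results can be combined.\<close>

lemma local_conjugate_distribution:
  fixes M :: "(real^'n::finite) set" and f :: "'n space1 \<Rightarrow> real"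
  assumes M: "contact_manifold5 M C" and N: "openin (top_of_set (prolong1 M C)) N"
    and f: "smooth_fun N f" and m0: "m0 \<in> N" and ns: "nonsingular_at M C N f m0"
    and D: "subdistribution3 M C (prolong1 M C) D"
    and meets: "\<And>z. z \<in> prolong2 M C \<Longrightarrow> fst z \<in> N \<Longrightarrow> (\<And>\<nu>. \<nu> \<in> plane2 z \<Longrightarrow> differential N f (fst z) \<nu> = 0) \<Longrightarrow>
      plane2 z \<inter> D (fst z) \<noteq> {0}"
  defines "E m \<equiv> conjugate_distribution curvature (cartan1 M C m)
      {\<nu> \<in> cartan1 M C m. differential N f m \<nu> = 0} (D m)"
  obtains U X Y Z where "m0 \<in> U" "smooth_on U X" "smooth_on U Y" "smooth_on U Z"
    "\<And>m. m \<in> N \<Longrightarrow> m \<in> U \<Longrightarrow> E m = span {X m, Y m, Z m}"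
    "\<And>m. m \<in> N \<Longrightarrow> m \<in> U \<Longrightarrow> dim (E m) = 3"
    "\<And>z. z \<in> prolong2 M C \<Longrightarrow> fst z \<in> N \<Longrightarrow> fst z \<in> U \<Longrightarrow>
      plane2 z \<inter> E (fst z) \<noteq> {0} \<longleftrightarrow> plane2 z \<inter> D (fst z) \<noteq> {0}"
proof -
  have NP: "N \<subseteq> prolong1 M C" using N openin_imp_subset by blast
  then have m0P: "m0 \<in> prolong1 M C" using m0 by blast
  then have "fst m0 \<in> M" by (auto simp: prolong1_def)
  then obtain X \<rho> \<theta> r0 where c: "contact_chart M C X \<rho> \<theta> r0" "fst m0 \<in> X"
    using contact_chart_exists[OF M] by metis
  interpret c: contact_chart M C X \<rho> \<theta> r0 by (rule c(1))
  obtain U3 g where g0: "m0 \<in> U3" "smooth_on U3 g" "\<forall>y\<in>N \<inter> U3. g y = f y"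
    by (rule smooth_fun_extension[OF f m0])
  note g = g0(1,2) bspec[OF g0(3)]
  define \<phi> where "\<phi> m = frechet_derivative g (at m)" for m
  have df: "differential N f m \<nu> = \<phi> m \<nu>" if "m \<in> N" "m \<in> U3" "\<nu> \<in> tangent_space (prolong1 M C) m" for m \<nu>
    unfolding \<phi>_def by (rule differential_eq[OF N that(1) g(2) that(2) g(3) that(3)])
  have lin\<phi>: "linear (\<phi> m)" if "m \<in> U3" for m
    unfolding \<phi>_def by (rule smooth_on_linear_derivative[OF g(2) that])
  obtain \<nu> where "\<nu> \<in> tangent_space (prolong1 M C) m0" "fst \<nu> = 0" "differential N f m0 \<nu> \<noteq> 0"
    using ns unfolding nonsingular_at_def by blast
  then have \<nu>: "\<nu> \<in> tangent_space (prolong1 M C) m0" "fst \<nu> = 0" "\<phi> m0 \<nu> \<noteq> 0"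
    using df[OF m0 g(1)] by simp_all
  \<comment> \<open>Chosen before the chart, so that the vector \<kappa>11 of the resulting frame
    has nonzero df at \<open>m0\<close> and hence in a neighbourhood.\<close>
  obtain a1 a2 where a: "a1 \<in> plane1 m0" "a2 \<in> plane1 m0" "indep2 a1 a2"
    and good: "\<And>F w. F \<in> C (fst m0) \<Longrightarrow> snd m0 *v F = 0 \<Longrightarrow> ext_deriv \<theta> (fst m0) a1 F = 1 \<Longrightarrow>
      ext_deriv \<theta> (fst m0) a2 F = 0 \<Longrightarrow>
      snd m0 *v w = w \<Longrightarrow> w \<bullet> a1 = 1 \<Longrightarrow> w \<bullet> a2 = 0 \<Longrightarrow> \<phi> m0 (0, sym_prod F w) \<noteq> 0"
    using c.good_basis[OF m0P c(2) lin\<phi>[OF g(1)] \<nu>] by metis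
  obtain W R where W: "prolong_chart M C X \<rho> \<theta> r0 W R a1 a2" "m0 \<in> W"
    using c.prolong_chart_exists[OF m0P c(2) a] by blast
  interpret pc: prolong_chart M C X \<rho> \<theta> r0 W R a1 a2 by (rule W(1))
  obtain U1 F1 F2 w1 w2 where U1: "open U1" "m0 \<in> U1" "U1 \<subseteq> W" and s1: "smooth_on U1 F1" "smooth_on U1 F2"
      "smooth_on U1 w1" "smooth_on U1 w2"
    and pp: "\<And>m. m \<in> prolong1 M C \<Longrightarrow> m \<in> U1 \<Longrightarrow> prolong_point M C X \<rho> \<theta> r0 W R a1 a2 m (F1 m) (F2 m) (w1 m) (w2 m)"
    using pc.frame_exists[OF m0P W(2)] by metis
  obtain U2 D1 D2 D3 where U2: "m0 \<in> U2" "smooth_on U2 D1" "smooth_on U2 D2" "smooth_on U2 D3"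
    "\<And>y. y \<in> prolong1 M C \<inter> U2 \<Longrightarrow> D y = span {D1 y, D2 y, D3 y}"
    using D m0P unfolding subdistribution3_def by metis
  define U where "U = U1 \<inter> U2 \<inter> U3"
  have U: "open U" "m0 \<in> U" "U \<subseteq> U1" "U \<subseteq> U2" "U \<subseteq> U3" "U \<subseteq> W"
    using U1 U2 g smooth_on_open[OF U2(2)] smooth_on_open[OF g(2)] by (auto simp: U_def)
  define v1 where "v1 = (\<lambda>m::'n space1. snd m *v a1)"
  define v2 where "v2 = (\<lambda>m::'n space1. snd m *v a2)"
  define \<nu>1 where "\<nu>1 = (\<lambda>m. frechet_derivative R (at m) (v1 m, 0))"
  define \<nu>2 where "\<nu>2 = (\<lambda>m. frechet_derivative R (at m) (v2 m, 0))"
  define \<kappa>11 where "\<kappa>11 = (\<lambda>m. (0::real^'n, sym_prod (F1 m) (w1 m)))"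
  define \<kappa>12 where "\<kappa>12 = (\<lambda>m. (0::real^'n, sym_prod (F2 m) (w1 m) + sym_prod (F1 m) (w2 m)))"
  define \<kappa>22 where "\<kappa>22 = (\<lambda>m. (0::real^'n, sym_prod (F2 m) (w2 m)))"
  note frame_defs = v1_def v2_def \<nu>1_def \<nu>2_def \<kappa>11_def \<kappa>12_def \<kappa>22_def
  have sv: "smooth_on U v1" "smooth_on U v2" unfolding v1_def v2_def
    by (intro smooth_on_matrix_vector_mult smooth_on_subset[OF pc.smooth_snd_W U(1,6)] smooth_on_const U(1))+
  have s\<nu>: "smooth_on U \<nu>1" "smooth_on U \<nu>2" unfolding \<nu>1_def \<nu>2_def using U(6)
    by (intro smooth_on_derivative_apply[OF pc.smooth_R] smooth_on_id smooth_on_Pair sv smooth_on_const U(1); simp)+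
  have sF: "smooth_on U F1" "smooth_on U F2" "smooth_on U w1" "smooth_on U w2"
    using s1 smooth_on_subset U(1,3) by blast+
  have s\<kappa>: "smooth_on U \<kappa>11" "smooth_on U \<kappa>12" "smooth_on U \<kappa>22" unfolding \<kappa>11_def \<kappa>12_def \<kappa>22_def
    by (intro smooth_on_Pair smooth_on_add smooth_on_const smooth_on_sym_prod sF U(1))+
  have s\<phi>: "smooth_on S (\<lambda>m. \<phi> m (h m))" if "smooth_on S h" "S \<subseteq> U" for S h
    unfolding \<phi>_def using that U(5) smooth_on_open[OF that(1)]
    by (intro smooth_on_derivative_apply[OF g(2)] smooth_on_id) auto
  have cartan: "cartan1 M C m = span {\<nu>1 m, \<nu>2 m, \<kappa>11 m, \<kappa>12 m, \<kappa>22 m}" "dim (cartan1 M C m) = 5"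
    if "m \<in> prolong1 M C" "m \<in> U" for m
  proof -
    interpret p: prolong_point M C X \<rho> \<theta> r0 W R a1 a2 m "F1 m" "F2 m" "w1 m" "w2 m" using that U by (intro pp) auto
    show "cartan1 M C m = span {\<nu>1 m, \<nu>2 m, \<kappa>11 m, \<kappa>12 m, \<kappa>22 m}" "dim (cartan1 M C m) = 5"
      using p.C1_span p.dim_C1 by (simp_all only: frame_defs)
  qed
  have dimD: "dim (D m) = 3" "D m \<subseteq> cartan1 M C m" if "m \<in> prolong1 M C" for m
    using D that unfolding subdistribution3_def by blast+
  have Dspan: "D m = span {D1 m, D2 m, D3 m}" if "m \<in> prolong1 M C" "m \<in> U" for m
    using U2(5) that U(4) by blast
  have "dim (span {D1 m0, D2 m0, D3 m0}) = 3" using dimD(1)[OF m0P] Dspan[OF m0P U(2)] by simp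
  from extend_frame[OF this cartan[OF m0P U(2)]] obtain d1 d2 where
    d: "d1 \<in> {\<nu>1 m0, \<nu>2 m0, \<kappa>11 m0, \<kappa>12 m0, \<kappa>22 m0}" "d2 \<in> {\<nu>1 m0, \<nu>2 m0, \<kappa>11 m0, \<kappa>12 m0, \<kappa>22 m0}"
    "D1 m0 \<noteq> 0" "D2 m0 \<notin> span {D1 m0}" "D3 m0 \<notin> span {D1 m0, D2 m0}" "d1 \<notin> span {D1 m0, D2 m0, D3 m0}"
    "d2 \<notin> span {D1 m0, D2 m0, D3 m0, d1}" by metis
  obtain c1 where c1: "c1 \<in> {\<nu>1, \<nu>2, \<kappa>11, \<kappa>12, \<kappa>22}" "c1 m0 = d1" using d(1) by blast
  obtain c2 where c2: "c2 \<in> {\<nu>1, \<nu>2, \<kappa>11, \<kappa>12, \<kappa>22}" "c2 m0 = d2" using d(2) by blast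
  have sc: "smooth_on U c1" "smooth_on U c2" using c1(1) c2(1) s\<nu> s\<kappa> by auto
  have c_mem: "c1 m \<in> cartan1 M C m" "c2 m \<in> cartan1 M C m" if "m \<in> prolong1 M C" "m \<in> U" for m
    unfolding cartan(1)[OF that] using c1(1) c2(1) by (auto intro!: span_base)
  \<comment> \<open>The frame of \<open>D\<close> comes first and the complement last, so the last
    two dual vectors annihilate \<open>D\<close> and serve as \<psi>1, \<psi>2.\<close>
  define b where "b i = [D1, D2, D3, c1, c2] ! i" for i
  have b5: "b 0 = D1" "b 1 = D2" "b 2 = D3" "b 3 = c1" "b 4 = c2" by (simp_all add: b_def numeral_2_eq_2 numeral_3_eq_3 numeral_Bit0)
  have lt5: "i < 5 \<longleftrightarrow> i = 0 \<or> i = 1 \<or> i = 2 \<or> i = 3 \<or> i = (4::nat)" for i by auto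
  have sb: "smooth_on U (b i)" if "i < 5" for i
    using that sc smooth_on_subset[OF U2(2) U(1,4)] smooth_on_subset[OF U2(3) U(1,4)] smooth_on_subset[OF U2(4) U(1,4)]
    unfolding lt5 using b5 by metis
  have ind: "b j m0 \<notin> span ((\<lambda>i. b i m0) ` {..<j})" if "j < 5" for j
  proof -
    have sets: "{..<1::nat} = {0}" "{..<2::nat} = {0, 1}" "{..<3::nat} = {0, 1, 2}" "{..<4::nat} = {0, 1, 2, 3}" by auto
    show ?thesis using that d(3-7) unfolding lt5
      by (elim disjE) (simp_all only: sets image_insert image_empty b5 c1(2) c2(2) lessThan_0 span_empty singleton_iff not_False_eq_True)
  qed
  obtain U5 \<beta> where U5: "open U5" "m0 \<in> U5" "U5 \<subseteq> U" and s\<beta>: "\<And>i. i < 5 \<Longrightarrow> smooth_on U5 (\<beta> i)"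
    and dual: "\<And>p i j. p \<in> U5 \<Longrightarrow> i < 5 \<Longrightarrow> j < 5 \<Longrightarrow> \<beta> i p \<bullet> b j p = (if i = j then 1 else 0)"
    using smooth_dual_frame[where b = b and k = 5, OF U(1,2) sb ind] by metis
  define \<psi>1 where "\<psi>1 m v = \<beta> 3 m \<bullet> v" for m v
  define \<psi>2 where "\<psi>2 m v = \<beta> 4 m \<bullet> v" for m v
  have lin\<psi>: "linear (\<psi>1 m)" "linear (\<psi>2 m)" for m
    unfolding \<psi>1_def \<psi>2_def by (rule bounded_linear.linear, rule bounded_linear_inner_right)+
  have \<psi>c: "\<psi>1 m (c1 m) = 1" "\<psi>1 m (c2 m) = 0" "\<psi>2 m (c1 m) = 0" "\<psi>2 m (c2 m) = 1" if "m \<in> U5" for m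
    using dual[OF that, of 3 3] dual[OF that, of 3 4] dual[OF that, of 4 3] dual[OF that, of 4 4]
    by (simp_all add: \<psi>1_def \<psi>2_def b5)
  have \<psi>D: "\<psi>1 m u = 0" "\<psi>2 m u = 0" if "m \<in> U5" "u \<in> span {D1 m, D2 m, D3 m}" for m u
  proof -
    have "subspace {u. \<psi>1 m u = 0 \<and> \<psi>2 m u = 0}"
      using lin\<psi> by (auto simp: subspace_def linear_0 linear_add linear_scale)
    moreover have "{D1 m, D2 m, D3 m} \<subseteq> {u. \<psi>1 m u = 0 \<and> \<psi>2 m u = 0}"
      using dual[OF that(1), of 3 0] dual[OF that(1), of 3 1] dual[OF that(1), of 3 2]
        dual[OF that(1), of 4 0] dual[OF that(1), of 4 1] dual[OF that(1), of 4 2]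
      by (simp add: \<psi>1_def \<psi>2_def b5 b5(2)[unfolded One_nat_def])
    ultimately show "\<psi>1 m u = 0" "\<psi>2 m u = 0" using that(2) span_minimal by blast+
  qed
  define U6 where "U6 = {m \<in> U5. \<phi> m (\<kappa>11 m) \<noteq> 0}"
  have "\<phi> m0 (\<kappa>11 m0) \<noteq> 0"
  proof -
    interpret p: prolong_point M C X \<rho> \<theta> r0 W R a1 a2 m0 "F1 m0" "F2 m0" "w1 m0" "w2 m0" using m0P U1 by (intro pp) auto
    have "snd m0 *v a1 = a1" "snd m0 *v a2 = a2" using a(1,2) p.plane1_iff by auto
    then show ?thesis unfolding \<kappa>11_def using p.F_C p.PF p.F_dual p.Pw p.w_dual by (intro good) simp_all
  qed
  moreover have "open U6" unfolding U6_def
    by (intro smooth_on_open_nonzero s\<phi> smooth_on_subset[OF s\<kappa>(1) U5(1,3)] U5)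
  ultimately have U6: "open U6" "m0 \<in> U6" "U6 \<subseteq> U" "U6 \<subseteq> U5" using U5 by (auto simp: U6_def)
  define e where "e m = \<phi> m (\<kappa>11 m)" for m
  define n where "n m = (1 / e m) *\<^sub>R \<kappa>11 m" for m
  define k1 where "k1 m = \<kappa>12 m - (\<phi> m (\<kappa>12 m) / e m) *\<^sub>R \<kappa>11 m" for m
  define k2 where "k2 m = \<kappa>22 m - (\<phi> m (\<kappa>22 m) / e m) *\<^sub>R \<kappa>11 m" for m
  define l1 where "l1 m = \<nu>1 m - (\<phi> m (\<nu>1 m) / e m) *\<^sub>R \<kappa>11 m" for m
  define l2 where "l2 m = \<nu>2 m - (\<phi> m (\<nu>2 m) / e m) *\<^sub>R \<kappa>11 m" for m
  have e: "smooth_on U6 e" "\<And>m. m \<in> U6 \<Longrightarrow> e m \<noteq> 0"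
    unfolding e_def using s\<phi>[OF smooth_on_subset[OF s\<kappa>(1) U6(1,3)] U6(3)] by (auto simp: U6_def)
  note s6 = smooth_on_subset[OF s\<kappa>(1) U6(1,3)] smooth_on_subset[OF s\<kappa>(2) U6(1,3)] smooth_on_subset[OF s\<kappa>(3) U6(1,3)]
    smooth_on_subset[OF s\<nu>(1) U6(1,3)] smooth_on_subset[OF s\<nu>(2) U6(1,3)]
  have sadapted: "smooth_on U6 n" "smooth_on U6 k1" "smooth_on U6 k2" "smooth_on U6 l1" "smooth_on U6 l2"
    unfolding n_def k1_def k2_def l1_def l2_def
    by (intro smooth_on_diff smooth_on_scaleR smooth_on_divide smooth_on_const s\<phi> s6 e U6; assumption?)+
  define \<Phi> where "\<Phi> m u v = \<psi>1 m u * \<psi>2 m v - \<psi>1 m v * \<psi>2 m u" for m u v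
  \<comment> \<open>The \<open>radical_frame\<close> conditions are established only at points of
    \<open>N\<close>, whereas this formula makes sense on the open set \<open>U6\<close> and can be
    shown smooth there; on \<open>N\<close> it agrees with the locale constant.\<close>
  define \<zeta> where "\<zeta> m v = \<Phi> m (n m) v -
     (\<Phi> m (k1 m) (l2 m) * ext_deriv \<theta> (fst m) (v1 m) (curvature (n m) v) +
      \<Phi> m (k2 m) (l2 m) * ext_deriv \<theta> (fst m) (v2 m) (curvature (n m) v))" for m v
  have s\<Phi>: "smooth_on U6 (\<lambda>m. \<Phi> m (h m) (h' m))" if "smooth_on U6 h" "smooth_on U6 h'" for h h'
    unfolding \<Phi>_def \<psi>1_def \<psi>2_def
    by (intro smooth_on_diff smooth_on_mult smooth_on_inner that smooth_on_subset[OF s\<beta> U6(1,4)]) simp_all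
  have fstX: "fst ` U6 \<subseteq> X" using U6 U pc.fst_W by auto
  have sfst: "smooth_on U6 fst" by (rule smooth_on_subset[OF pc.smooth_fst_W U6(1)]) (use U6 U in auto)
  have s\<zeta>: "smooth_on U6 (\<lambda>m. \<zeta> m (h m))" if "smooth_on U6 h" for h
    unfolding \<zeta>_def
    by (intro smooth_on_diff smooth_on_add smooth_on_mult s\<Phi> sadapted that
        smooth_on_ext_deriv[OF c.smooth_theta sfst fstX] smooth_on_bilinear[OF bounded_bilinear_curvature]
        smooth_on_subset[OF sv(1) U6(1,3)] smooth_on_subset[OF sv(2) U6(1,3)])
  have rf: "radical_frame (cartan1 M C m) curvature (\<nu>1 m) (\<nu>2 m) (\<kappa>11 m) (\<kappa>12 m) (\<kappa>22 m) (F1 m) (F2 m)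
      (ext_deriv \<theta> (fst m) (v1 m)) (ext_deriv \<theta> (fst m) (v2 m)) (\<phi> m) (D m) (\<psi>1 m) (\<psi>2 m) (c1 m) (c2 m)"
    if m: "m \<in> N" "m \<in> U6" for m
  proof -
    have mP: "m \<in> prolong1 M C" and mU: "m \<in> U" "m \<in> U1" "m \<in> U5" "m \<in> U3" using m NP U6 U by auto
    interpret p: prolong_point M C X \<rho> \<theta> r0 W R a1 a2 m "F1 m" "F2 m" "w1 m" "w2 m" using mP mU by (intro pp) auto
    show ?thesis
    proof (rule radical_frame.intro[OF _ radical_frame_axioms.intro])
      show "curvature_frame (cartan1 M C m) curvature (\<nu>1 m) (\<nu>2 m) (\<kappa>11 m) (\<kappa>12 m) (\<kappa>22 m) (F1 m) (F2 m)
        (ext_deriv \<theta> (fst m) (v1 m)) (ext_deriv \<theta> (fst m) (v2 m)) (\<phi> m)"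
        using p.curvature_frame[OF lin\<phi>[OF mU(4)]] m(2) by (simp add: frame_defs U6_def)
      show "D m = {v \<in> cartan1 M C m. \<psi>1 m v = 0 \<and> \<psi>2 m v = 0}"
        by (rule kernel_of_dual_functionals[OF p.subspace_C1 p.dim_C1 _ dimD(2)[OF mP] dimD(1)[OF mP] lin\<psi> _ _ c_mem[OF mP mU(1)] \<psi>c[OF mU(3)]])
           (use \<psi>D[OF mU(3)] Dspan[OF mP mU(1)] in auto)
      fix L1 L2 assume L: "L1 \<in> {v \<in> cartan1 M C m. \<phi> m v = 0}" "L2 \<in> {v \<in> cartan1 M C m. \<phi> m v = 0}" "curvature L1 L2 = 0"
        "L1 - \<nu>1 m \<in> span {\<kappa>11 m, \<kappa>12 m, \<kappa>22 m}" "L2 - \<nu>2 m \<in> span {\<kappa>11 m, \<kappa>12 m, \<kappa>22 m}"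
      have vert: "fst u = 0" if "u \<in> span {\<kappa>11 m, \<kappa>12 m, \<kappa>22 m}" for u
      proof -
        have "span {\<kappa>11 m, \<kappa>12 m, \<kappa>22 m} \<subseteq> {u. fst u = 0}"
          by (intro span_minimal) (auto simp: frame_defs subspace_def)
        then show ?thesis using that by blast
      qed
      have "fst (\<nu>1 m) = v1 m" "fst (\<nu>2 m) = v2 m" using p.fst_nu by (simp_all only: frame_defs)
      then have fst: "fst L1 = snd m *v a1" "fst L2 = snd m *v a2"
        using vert[OF L(4)] vert[OF L(5)] by (simp_all add: v1_def v2_def)
      have lag: "lagrangian_plane2 M C m (span {L1, L2})" using L fst by (intro p.lagrangian_span) auto
      \<comment> \<open>The hypothesis \<open>meets\<close> speaks of points of
        \<open>prolong2\<close>, so the plane is realised as such a point.\<close>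
      from p.prolong2_exists[OF this] obtain z where z: "z \<in> prolong2 M C" "fst z = m" "plane2 z = span {L1, L2}" .
      have "differential N f (fst z) \<nu> = 0" if "\<nu> \<in> plane2 z" for \<nu>
      proof -
        have "subspace {v \<in> cartan1 M C m. \<phi> m v = 0}"
          using p.subspace_C1 lin\<phi>[OF mU(4)] by (auto simp: subspace_def linear_0 linear_add linear_scale)
        then have "span {L1, L2} \<subseteq> {v \<in> cartan1 M C m. \<phi> m v = 0}" using L(1,2) by (intro span_minimal) auto
        then have "\<nu> \<in> cartan1 M C m" "\<phi> m \<nu> = 0" using that z(3) by auto
        then show ?thesis using df[OF m(1) mU(4)] p.C1_iff z(2) by simp
      qed
      moreover have "fst z \<in> N" using z(2) m(1) by simp
      ultimately have "plane2 z \<inter> D (fst z) \<noteq> {0}" using z(1) by (intro meets)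
      moreover have "0 \<in> span {L1, L2} \<inter> D m" using Dspan[OF mP mU(1)] by (simp add: span_0)
      ultimately show "\<exists>r\<in>span {L1, L2}. r \<noteq> 0 \<and> r \<in> D m" unfolding z by blast
    qed (fact lin\<psi> c_mem[OF mP mU(1)] \<psi>c[OF mU(3)])+
  qed
  have loc: "\<zeta> m = radical_frame.\<zeta> curvature (\<nu>2 m) (\<kappa>11 m) (\<kappa>12 m) (\<kappa>22 m)
      (ext_deriv \<theta> (fst m) (v1 m)) (ext_deriv \<theta> (fst m) (v2 m)) (\<phi> m) (\<psi>1 m) (\<psi>2 m)" if "m \<in> N" "m \<in> U6" for m
  proof
    fix v
    interpret r: radical_frame "cartan1 M C m" curvature "\<nu>1 m" "\<nu>2 m" "\<kappa>11 m" "\<kappa>12 m" "\<kappa>22 m" "F1 m" "F2 m"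
      "ext_deriv \<theta> (fst m) (v1 m)" "ext_deriv \<theta> (fst m) (v2 m)" "\<phi> m" "D m" "\<psi>1 m" "\<psi>2 m" "c1 m" "c2 m"
      by (rule rf[OF that])
    show "\<zeta> m v = r.\<zeta> v"
      unfolding \<zeta>_def \<Phi>_def n_def k1_def k2_def l2_def e_def r.\<zeta>_def r.\<alpha>_def r.\<Phi>_def r.adapted_defs ..
  qed
  have E_eq: "E m = conjugate_distribution curvature (cartan1 M C m) {\<nu> \<in> cartan1 M C m. \<phi> m \<nu> = 0} (D m)"
    if m: "m \<in> N" "m \<in> U6" for m
  proof -
    have mP: "m \<in> prolong1 M C" and mU: "m \<in> U1" "m \<in> U3" using m NP U6 U by auto
    interpret p: prolong_point M C X \<rho> \<theta> r0 W R a1 a2 m "F1 m" "F2 m" "w1 m" "w2 m" using mP mU by (intro pp) auto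
    have "{\<nu> \<in> cartan1 M C m. differential N f m \<nu> = 0} = {\<nu> \<in> cartan1 M C m. \<phi> m \<nu> = 0}"
      using df[OF m(1) mU(2)] p.C1_iff by auto
    then show ?thesis unfolding E_def by simp
  qed
  have "\<zeta> m0 (l1 m0) \<noteq> 0 \<or> \<zeta> m0 (l2 m0) \<noteq> 0 \<or> \<zeta> m0 (k1 m0) \<noteq> 0 \<or> \<zeta> m0 (k2 m0) \<noteq> 0"
  proof -
    interpret r: radical_frame "cartan1 M C m0" curvature "\<nu>1 m0" "\<nu>2 m0" "\<kappa>11 m0" "\<kappa>12 m0" "\<kappa>22 m0" "F1 m0" "F2 m0"
      "ext_deriv \<theta> (fst m0) (v1 m0)" "ext_deriv \<theta> (fst m0) (v2 m0)" "\<phi> m0" "D m0" "\<psi>1 m0" "\<psi>2 m0" "c1 m0" "c2 m0"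
      by (rule rf[OF m0 U6(2)])
    show ?thesis unfolding loc[OF m0 U6(2)] l1_def l2_def k1_def k2_def e_def using r.zeta_nonzero[unfolded r.adapted_defs] .
  qed
  \<comment> \<open>Each tuple puts a possible pivot first. The one selected at \<open>m0\<close>
    serves a whole neighbourhood, since \<zeta> stays nonzero on it.\<close>
  then obtain h where h: "h \<in> {(l1, l2, k1, k2), (l2, l1, k1, k2), (k1, l1, l2, k2), (k2, l1, l2, k1)}" "\<zeta> m0 (fst h m0) \<noteq> 0"
    by fastforce
  obtain g0 g1 g2 g3 where gs: "h = (g0, g1, g2, g3)" by (metis prod.exhaust)
  have sg: "smooth_on U6 g0" "smooth_on U6 g1" "smooth_on U6 g2" "smooth_on U6 g3"
    using h(1) sadapted unfolding gs by auto
  have gset: "{g0 m, g1 m, g2 m, g3 m} = {l1 m, l2 m, k1 m, k2 m}" for m using h(1) unfolding gs by auto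
  define U7 where "U7 = {m \<in> U6. \<zeta> m (g0 m) \<noteq> 0}"
  have U7: "open U7" "m0 \<in> U7" "U7 \<subseteq> U6"
    unfolding U7_def using smooth_on_open_nonzero[OF s\<zeta>[OF sg(1)]] h(2) U6(2) gs by auto
  define K where "K i m = i m - (\<zeta> m (i m) / \<zeta> m (g0 m)) *\<^sub>R g0 m" for i m
  have sK: "smooth_on U7 (K i)" if "smooth_on U6 i" for i
    unfolding K_def
    by (intro smooth_on_diff smooth_on_scaleR smooth_on_divide smooth_on_subset[OF s\<zeta>[OF that] U7(1,3)]
        smooth_on_subset[OF s\<zeta>[OF sg(1)] U7(1,3)] smooth_on_subset[OF that U7(1,3)] smooth_on_subset[OF sg(1) U7(1,3)])
       (simp add: U7_def)
  show ?thesis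
  proof (rule that[OF U7(2) sK[OF sg(2)] sK[OF sg(3)] sK[OF sg(4)]])
    fix m assume m: "m \<in> N" "m \<in> U7"
    then have m6: "m \<in> U6" and nz: "\<zeta> m (g0 m) \<noteq> 0" by (auto simp: U7_def)
    interpret r: radical_frame "cartan1 M C m" curvature "\<nu>1 m" "\<nu>2 m" "\<kappa>11 m" "\<kappa>12 m" "\<kappa>22 m" "F1 m" "F2 m"
      "ext_deriv \<theta> (fst m) (v1 m)" "ext_deriv \<theta> (fst m) (v2 m)" "\<phi> m" "D m" "\<psi>1 m" "\<psi>2 m" "c1 m" "c2 m"
      by (rule rf[OF m(1) m6])
    have set: "{g0 m, g1 m, g2 m, g3 m} = {r.l1, r.l2, r.k1, r.k2}"
      unfolding gset l1_def l2_def k1_def k2_def e_def r.adapted_defs ..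
    note kf = r.kernel_frame[OF set nz[unfolded loc[OF m(1) m6]], folded loc[OF m(1) m6] E_eq[OF m(1) m6]]
    show "E m = span {K g1 m, K g2 m, K g3 m}" unfolding K_def by (rule kf(1))
    show "dim (E m) = 3" by (rule kf(2))
  next
    fix z assume z: "z \<in> prolong2 M C" "fst z \<in> N" "fst z \<in> U7"
    define m where "m = fst z"
    have m: "m \<in> N" "m \<in> U6" "m \<in> prolong1 M C" "m \<in> U1" using z U7 U6 U NP by (auto simp: m_def)
    interpret r: radical_frame "cartan1 M C m" curvature "\<nu>1 m" "\<nu>2 m" "\<kappa>11 m" "\<kappa>12 m" "\<kappa>22 m" "F1 m" "F2 m"
      "ext_deriv \<theta> (fst m) (v1 m)" "ext_deriv \<theta> (fst m) (v2 m)" "\<phi> m" "D m" "\<psi>1 m" "\<psi>2 m" "c1 m" "c2 m"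
      by (rule rf[OF m(1,2)])
    interpret p: prolong_point M C X \<rho> \<theta> r0 W R a1 a2 m "F1 m" "F2 m" "w1 m" "w2 m" using m by (intro pp) auto
    have "lagrangian_plane2 M C m (plane2 z)" using prolong2_lagrangian[OF z(1)] by (simp add: m_def)
    then show "plane2 z \<inter> E (fst z) \<noteq> {0} \<longleftrightarrow> plane2 z \<inter> D (fst z) \<noteq> {0}"
      unfolding m_def[symmetric] E_eq[OF m(1,2)] p.lagrangian_plane2_iff
      by (intro r.conjugate_distribution_meets) auto
  qed
qed

theorem proposition7p4:
  fixes M :: "(real^'n) set"
    and C :: "real^'n \<Rightarrow> (real^'n) set"
    and E :: "('n::finite) space2 set"
    and N :: "'n space1 set"
    and f :: "'n space1 \<Rightarrow> real"
  assumes "contact_manifold5 M C"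
    and "goursat_pde M C E"
    and "openin (top_of_set (prolong1 M C)) N"
    and "smooth_fun N f"
    and "\<forall>m\<in>N. nonsingular_at M C N f m"
  shows "intermediate_integral M C N f E \<longleftrightarrow>
    (\<exists>D. subdistribution3 M C N D \<and> first_integral N f D \<and>
         goursat_locus M C N D = {z \<in> E. fst z \<in> N})"
proof
  assume int: "intermediate_integral M C N f E"
  obtain D where D: "subdistribution3 M C (prolong1 M C) D" "E = goursat_locus M C (prolong1 M C) D"
    using assms(2) unfolding goursat_pde_def by blast
  have NP: "N \<subseteq> prolong1 M C" using assms(3) openin_imp_subset by blast
  have meets: "plane2 z \<inter> D (fst z) \<noteq> {0}"
    if z: "z \<in> prolong2 M C" "fst z \<in> N" "\<And>\<nu>. \<nu> \<in> plane2 z \<Longrightarrow> differential N f (fst z) \<nu> = 0" for z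
  proof -
    \<comment> \<open>Each point lies on the level set of its own value, so the constant is taken to
      be \<open>f (fst z)\<close>.\<close>
    have "z \<in> level_prolongation M C N f (f (fst z))" using z by (simp add: level_prolongation_def)
    then have "z \<in> E" using int unfolding intermediate_integral_def by blast
    then show ?thesis unfolding D(2) goursat_locus_def by blast
  qed
  \<comment> \<open>A single formula over all of \<open>N\<close>; the local frames enter only in
    verifying dimension, smoothness and locus.\<close>
  define D' where "D' m = conjugate_distribution curvature (cartan1 M C m)
      {\<nu> \<in> cartan1 M C m. differential N f m \<nu> = 0} (D m)" for m
  have D'_sub: "D' m \<subseteq> {\<nu> \<in> cartan1 M C m. differential N f m \<nu> = 0}" for m
    unfolding D'_def conjugate_distribution_def by blast
  have loc: "\<exists>U X Y Z. m \<in> U \<and> smooth_on U X \<and> smooth_on U Y \<and> smooth_on U Z \<and>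
      (\<forall>y\<in>N \<inter> U. D' y = span {X y, Y y, Z y} \<and> dim (D' y) = 3) \<and>
      (\<forall>z\<in>prolong2 M C. fst z \<in> N \<inter> U \<longrightarrow> (plane2 z \<inter> D' (fst z) \<noteq> {0} \<longleftrightarrow> plane2 z \<inter> D (fst z) \<noteq> {0}))"
    if m: "m \<in> N" for m
  proof -
    have "nonsingular_at M C N f m" using assms(5) m by blast
    from local_conjugate_distribution[OF assms(1,3,4) m this D(1) meets, folded D'_def]
    obtain U X Y Z where "m \<in> U" "smooth_on U X" "smooth_on U Y" "smooth_on U Z"
      "\<And>m. m \<in> N \<Longrightarrow> m \<in> U \<Longrightarrow> D' m = span {X m, Y m, Z m}" "\<And>m. m \<in> N \<Longrightarrow> m \<in> U \<Longrightarrow> dim (D' m) = 3"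
      "\<And>z. z \<in> prolong2 M C \<Longrightarrow> fst z \<in> N \<Longrightarrow> fst z \<in> U \<Longrightarrow>
        plane2 z \<inter> D' (fst z) \<noteq> {0} \<longleftrightarrow> plane2 z \<inter> D (fst z) \<noteq> {0}"
      by blast
    then show ?thesis by (intro exI[of _ U] exI[of _ X] exI[of _ Y] exI[of _ Z]) blast
  qed
  have "subdistribution3 M C N D'"
    unfolding subdistribution3_def
  proof (intro conjI ballI)
    fix m assume m: "m \<in> N"
    show "dim (D' m) = 3" using loc[OF m] m by blast
    show "D' m \<subseteq> cartan1 M C m" using D'_sub by blast
    show "\<exists>U X Y Z. m \<in> U \<and> smooth_on U X \<and> smooth_on U Y \<and> smooth_on U Z \<and>
        (\<forall>y\<in>N \<inter> U. D' y = span {X y, Y y, Z y})" using loc[OF m] by blast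
  qed
  moreover have "first_integral N f D'" unfolding first_integral_def using D'_sub by blast
  moreover have "goursat_locus M C N D' = {z \<in> E. fst z \<in> N}"
  proof -
    have "plane2 z \<inter> D' (fst z) \<noteq> {0} \<longleftrightarrow> plane2 z \<inter> D (fst z) \<noteq> {0}" if "z \<in> prolong2 M C" "fst z \<in> N" for z
      using loc[OF that(2)] that by blast
    then show ?thesis unfolding D(2) goursat_locus_def using NP by blast
  qed
  ultimately show "\<exists>D. subdistribution3 M C N D \<and> first_integral N f D \<and>
         goursat_locus M C N D = {z \<in> E. fst z \<in> N}" by blast
next
  assume "\<exists>D. subdistribution3 M C N D \<and> first_integral N f D \<and>
         goursat_locus M C N D = {z \<in> E. fst z \<in> N}"
  then obtain D where D: "subdistribution3 M C N D" "first_integral N f D"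
    "goursat_locus M C N D = {z \<in> E. fst z \<in> N}" by blast
  show "intermediate_integral M C N f E"
    unfolding intermediate_integral_def
  proof (intro allI subsetI)
    fix c z assume "z \<in> level_prolongation M C N f c"
    then have z: "z \<in> prolong2 M C" "fst z \<in> N" "\<And>\<nu>. \<nu> \<in> plane2 z \<Longrightarrow> differential N f (fst z) \<nu> = 0"
      by (auto simp: level_prolongation_def)
    \<comment> \<open>That \<open>D\<close> has subspaces as values is contained only in the local
      frame condition, since \<open>dim\<close> is defined for arbitrary sets.\<close>
    have "\<exists>X Y Z. D (fst z) = span {X, Y, Z}"
      using D(1) z(2) unfolding subdistribution3_def by blast
    then have sub: "subspace (D (fst z))" by auto
    have "plane2 z \<inter> D (fst z) \<noteq> {0}"
    proof (rule level_prolongation_meets[OF assms(1,3,4) _ z sub])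
      show "nonsingular_at M C N f (fst z)" using assms(5) z(2) by blast
      show "dim (D (fst z)) = 3" "D (fst z) \<subseteq> cartan1 M C (fst z)"
        using D(1) z(2) unfolding subdistribution3_def by blast+
      show "differential N f (fst z) \<nu> = 0" if "\<nu> \<in> D (fst z)" for \<nu>
        using D(2) z(2) that unfolding first_integral_def by blast
    qed
    then have "z \<in> goursat_locus M C N D" using z by (simp add: goursat_locus_def)
    then show "z \<in> E" using D(3) by blast
  qed
qed

end
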